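(* Let $r\ge2$, $q=e^{\pi\sqrt{-1}/r}$, $\epsilon\in(-\frac12,\frac12)$, $i\in\{0,\dots,r-2\}$ and $\ell\in\mathbb Z$. Let $X_\epsilon$ be the $\overline U_q^H(\mathfrak{sl}_2)$-module with vector space basis $$\{w^L_{i+2-2r},w^L_{i+4-2r},\dots,w^L_{-i-2},\ w^H_{-i},w^H_{-i+2},\dots,w^H_i,\ w^S_{-i},\dots,w^S_i,\ w^R_{i+2},w^R_{i+4},\dots,w^R_{2r-2-i}\}$$ (indices in each string increasing by $2$) and action - $Hw_k^X=(k+\ell r+\epsilon)w_k^X$, $Kw_k^X=(-1)^\ell q^{k+\epsilon}w_k^X$ for $X\in\{L,H,S,R\}$; - $w^R_{i+2}=(-1)^\ell Ew^H_i$, $w^L_{-i-2}=Fw^H_{-i}$, $Fw^R_{i+2}=w_i^S+[1+i][\epsilon]w_i^H$; - $w^H_{i-2k}=F^kw^H_i$ and $w^S_{i-2k}=F^kw_i^S$ for $0\le k\le i$; $w^L_{-i-2-2k}=F^kw^L_{-i-2}$ and $w^R_{i+2+2k}=(-1)^{k\ell}E^kw^R_{i+2}$ for $0\le k\le r-2-i$ (so $Fw_k^X=w_{k-2}^X$ for $X\in\{L,S,H\}$ and $Ew_k^R=(-1)^\ell w_{k+2}^R$ whenever both vectors belong to the basis); - $Fw^S_{-i}=-[1+i][\epsilon]w^L_{-i-2}$, $Ew_i^S=2(-1)^{\ell+1}[1+i][\epsilon]w^R_{i+2}$, $Ew^R_{2r-2-i}=Fw^L_{i+2-2r}=0$; -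 $Ew^L_{-i-2}=2(-1)^\ell[i+1][\epsilon]w^H_{-i}+(-1)^\ell w^S_{-i}$; - for $1\le k\le r-2-i$: $Ew^L_{-i-2-2k}=(-1)^{\ell+1}[1+i+k][k-\epsilon]w^L_{-i-2-2(k-1)}$ and $Fw^R_{i+2+2k}=-[1+i+k][k+\epsilon]w^R_{i+2+2(k-1)}$; - for $1\le k\le i$: $$Ew^H_{i-2k}=\big(2[1+i-k+\epsilon][k]-[1+i-k][k-\epsilon]\big)(-1)^\ell w^H_{i-2(k-1)}+(-1)^\ell w^S_{i-2(k-1)},$$ $$Ew^S_{i-2k}=\big(2[1+i-k][k-\epsilon]-[1+i-k+\epsilon][k]\big)(-1)^\ell w^S_{i-2(k-1)}+2(-1)^{\ell+1}[1+i]^2[\epsilon]^2w^H_{i-2(k-1)}.$$ Then $$X_\epsilon\cong\begin{cases}V_{1+i-r+\ell r+\epsilon}\oplus V_{-1-i+r+\ell r+\epsilon}&\text{if }\epsilon\ne0,\\ P_i\otimes\mathbb C^H_{\ell r}&\text{if }\epsilon=0.\end{cases}$$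
   Context: $q^z=e^{\pi\sqrt{-1}z/r}$, $\{z\}=q^z-q^{-z}$, $[z]=\{z\}/\{1\}$. $\overline U_q^H(\mathfrak{sl}_2)$ is the unital algebra generated by $E,F,K^{\pm1},H$ with $KE=q^2EK$, $KF=q^{-2}FK$, $HK=KH$, $[H,E]=2E$, $[H,F]=-2F$, $[E,F]=\frac{K-K^{-1}}{q-q^{-1}}$, $E^r=F^r=0$, with coproduct $\Delta(E)=1\otimes E+E\otimes K$, $\Delta(F)=K^{-1}\otimes F+F\otimes1$, $\Delta(K)=K\otimes K$, $\Delta(H)=1\otimes H+H\otimes1$. A weight module is a finite-dimensional module on which $H$ is diagonalizable and $K=q^H$; $\mathcal C$ is the category of weight modules. $V_\alpha$ ($\alpha\in\mathbb C$) has basis $v_0,\dots,v_{r-1}$ with $Hv_n=(\alpha+r-1-2n)v_n$, $Ev_n=[n][n-\alpha]v_{n-1}$, $Fv_n=v_{n+1}$, $v_{-1}=v_r=0$. $S_i$ is the simple module of dimension $i+1$ with highest weight $i$. $\mathbb C^H_{\ell r}$ is one-dimensional with $E=F=0$, $H=\ell r$. $P_i$ ($0\le i\le r-2$) is the projective cover of $S_i$ in $\mathcal C$. *)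

theory Defs
  imports Complex_Main "HOL-Library.Function_Algebras"
begin

section \<open>Free complex vector spaces on finite sets\<close>

type_synonym 'a vec = "'a \<Rightarrow> complex"

definition scale :: "complex \<Rightarrow> 'a vec \<Rightarrow> 'a vec" (infixr \<open>*\<^sub>c\<close> 75) where
  "c *\<^sub>c v = (\<lambda>a. c * v a)"

definition bvec :: "'a \<Rightarrow> 'a vec" where
  "bvec a = (\<lambda>b. if b = a then 1 else 0)"

interpretation cvec: vector_space "scale :: complex \<Rightarrow> 'a vec \<Rightarrow> 'a vec"
  by unfold_locales (auto simp: scale_def fun_eq_iff algebra_simps)

definition free_space :: "'a set \<Rightarrow> 'a vec set" where
  "free_space B = {v. \<forall>a. a \<notin> B \<longrightarrow> v a = 0}"

definition lin_ext :: "'a set \<Rightarrow> ('a \<Rightarrow> 'b vec) \<Rightarrow> 'a vec \<Rightarrow> 'b vec" where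
  "lin_ext B f v = (\<Sum>b\<in>B. v b *\<^sub>c f b)"

section \<open>Quantum numbers\<close>

definition qpow :: "nat \<Rightarrow> complex \<Rightarrow> complex" where
  "qpow r z = exp (of_real pi * \<i> * z / of_nat r)"

definition qbr :: "nat \<Rightarrow> complex \<Rightarrow> complex" where
  "qbr r z = qpow r z - qpow r (- z)"

definition qnum :: "nat \<Rightarrow> complex \<Rightarrow> complex" where
  "qnum r z = qbr r z / qbr r 1"

section \<open>Finite-dimensional modules over the unrolled quantum group\<close>

text \<open>
  A module over an algebra given by generators and relations is a vector space with one linear
  operator per generator, subject to the relations. All modules occurring here are
  finite-dimensional and are presented on a chosen finite basis: the underlying vector space is
  the free space on the set \<open>basis\<close>, and each generator is given by the images of the basis
  vectors. Submodules and homomorphisms do not refer to the basis.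
\<close>

record 'a qmod =
  basis :: "'a set"
  actE :: "'a \<Rightarrow> 'a vec"
  actF :: "'a \<Rightarrow> 'a vec"
  actK :: "'a \<Rightarrow> 'a vec"
  actKi :: "'a \<Rightarrow> 'a vec"   \<comment> \<open>the generator \<open>K\<^sup>-\<^sup>1\<close>\<close>
  actH :: "'a \<Rightarrow> 'a vec"

definition vspace :: "'a qmod \<Rightarrow> 'a vec set" where
  "vspace M = free_space (basis M)"

definition opE :: "'a qmod \<Rightarrow> 'a vec \<Rightarrow> 'a vec" where "opE M = lin_ext (basis M) (actE M)"
definition opF :: "'a qmod \<Rightarrow> 'a vec \<Rightarrow> 'a vec" where "opF M = lin_ext (basis M) (actF M)"
definition opK :: "'a qmod \<Rightarrow> 'a vec \<Rightarrow> 'a vec" where "opK M = lin_ext (basis M) (actK M)"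
definition opKi :: "'a qmod \<Rightarrow> 'a vec \<Rightarrow> 'a vec" where "opKi M = lin_ext (basis M) (actKi M)"
definition opH :: "'a qmod \<Rightarrow> 'a vec \<Rightarrow> 'a vec" where "opH M = lin_ext (basis M) (actH M)"

definition uqH_module :: "nat \<Rightarrow> 'a qmod \<Rightarrow> bool" where
  "uqH_module r M \<longleftrightarrow>
     finite (basis M) \<and>
     (\<forall>b\<in>basis M. actE M b \<in> vspace M \<and> actF M b \<in> vspace M \<and> actK M b \<in> vspace M \<and>
        actKi M b \<in> vspace M \<and> actH M b \<in> vspace M) \<and>
     (\<forall>v\<in>vspace M.
        opK M (opKi M v) = v \<and> opKi M (opK M v) = v \<and>
        opK M (opE M v) = qpow r 2 *\<^sub>c opE M (opK M v) \<and>
        opK M (opF M v) = qpow r (-2) *\<^sub>c opF M (opK M v) \<and>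
        opH M (opK M v) = opK M (opH M v) \<and>
        opH M (opE M v) - opE M (opH M v) = 2 *\<^sub>c opE M v \<and>
        opH M (opF M v) - opF M (opH M v) = (-2) *\<^sub>c opF M v \<and>
        opE M (opF M v) - opF M (opE M v)
          = (1 / (qpow r 1 - qpow r (-1))) *\<^sub>c (opK M v - opKi M v) \<and>
        (opE M ^^ r) v = 0 \<and> (opF M ^^ r) v = 0)"

text \<open>On a space where \<open>H\<close> is diagonalizable, \<open>K = q\<^sup>H\<close> means that \<open>K\<close> acts by \<open>q\<^sup>\<mu>\<close> on every
  \<open>H\<close>-eigenvector of eigenvalue \<open>\<mu>\<close>.\<close>

definition weight_module :: "nat \<Rightarrow> 'a qmod \<Rightarrow> bool" where
  "weight_module r M \<longleftrightarrow>
     uqH_module r M \<and>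
     vspace M = cvec.span {v \<in> vspace M. \<exists>\<mu>. opH M v = \<mu> *\<^sub>c v} \<and>
     (\<forall>v\<in>vspace M. \<forall>\<mu>. opH M v = \<mu> *\<^sub>c v \<longrightarrow> opK M v = qpow r \<mu> *\<^sub>c v)"

definition mod_hom :: "'a qmod \<Rightarrow> 'b qmod \<Rightarrow> ('a vec \<Rightarrow> 'b vec) \<Rightarrow> bool" where
  "mod_hom M N f \<longleftrightarrow>
     (\<forall>v\<in>vspace M. f v \<in> vspace N) \<and>
     (\<forall>v\<in>vspace M. \<forall>w\<in>vspace M. f (v + w) = f v + f w) \<and>
     (\<forall>c. \<forall>v\<in>vspace M. f (c *\<^sub>c v) = c *\<^sub>c f v) \<and>
     (\<forall>v\<in>vspace M. f (opE M v) = opE N (f v) \<and> f (opF M v) = opF N (f v) \<and>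
        f (opK M v) = opK N (f v) \<and> f (opKi M v) = opKi N (f v) \<and> f (opH M v) = opH N (f v))"

definition mod_iso :: "'a qmod \<Rightarrow> 'b qmod \<Rightarrow> bool" (infix \<open>\<cong>\<^sub>m\<close> 50) where
  "M \<cong>\<^sub>m N \<longleftrightarrow> (\<exists>f. mod_hom M N f \<and> bij_betw f (vspace M) (vspace N))"

definition submod :: "'a qmod \<Rightarrow> 'a vec set \<Rightarrow> bool" where
  "submod M U \<longleftrightarrow>
     U \<subseteq> vspace M \<and> cvec.subspace U \<and>
     (\<forall>v\<in>U. opE M v \<in> U \<and> opF M v \<in> U \<and> opK M v \<in> U \<and> opKi M v \<in> U \<and> opH M v \<in> U)"

definition simple_mod :: "'a qmod \<Rightarrow> bool" where
  "simple_mod M \<longleftrightarrow> vspace M \<noteq> {0} \<and> (\<forall>U. submod M U \<longrightarrow> U = {0} \<or> U = vspace M)"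

section \<open>Direct sums and tensor products\<close>

definition inl_vec :: "'a vec \<Rightarrow> ('a + 'b) vec" where
  "inl_vec u = (\<lambda>x. case x of Inl a \<Rightarrow> u a | Inr b \<Rightarrow> 0)"

definition inr_vec :: "'b vec \<Rightarrow> ('a + 'b) vec" where
  "inr_vec u = (\<lambda>x. case x of Inl a \<Rightarrow> 0 | Inr b \<Rightarrow> u b)"

definition sum_act :: "('a \<Rightarrow> 'a vec) \<Rightarrow> ('b \<Rightarrow> 'b vec) \<Rightarrow> 'a + 'b \<Rightarrow> ('a + 'b) vec" where
  "sum_act f g x = (case x of Inl a \<Rightarrow> inl_vec (f a) | Inr b \<Rightarrow> inr_vec (g b))"

definition direct_sum :: "'a qmod \<Rightarrow> 'b qmod \<Rightarrow> ('a + 'b) qmod" (infixr \<open>\<oplus>\<^sub>m\<close> 65) where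
  "M \<oplus>\<^sub>m N =
     \<lparr> basis = basis M <+> basis N,
       actE = sum_act (actE M) (actE N),
       actF = sum_act (actF M) (actF N),
       actK = sum_act (actK M) (actK N),
       actKi = sum_act (actKi M) (actKi N),
       actH = sum_act (actH M) (actH N) \<rparr>"

definition tensor_vec :: "'a vec \<Rightarrow> 'b vec \<Rightarrow> ('a \<times> 'b) vec" (infixr \<open>\<otimes>\<^sub>v\<close> 70) where
  "u \<otimes>\<^sub>v v = (\<lambda>(a, b). u a * v b)"

text \<open>The action on a tensor product is through the coproduct
  \<open>E \<mapsto> 1 \<otimes> E + E \<otimes> K\<close>, \<open>F \<mapsto> K\<^sup>-\<^sup>1 \<otimes> F + F \<otimes> 1\<close>, \<open>K \<mapsto> K \<otimes> K\<close>, \<open>H \<mapsto> 1 \<otimes> H + H \<otimes> 1\<close>.\<close>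

definition tensor_mod :: "'a qmod \<Rightarrow> 'b qmod \<Rightarrow> ('a \<times> 'b) qmod" (infixr \<open>\<otimes>\<^sub>m\<close> 70) where
  "M \<otimes>\<^sub>m N =
     \<lparr> basis = basis M \<times> basis N,
       actE = (\<lambda>(a, b). bvec a \<otimes>\<^sub>v actE N b + actE M a \<otimes>\<^sub>v actK N b),
       actF = (\<lambda>(a, b). actKi M a \<otimes>\<^sub>v actF N b + actF M a \<otimes>\<^sub>v bvec b),
       actK = (\<lambda>(a, b). actK M a \<otimes>\<^sub>v actK N b),
       actKi = (\<lambda>(a, b). actKi M a \<otimes>\<^sub>v actKi N b),
       actH = (\<lambda>(a, b). bvec a \<otimes>\<^sub>v actH N b + actH M a \<otimes>\<^sub>v bvec b) \<rparr>"

section \<open>The category of weight modules\<close>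

text \<open>Every finite-dimensional module is isomorphic to one whose basis is a set of natural
  numbers, so testing projectivity on modules of type \<open>nat qmod\<close> is no restriction.\<close>

definition projective_in_C :: "nat \<Rightarrow> 'a qmod \<Rightarrow> bool" where
  "projective_in_C r P \<longleftrightarrow>
     weight_module r P \<and>
     (\<forall>(M :: nat qmod) (N :: nat qmod) g f.
        weight_module r M \<and> weight_module r N \<and> mod_hom M N g \<and> g ` vspace M = vspace N \<and>
        mod_hom P N f \<longrightarrow>
        (\<exists>h. mod_hom P M h \<and> (\<forall>v\<in>vspace P. g (h v) = f v)))"

definition projective_cover :: "nat \<Rightarrow> 'a qmod \<Rightarrow> 'b qmod \<Rightarrow> bool" where
  "projective_cover r P S \<longleftrightarrow>
     projective_in_C r P \<and> weight_module r S \<and>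
     (\<exists>p. mod_hom P S p \<and> p ` vspace P = vspace S \<and>
        (\<forall>U. submod P U \<and>
           vspace P = {u + k | u k. u \<in> U \<and> k \<in> vspace P \<and> p k = 0} \<longrightarrow> U = vspace P))"

section \<open>The modules \<open>V\<^sub>\<alpha>\<close>, \<open>S\<^sub>i\<close>, \<open>\<complex>\<^sup>H\<close> and \<open>X\<^sub>\<epsilon>\<close>\<close>

definition V_mod :: "nat \<Rightarrow> complex \<Rightarrow> nat qmod" where
  "V_mod r \<alpha> =
     \<lparr> basis = {..<r},
       actE = (\<lambda>n. if n = 0 then 0 else (qnum r (of_nat n) * qnum r (of_nat n - \<alpha>)) *\<^sub>c bvec (n - 1)),
       actF = (\<lambda>n. if n = r - 1 then 0 else bvec (n + 1)),
       actK = (\<lambda>n. qpow r (\<alpha> + of_nat r - 1 - 2 * of_nat n) *\<^sub>c bvec n),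
       actKi = (\<lambda>n. qpow r (- (\<alpha> + of_nat r - 1 - 2 * of_nat n)) *\<^sub>c bvec n),
       actH = (\<lambda>n. (\<alpha> + of_nat r - 1 - 2 * of_nat n) *\<^sub>c bvec n) \<rparr>"

text \<open>\<open>is_S r i S\<close>: \<open>S\<close> is a copy of \<open>S\<^sub>i\<close>, the simple weight module of dimension \<open>i + 1\<close> with
  highest weight \<open>i\<close>.\<close>

definition is_S :: "nat \<Rightarrow> nat \<Rightarrow> 'a qmod \<Rightarrow> bool" where
  "is_S r i S \<longleftrightarrow>
     weight_module r S \<and> simple_mod S \<and> card (basis S) = i + 1 \<and>
     (\<exists>v\<in>vspace S. v \<noteq> 0 \<and> opE S v = 0 \<and> opH S v = of_nat i *\<^sub>c v)"

text \<open>\<open>CH_mod r l\<close> is the one-dimensional module \<open>\<complex>\<^sup>H\<close> of weight \<open>l r\<close>.\<close>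

definition CH_mod :: "nat \<Rightarrow> int \<Rightarrow> unit qmod" where
  "CH_mod r l =
     \<lparr> basis = UNIV,
       actE = (\<lambda>_. 0),
       actF = (\<lambda>_. 0),
       actK = (\<lambda>b. qpow r (of_int l * of_nat r) *\<^sub>c bvec b),
       actKi = (\<lambda>b. qpow r (- (of_int l * of_nat r)) *\<^sub>c bvec b),
       actH = (\<lambda>b. (of_int l * of_nat r) *\<^sub>c bvec b) \<rparr>"

text \<open>
  The basis vectors of \<open>X\<^sub>\<epsilon>\<close> are numbered inside their strings in the order in which
  successive powers of \<open>F\<close> (for \<open>L\<close>, \<open>H\<close>, \<open>S\<close>) or of \<open>E\<close> (for \<open>R\<close>) produce them:
  \<open>wL k\<close>, \<open>wH k\<close>, \<open>wS k\<close>, \<open>wR k\<close> stand for the vectors \<open>w\<^sup>L\<close> of index \<open>-i-2-2k\<close>, \<open>w\<^sup>H\<close> and \<open>w\<^sup>S\<close> of index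
  \<open>i-2k\<close>, and \<open>w\<^sup>R\<close> of index \<open>i+2+2k\<close>; the function \<open>x_index\<close> returns the index.
\<close>

datatype x_label = wL nat | wH nat | wS nat | wR nat

fun x_index :: "nat \<Rightarrow> x_label \<Rightarrow> int" where
  "x_index i (wL k) = - int i - 2 - 2 * int k"
| "x_index i (wH k) = int i - 2 * int k"
| "x_index i (wS k) = int i - 2 * int k"
| "x_index i (wR k) = int i + 2 + 2 * int k"

fun x_E :: "nat \<Rightarrow> nat \<Rightarrow> int \<Rightarrow> complex \<Rightarrow> x_label \<Rightarrow> x_label vec" where
  "x_E r i l \<epsilon> (wL k) =
     (if k = 0 then
        (2 * (-1) powi l * qnum r (of_nat i + 1) * qnum r \<epsilon>) *\<^sub>c bvec (wH i)
        + ((-1) powi l) *\<^sub>c bvec (wS i)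
      else ((-1) powi (l + 1) * qnum r (1 + of_nat i + of_nat k) * qnum r (of_nat k - \<epsilon>))
             *\<^sub>c bvec (wL (k - 1)))"
| "x_E r i l \<epsilon> (wH k) =
     (if k = 0 then ((-1) powi l) *\<^sub>c bvec (wR 0)
      else ((2 * qnum r (1 + of_nat i - of_nat k + \<epsilon>) * qnum r (of_nat k)
               - qnum r (1 + of_nat i - of_nat k) * qnum r (of_nat k - \<epsilon>)) * (-1) powi l)
             *\<^sub>c bvec (wH (k - 1))
           + ((-1) powi l) *\<^sub>c bvec (wS (k - 1)))"
| "x_E r i l \<epsilon> (wS k) =
     (if k = 0 then (2 * (-1) powi (l + 1) * qnum r (1 + of_nat i) * qnum r \<epsilon>) *\<^sub>c bvec (wR 0)
      else ((2 * qnum r (1 + of_nat i - of_nat k) * qnum r (of_nat k - \<epsilon>)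
               - qnum r (1 + of_nat i - of_nat k + \<epsilon>) * qnum r (of_nat k)) * (-1) powi l)
             *\<^sub>c bvec (wS (k - 1))
           + (2 * (-1) powi (l + 1) * (qnum r (1 + of_nat i))\<^sup>2 * (qnum r \<epsilon>)\<^sup>2) *\<^sub>c bvec (wH (k - 1)))"
| "x_E r i l \<epsilon> (wR k) = (if k = r - 2 - i then 0 else ((-1) powi l) *\<^sub>c bvec (wR (k + 1)))"

fun x_F :: "nat \<Rightarrow> nat \<Rightarrow> complex \<Rightarrow> x_label \<Rightarrow> x_label vec" where
  "x_F r i \<epsilon> (wL k) = (if k = r - 2 - i then 0 else bvec (wL (k + 1)))"
| "x_F r i \<epsilon> (wH k) = (if k = i then bvec (wL 0) else bvec (wH (k + 1)))"
| "x_F r i \<epsilon> (wS k) =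
     (if k = i then (- qnum r (1 + of_nat i) * qnum r \<epsilon>) *\<^sub>c bvec (wL 0) else bvec (wS (k + 1)))"
| "x_F r i \<epsilon> (wR k) =
     (if k = 0 then bvec (wS 0) + (qnum r (1 + of_nat i) * qnum r \<epsilon>) *\<^sub>c bvec (wH 0)
      else (- qnum r (1 + of_nat i + of_nat k) * qnum r (of_nat k + \<epsilon>)) *\<^sub>c bvec (wR (k - 1)))"

definition X_mod :: "nat \<Rightarrow> nat \<Rightarrow> int \<Rightarrow> complex \<Rightarrow> x_label qmod" where
  "X_mod r i l \<epsilon> =
     \<lparr> basis = wL ` {0..r - 2 - i} \<union> wH ` {0..i} \<union> wS ` {0..i} \<union> wR ` {0..r - 2 - i},
       actE = x_E r i l \<epsilon>,
       actF = x_F r i \<epsilon>,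
       actK = (\<lambda>x. ((-1) powi l * qpow r (of_int (x_index i x) + \<epsilon>)) *\<^sub>c bvec x),
       actKi = (\<lambda>x. ((-1) powi l * qpow r (- (of_int (x_index i x) + \<epsilon>))) *\<^sub>c bvec x),
       actH = (\<lambda>x. (of_int (x_index i x) + of_int l * of_nat r + \<epsilon>) *\<^sub>c bvec x) \<rparr>"

end

theory Submission
  imports Defs
begin

text \<open>
  The relations of the algebra are checked on the basis of \<open>X\<close>; every coefficient identity
  reduces to \<open>{x} {y} = c (x + y) - c (x - y)\<close> with \<open>c z = q\<^sup>z + q\<^sup>-\<^sup>z\<close>.

  For \<open>\<epsilon> \<noteq> 0\<close> put \<open>a = [1+i][\<epsilon>] \<noteq> 0\<close>. The vectors \<open>2 a w\<^sup>H\<^sub>i + w\<^sup>S\<^sub>i\<close> and \<open>w\<^sup>R\<close> of top index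
  are killed by \<open>E\<close>, so each generates an image of a module \<open>V\<^sub>\<alpha>\<close>, and together the powers of \<open>F\<close>
  applied to them form a basis of \<open>X\<close>.

  For \<open>\<epsilon> = 0\<close> the module with \<open>l = 0\<close> is generated by \<open>w\<^sup>H\<^sub>i\<close>, and a vector \<open>y\<close> of weight \<open>i\<close> in any
  module satisfies the relations of \<open>w\<^sup>H\<^sub>i\<close> as soon as \<open>T\<^sup>2 y = 0\<close> for \<open>T = F E\<close>. On weight \<open>i\<close> one has
  \<open>0 = F\<^sup>r E\<^sup>r = \<Prod>\<^sub>j (T - \<kappa>\<^sub>j)\<close> with \<open>\<kappa>\<^sub>j = [j][i+1+j]\<close>, which vanishes exactly for \<open>j = 0\<close> and
  \<open>j = r-1-i\<close>; applying the other factors to a lift of the highest weight vector of \<open>S\<^sub>i\<close> to \<open>P\<^sub>i\<close>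
  gives such a \<open>y\<close>, hence a map \<open>k\<close> from \<open>X\<close> to \<open>P\<^sub>i\<close>, which is onto because the cover is essential.
  Projectivity gives a map \<open>h\<close> back over \<open>S\<^sub>i\<close>, and \<open>h k\<close> sends \<open>w\<^sup>H\<^sub>i\<close> to \<open>w\<^sup>H\<^sub>i + d w\<^sup>S\<^sub>i\<close>, so it is
  unipotent and \<open>k\<close> is injective.
\<close>

section \<open>Linear maps given on bases\<close>

abbreviation clin :: "('a vec \<Rightarrow> 'b vec) \<Rightarrow> bool" where
  "clin \<equiv> module_hom scale scale"

lemma clinI:
  assumes "\<And>v w. f (v + w) = f v + f w" "\<And>c v. f (c *\<^sub>c v) = c *\<^sub>c f v"
  shows "clin f"
  using assms by unfold_locales auto

lemma scale_apply [simp]: "(c *\<^sub>c v) a = c * v a"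
  by (simp add: scale_def)

lemma sum_fun_apply [simp]: "(\<Sum>x\<in>A. f x) a = (\<Sum>x\<in>A. (f x a :: complex))"
  by (induction A rule: infinite_finite_induct) auto

text \<open>The sum sees only the coordinates in \<open>B\<close>, so \<open>lin_ext\<close> is
  linear on all functions and not just on \<open>free_space B\<close>. Linearity of the module
  operators therefore carries no membership side conditions.\<close>

lemma clin_lin_ext: "clin (lin_ext B f)"
  by (rule clinI)
    (auto simp: lin_ext_def fun_eq_iff sum.distrib sum_distrib_left algebra_simps)

lemmas lin_ext_simps =
  module_hom.add[OF clin_lin_ext] module_hom.scale[OF clin_lin_ext]
  module_hom.zero[OF clin_lin_ext] module_hom.neg[OF clin_lin_ext]
  module_hom.diff[OF clin_lin_ext]

lemma bvec_in [simp]: "bvec b \<in> free_space B \<longleftrightarrow> b \<in> B"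
  by (auto simp: bvec_def free_space_def)

lemma lin_ext_bvec [simp]:
  assumes "finite B" "b \<in> B"
  shows "lin_ext B f (bvec b) = f b"
proof -
  have "lin_ext B f (bvec b) = (\<Sum>x\<in>B. if x = b then f b else 0)"
    unfolding lin_ext_def by (rule sum.cong) (auto simp: bvec_def fun_eq_iff)
  then show ?thesis using assms by simp
qed

lemma subspace_free_space: "cvec.subspace (free_space B)"
  by (auto simp: cvec.subspace_def free_space_def)

lemma free_space_closed [simp, intro]:
  "0 \<in> free_space B"
  "v \<in> free_space B \<Longrightarrow> w \<in> free_space B \<Longrightarrow> v + w \<in> free_space B"
  "v \<in> free_space B \<Longrightarrow> w \<in> free_space B \<Longrightarrow> v - w \<in> free_space B"
  "v \<in> free_space B \<Longrightarrow> - v \<in> free_space B"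
  "v \<in> free_space B \<Longrightarrow> c *\<^sub>c v \<in> free_space B"
  by (auto simp: free_space_def)

lemma lin_ext_in:
  assumes "\<And>b. b \<in> B \<Longrightarrow> f b \<in> free_space C"
  shows "lin_ext B f v \<in> free_space C"
  unfolding lin_ext_def
  by (intro cvec.subspace_sum[OF subspace_free_space] free_space_closed assms)

lemma free_space_expand:
  assumes "finite B" "v \<in> free_space B"
  shows "v = (\<Sum>b\<in>B. v b *\<^sub>c bvec b)"
proof
  fix a
  have "(\<Sum>b\<in>B. v b * bvec b a) = (\<Sum>b\<in>B. if a = b then v a else 0)"
    by (rule sum.cong) (auto simp: bvec_def)
  then show "v a = (\<Sum>b\<in>B. v b *\<^sub>c bvec b) a"
    using assms by (auto simp: free_space_def)
qed

lemma clin_eqI: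
  assumes "finite B" "clin f" "clin g" "v \<in> free_space B"
    and "\<And>b. b \<in> B \<Longrightarrow> f (bvec b) = g (bvec b)"
  shows "f v = g v"
proof -
  interpret f: module_hom scale scale f by fact
  interpret g: module_hom scale scale g by fact
  show ?thesis
    by (subst (1 2) free_space_expand[OF assms(1,4)])
      (simp only: f.sum g.sum f.scale g.scale assms(5) cong: sum.cong)
qed

lemma clin_id: "clin (\<lambda>v. v)"
  by (rule clinI) auto

lemma clin_comp: "clin f \<Longrightarrow> clin g \<Longrightarrow> clin (\<lambda>v. g (f v))"
  by (auto intro!: clinI simp: module_hom.add module_hom.scale)

lemma clin_scale: "clin f \<Longrightarrow> clin (\<lambda>v. c *\<^sub>c f v)"
  by (auto intro!: clinI simp: module_hom.add module_hom.scale fun_eq_iff algebra_simps)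

lemma clin_diff: "clin f \<Longrightarrow> clin g \<Longrightarrow> clin (\<lambda>v. f v - g v)"
  by (auto intro!: clinI simp: module_hom.add module_hom.scale fun_eq_iff algebra_simps)

lemma clin_zero: "clin (\<lambda>v. 0)"
  by (rule clinI) auto

lemma clin_funpow:
  fixes f :: "'a vec \<Rightarrow> 'a vec"
  assumes "clin f" shows "clin (f ^^ n)"
proof (rule nat_induct)
  show "clin (f ^^ 0)" by (rule clinI) simp_all
  show "clin (f ^^ Suc n)" if "clin (f ^^ n)" for n
    by (rule clinI)
      (simp_all add: module_hom.add[OF that] module_hom.scale[OF that]
        module_hom.add[OF assms] module_hom.scale[OF assms])
qed

text \<open>The inverse is the linear extension of \<open>g\<close>: both composites fix the basis
  vectors, hence are identities. No dimension count is involved.\<close>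

lemma bij_betw_lin_ext:
  assumes fin: "finite B" "finite C"
    and f: "\<And>b. b \<in> B \<Longrightarrow> f b \<in> free_space C" and g: "\<And>c. c \<in> C \<Longrightarrow> g c \<in> free_space B"
    and gf: "\<And>b. b \<in> B \<Longrightarrow> lin_ext C g (f b) = bvec b"
    and fg: "\<And>c. c \<in> C \<Longrightarrow> lin_ext B f (g c) = bvec c"
  shows "bij_betw (lin_ext B f) (free_space B) (free_space C)"
proof -
  have 1: "lin_ext C g (lin_ext B f v) = v" if "v \<in> free_space B" for v
    by (rule clin_eqI[OF fin(1) clin_comp[OF clin_lin_ext clin_lin_ext] clin_id that])
      (simp add: fin gf)
  have 2: "lin_ext B f (lin_ext C g v) = v" if "v \<in> free_space C" for v
    by (rule clin_eqI[OF fin(2) clin_comp[OF clin_lin_ext clin_lin_ext] clin_id that])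
      (simp add: fin fg)
  show ?thesis
    using 1 2 lin_ext_in[OF f] lin_ext_in[OF g]
    by (intro bij_betw_byWitness[where f' = "lin_ext C g"]) auto
qed

section \<open>Operators and homomorphisms determined on a basis\<close>

lemmas op_defs = opE_def opF_def opK_def opKi_def opH_def

lemma clin_op: "clin (opE M)" "clin (opF M)" "clin (opK M)" "clin (opKi M)" "clin (opH M)"
  by (simp_all add: op_defs clin_lin_ext)

lemmas op_simps =
  clin_op[THEN module_hom.add] clin_op[THEN module_hom.scale] clin_op[THEN module_hom.zero]
  clin_op[THEN module_hom.neg] clin_op[THEN module_hom.diff]

lemma mod_hom_lin_ext:
  assumes fin: "finite (basis M)"
    and f: "\<And>b. b \<in> basis M \<Longrightarrow> f b \<in> vspace N"
    and E: "\<And>b. b \<in> basis M \<Longrightarrow> lin_ext (basis M) f (actE M b) = opE N (f b)"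
    and F: "\<And>b. b \<in> basis M \<Longrightarrow> lin_ext (basis M) f (actF M b) = opF N (f b)"
    and K: "\<And>b. b \<in> basis M \<Longrightarrow> lin_ext (basis M) f (actK M b) = opK N (f b)"
    and Ki: "\<And>b. b \<in> basis M \<Longrightarrow> lin_ext (basis M) f (actKi M b) = opKi N (f b)"
    and H: "\<And>b. b \<in> basis M \<Longrightarrow> lin_ext (basis M) f (actH M b) = opH N (f b)"
  shows "mod_hom M N (lin_ext (basis M) f)"
proof -
  let ?f = "lin_ext (basis M) f"
  have *: "?f (lin_ext (basis M) act v) = opr (?f v)"
    if "v \<in> vspace M" "clin opr" "\<And>b. b \<in> basis M \<Longrightarrow> ?f (act b) = opr (f b)" for act opr v
    using that(1) unfolding vspace_def
    by (rule clin_eqI[OF fin clin_comp[OF clin_lin_ext clin_lin_ext] clin_comp[OF clin_lin_ext that(2)]])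
      (simp add: fin that(3))
  have ef: "?f (opE M v) = opE N (?f v)" if "v \<in> vspace M" for v
    unfolding opE_def[of M] by (rule *[OF that clin_op(1) E])
  have ff: "?f (opF M v) = opF N (?f v)" if "v \<in> vspace M" for v
    unfolding opF_def[of M] by (rule *[OF that clin_op(2) F])
  have kf: "?f (opK M v) = opK N (?f v)" if "v \<in> vspace M" for v
    unfolding opK_def[of M] by (rule *[OF that clin_op(3) K])
  have kif: "?f (opKi M v) = opKi N (?f v)" if "v \<in> vspace M" for v
    unfolding opKi_def[of M] by (rule *[OF that clin_op(4) Ki])
  have hf: "?f (opH M v) = opH N (?f v)" if "v \<in> vspace M" for v
    unfolding opH_def[of M] by (rule *[OF that clin_op(5) H])
  have "?f v \<in> vspace N" for v
    using f unfolding vspace_def by (rule lin_ext_in)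
  with ef ff kf kif hf show ?thesis
    by (simp add: mod_hom_def lin_ext_simps)
qed

section \<open>Quantum exponentials and quantum numbers\<close>

lemma qpow_add: "qpow r (x + y) = qpow r x * qpow r y"
  by (simp add: qpow_def exp_add[symmetric] add_divide_distrib algebra_simps)

lemma qpow_0 [simp]: "qpow r 0 = 1"
  by (simp add: qpow_def)

lemma qpow_nonzero [simp]: "qpow r x \<noteq> 0"
  by (simp add: qpow_def)

lemma qpow_minus: "qpow r (- x) = inverse (qpow r x)"
  by (simp add: qpow_def exp_minus)

text \<open>This is q^r = exp(pi i) = -1. It explains the factor (-1)^l in the action of
  \<open>K\<close> on \<open>X\<close>, where all weights are shifted by l r.\<close>

lemma qpow_int_mult_r:
  assumes "r > 0" shows "qpow r (of_int l * of_nat r) = (-1) powi l"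
proof -
  have "qpow r (of_int l * of_nat r) = exp (of_int l * (of_real pi * \<i>))"
    using assms by (simp add: qpow_def algebra_simps)
  also have "\<dots> = exp (of_real pi * \<i>) powi l"
    by (rule exp_power_int[symmetric])
  finally show ?thesis by simp
qed

lemma qnum_0 [simp]: "qnum r 0 = 0"
  by (simp add: qnum_def qbr_def)

lemma qnum_minus: "qnum r (- x) = - qnum r x"
  by (simp add: qnum_def qbr_def minus_divide_left)

text \<open>This is 2 cos(pi z / r). Quantum numbers are quotients of sines, so a product of two of
  them is a difference of two values of this even function.\<close>

definition qcos :: "nat \<Rightarrow> complex \<Rightarrow> complex" where
  "qcos r z = qpow r z + qpow r (- z)"

lemma qcos_minus: "qcos r (- z) = qcos r z"
  by (simp add: qcos_def)

lemma qnum_mult: "qnum r x * qnum r y = (qcos r (x + y) - qcos r (x - y)) / (qbr r 1)\<^sup>2"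
proof -
  have "qbr r x * qbr r y = qcos r (x + y) - qcos r (x - y)"
    unfolding qbr_def qcos_def diff_conv_add_uminus minus_add_distrib minus_minus qpow_add
    by (simp add: algebra_simps)
  then show ?thesis by (simp add: qnum_def power2_eq_square)
qed

text \<open>Each product is a difference of two values of \<open>qcos\<close>. The term at x - y
  cancels the one at z + w, and the remaining two are those of [u][v]. The disjunctions reflect that
  \<open>qcos\<close> is even.\<close>

lemma qnum_mult_add:
  assumes "x + y = u + v" "x - y = z + w \<or> y - x = z + w" "z - w = u - v \<or> z - w = v - u"
  shows "qnum r x * qnum r y + qnum r z * qnum r w = qnum r u * qnum r v"
proof -
  have 1: "qcos r (x + y) = qcos r (u + v)" using assms(1) by simp
  have 2: "qcos r (x - y) = qcos r (z + w)"
    using assms(2) qcos_minus[of r "x - y"] by auto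
  have 3: "qcos r (z - w) = qcos r (u - v)"
    using assms(3) qcos_minus[of r "u - v"] by auto
  show ?thesis unfolding qnum_mult 1 2 3 by (simp add: diff_divide_distrib)
qed

lemma qpow_real: "qpow r (of_real x) = cis (pi * x / r)"
  by (simp add: qpow_def cis_conv_exp algebra_simps)

lemma qbr_real: "qbr r (of_real x) = 2 * \<i> * of_real (sin (pi * x / r))"
proof -
  have "qpow r (- of_real x) = cis (- (pi * x / r))"
    using qpow_real[of r "- x"] by simp
  then show ?thesis by (simp add: qbr_def qpow_real complex_eq_iff)
qed

lemma qbr_nonzero:
  assumes "r > 0" "0 < x" "x < real r"
  shows "qbr r (of_real x) \<noteq> 0"
proof -
  have "0 < sin (pi * x / r)"
    by (rule sin_gt_zero) (use assms in \<open>auto simp: field_simps\<close>)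
  then show ?thesis by (simp add: qbr_real)
qed

text \<open>On the real line \<open>qbr\<close> is 2 i sin(pi x / r), and the sine has no zero
  strictly between 0 and pi. This covers the denominator {1} as well.\<close>

lemma qnum_nonzero:
  assumes "r \<ge> 2" "0 < \<bar>x\<bar>" "\<bar>x\<bar> < real r"
  shows "qnum r (of_real x) \<noteq> 0"
proof -
  have 1: "qbr r 1 \<noteq> 0" using qbr_nonzero[of r 1] assms by simp
  have "qbr r (of_real \<bar>x\<bar>) \<noteq> 0" using qbr_nonzero[of r "\<bar>x\<bar>"] assms by simp
  then have "qbr r (of_real x) \<noteq> 0"
    by (auto simp: abs_if qbr_def split: if_splits)
  with 1 show ?thesis by (simp add: qnum_def)
qed

lemma qnum_int_nonzero:
  assumes "r \<ge> 2" "0 < \<bar>n\<bar>" "\<bar>n\<bar> < int r"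
  shows "qnum r (of_int n) \<noteq> 0"
  using qnum_nonzero[of r "of_int n"] assms by simp

lemma qnum_1 [simp]:
  assumes "r \<ge> 2" shows "qnum r 1 = 1"
  using qbr_nonzero[of r 1] assms by (simp add: qnum_def)

lemma qpow_add_r:
  assumes "r > 0" shows "qpow r (z + of_nat r) = - qpow r z" "qpow r (of_nat r) = -1"
  using qpow_int_mult_r[of r 1] assms by (simp_all add: qpow_add)

lemma qnum_add_r:
  assumes "r > 0" shows "qnum r (z + of_nat r) = - qnum r z"
proof -
  have "qpow r (- z - of_nat r) = - qpow r (- z)"
    using qpow_add_r(1)[OF assms, of "- z - of_nat r"] by simp
  then show ?thesis
    by (simp add: qnum_def qbr_def qpow_add_r[OF assms] diff_conv_add_uminus[symmetric] diff_divide_distrib)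
qed

lemma qnum_r [simp]: "r > 0 \<Longrightarrow> qnum r (of_nat r) = 0"
  using qnum_add_r[of r 0] by simp

section \<open>Weight vectors and operators\<close>

lemmas funpow_op_simps =
  clin_op[THEN clin_funpow, THEN module_hom.add] clin_op[THEN clin_funpow, THEN module_hom.scale]
  clin_op[THEN clin_funpow, THEN module_hom.zero] clin_op[THEN clin_funpow, THEN module_hom.neg]
  clin_op[THEN clin_funpow, THEN module_hom.diff]

definition weight_vec :: "nat \<Rightarrow> 'a qmod \<Rightarrow> complex \<Rightarrow> 'a vec \<Rightarrow> bool" where
  "weight_vec r M \<mu> v \<longleftrightarrow>
     v \<in> vspace M \<and> opH M v = \<mu> *\<^sub>c v \<and> opK M v = qpow r \<mu> *\<^sub>c v \<and> opKi M v = qpow r (- \<mu>) *\<^sub>c v"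

lemma wt_lin:
  assumes "weight_vec r M \<mu> v" "weight_vec r M \<mu> w"
  shows "weight_vec r M \<mu> (v + w)" "weight_vec r M \<mu> (v - w)"
  using assms by (auto simp: weight_vec_def op_simps vspace_def fun_eq_iff algebra_simps)

lemma wt_scale: "weight_vec r M \<mu> v \<Longrightarrow> weight_vec r M \<mu> (c *\<^sub>c v)"
  by (auto simp: weight_vec_def op_simps vspace_def fun_eq_iff algebra_simps)

lemma wt_minus: "weight_vec r M \<mu> v \<Longrightarrow> weight_vec r M \<mu> (- v)"
  by (auto simp: weight_vec_def op_simps vspace_def fun_eq_iff)

lemma wt_0: "weight_vec r M \<mu> 0"
  by (simp add: weight_vec_def op_simps vspace_def fun_eq_iff)

text \<open>With \<open>T = F E\<close> on the space of weight \<open>\<mu>\<close>, these are the numbers with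
  \<open>F E (E\<^sup>n y) = E\<^sup>n (T y - \<kappa>\<^sub>n y)\<close>.\<close>

definition kap :: "nat \<Rightarrow> complex \<Rightarrow> nat \<Rightarrow> complex" where
  "kap r \<mu> n = qnum r (of_nat n) * qnum r (\<mu> + 1 + of_nat n)"

text \<open>The polynomial in \<open>A\<close> with the list of roots \<open>ms\<close>, the last
  factor acting first. A list keeps repeated roots and lets factors be split off.\<close>

definition prod_op :: "('a vec \<Rightarrow> 'a vec) \<Rightarrow> complex list \<Rightarrow> 'a vec \<Rightarrow> 'a vec" where
  "prod_op A ms = foldr (\<lambda>m x. A x - m *\<^sub>c x) ms"

lemma prod_op_simps [simp]:
  "prod_op A [] x = x" "prod_op A (m # ms) x = A (prod_op A ms x) - m *\<^sub>c prod_op A ms x"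
  "prod_op A (ms @ ns) x = prod_op A ms (prod_op A ns x)"
  by (simp_all add: prod_op_def)

lemma clin_prod_op: "clin A \<Longrightarrow> clin (prod_op A ms)"
proof (induction ms)
  case Nil
  have *: "prod_op A [] = (\<lambda>x. x)" by (simp add: fun_eq_iff)
  show ?case unfolding * by (rule clin_id)
next
  case (Cons m ms)
  have *: "prod_op A (m # ms) = (\<lambda>x. A (prod_op A ms x) - m *\<^sub>c prod_op A ms x)"
    by (simp add: fun_eq_iff)
  show ?case unfolding * using Cons by (intro clin_diff clin_comp[of "prod_op A ms" A] clin_scale)
qed

lemma prod_op_commute:
  assumes "clin A" shows "prod_op A ms (A x) = A (prod_op A ms x)"
proof (induction ms)
  case Nil
  show "prod_op A [] (A x) = A (prod_op A [] x)" by simp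
next
  case (Cons m ms)
  have IH: "prod_op A ms (A x) = A (prod_op A ms x)" by (rule Cons.IH)
  show "prod_op A (m # ms) (A x) = A (prod_op A (m # ms) x)"
    by (simp add: IH module_hom.diff[OF assms] module_hom.scale[OF assms])
qed

lemma prod_op_shift:
  assumes "clin A"
  shows "prod_op A ms (A x - m *\<^sub>c x) = A (prod_op A ms x) - m *\<^sub>c prod_op A ms x"
  by (simp add: module_hom.diff[OF clin_prod_op[OF assms]] module_hom.scale[OF clin_prod_op[OF assms]]
    prod_op_commute[OF assms])

lemma prod_op_swap:
  assumes "clin A"
  shows "prod_op A ms (prod_op A ns x) = prod_op A ns (prod_op A ms x)"
proof (induction ms)
  case Nil
  show "prod_op A [] (prod_op A ns x) = prod_op A ns (prod_op A [] x)" by simp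
next
  case (Cons m ms)
  have IH: "prod_op A ms (prod_op A ns x) = prod_op A ns (prod_op A ms x)" by (rule Cons.IH)
  show "prod_op A (m # ms) (prod_op A ns x) = prod_op A ns (prod_op A (m # ms) x)"
    by (simp add: IH prod_op_shift[OF assms])
qed

text \<open>If A^2 x = 0 then p(A) x = p(0) x + p'(0) A x for every polynomial p, and p(0) is
  nonzero exactly because 0 is not among the roots.\<close>

lemma prod_op_kernel2:
  assumes A: "clin A" and "A (A x) = 0" "0 \<notin> set ms"
  shows "\<exists>c d. c \<noteq> 0 \<and> prod_op A ms x = c *\<^sub>c x + d *\<^sub>c A x"
  using assms(3)
proof (induction ms)
  case Nil
  have "prod_op A [] x = 1 *\<^sub>c x + 0 *\<^sub>c A x" by (simp add: fun_eq_iff)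
  then show ?case by (metis zero_neq_one)
next
  case (Cons m ms)
  then have "0 \<notin> set ms" by simp
  from Cons.IH[OF this] obtain c d
    where cd: "c \<noteq> 0" "prod_op A ms x = c *\<^sub>c x + d *\<^sub>c A x" by blast
  have "prod_op A (m # ms) x = A (c *\<^sub>c x + d *\<^sub>c A x) - m *\<^sub>c (c *\<^sub>c x + d *\<^sub>c A x)"
    by (simp only: prod_op_simps cd)
  also have "\<dots> = c *\<^sub>c A x - m *\<^sub>c (c *\<^sub>c x + d *\<^sub>c A x)"
    by (simp add: module_hom.add[OF A] module_hom.scale[OF A] assms(2))
  also have "\<dots> = (- m * c) *\<^sub>c x + (c - m * d) *\<^sub>c A x"
    by (simp add: fun_eq_iff algebra_simps)
  finally have "prod_op A (m # ms) x = (- m * c) *\<^sub>c x + (c - m * d) *\<^sub>c A x" .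
  moreover have "- m * c \<noteq> 0" using cd Cons.prems by auto
  ultimately show ?case by blast
qed

section \<open>Commuting powers of E and F on weight vectors\<close>

locale uqH =
  fixes r :: nat and M :: "'a qmod"
  assumes r2: "2 \<le> r" and mod: "uqH_module r M"
begin

abbreviation "E \<equiv> opE M"
abbreviation "F \<equiv> opF M"
abbreviation "K \<equiv> opK M"
abbreviation "Ki \<equiv> opKi M"
abbreviation "H \<equiv> opH M"
abbreviation "wt \<equiv> weight_vec r M"
abbreviation "T \<equiv> \<lambda>v. F (E v)"

lemma fin: "finite (basis M)"
  using mod by (simp add: uqH_module_def)

lemma closed [simp]: "E v \<in> vspace M" "F v \<in> vspace M" "K v \<in> vspace M" "Ki v \<in> vspace M" "H v \<in> vspace M"
  using mod by (auto simp: uqH_module_def op_defs vspace_def intro!: lin_ext_in)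

lemma closed_pow [simp]:
  assumes "v \<in> vspace M" shows "(E ^^ n) v \<in> vspace M" "(F ^^ n) v \<in> vspace M"
  using assms by (induction n) auto

lemma relations:
  assumes "v \<in> vspace M"
  shows "K (Ki v) = v" "Ki (K v) = v" "K (E v) = qpow r 2 *\<^sub>c E (K v)"
    "K (F v) = qpow r (-2) *\<^sub>c F (K v)" "H (K v) = K (H v)"
    "H (E v) - E (H v) = 2 *\<^sub>c E v" "H (F v) - F (H v) = (-2) *\<^sub>c F v"
    "E (F v) - F (E v) = (1 / (qpow r 1 - qpow r (-1))) *\<^sub>c (K v - Ki v)"
    "(E ^^ r) v = 0" "(F ^^ r) v = 0"
  using mod assms unfolding uqH_module_def by blast+

lemma wt_in: "wt \<mu> v \<Longrightarrow> v \<in> vspace M"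
  by (simp add: weight_vec_def)

text \<open>The action of \<open>Ki\<close> comes for free: apply it to K v = q^\<mu> v and use that
  it inverts \<open>K\<close>.\<close>

lemma wtI:
  assumes "v \<in> vspace M" "H v = \<mu> *\<^sub>c v" "K v = qpow r \<mu> *\<^sub>c v"
  shows "wt \<mu> v"
proof -
  have "v = Ki (qpow r \<mu> *\<^sub>c v)" using relations(2)[OF assms(1)] assms(3) by simp
  then have "v = qpow r \<mu> *\<^sub>c Ki v" by (simp add: op_simps)
  then have "qpow r (- \<mu>) *\<^sub>c v = qpow r (- \<mu>) *\<^sub>c (qpow r \<mu> *\<^sub>c Ki v)" by simp
  then have "qpow r (- \<mu>) *\<^sub>c v = Ki v" by (simp add: qpow_minus)
  then show ?thesis using assms by (simp add: weight_vec_def)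
qed

lemma wt_E: assumes "wt \<mu> v" shows "wt (\<mu> + 2) (E v)"
proof (rule wtI)
  have v: "v \<in> vspace M" using assms by (rule wt_in)
  show "E v \<in> vspace M" by simp
  have Hv: "H v = \<mu> *\<^sub>c v" using assms by (simp add: weight_vec_def)
  show "H (E v) = (\<mu> + 2) *\<^sub>c E v"
    using relations(6)[OF v] unfolding Hv by (simp add: op_simps fun_eq_iff algebra_simps)
  show "K (E v) = qpow r (\<mu> + 2) *\<^sub>c E v"
    using relations(3)[OF v] assms by (simp add: weight_vec_def op_simps qpow_add mult.commute)
qed

lemma wt_F: assumes "wt \<mu> v" shows "wt (\<mu> - 2) (F v)"
proof (rule wtI)
  have v: "v \<in> vspace M" using assms by (rule wt_in)
  show "F v \<in> vspace M" by simp
  have Hv: "H v = \<mu> *\<^sub>c v" using assms by (simp add: weight_vec_def)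
  show "H (F v) = (\<mu> - 2) *\<^sub>c F v"
    using relations(7)[OF v] unfolding Hv by (simp add: op_simps fun_eq_iff algebra_simps)
  show "K (F v) = qpow r (\<mu> - 2) *\<^sub>c F v"
    using relations(4)[OF v] assms qpow_add[of r \<mu> "-2"] by (simp add: weight_vec_def op_simps mult.commute)
qed

lemma wt_En: "wt \<mu> v \<Longrightarrow> wt (\<mu> + 2 * of_nat n) ((E ^^ n) v)"
proof (induction n)
  case (Suc n)
  then show ?case using wt_E[of "\<mu> + 2 * of_nat n" "(E ^^ n) v"] by (simp add: algebra_simps)
qed simp

lemma wt_Fn: "wt \<mu> v \<Longrightarrow> wt (\<mu> - 2 * of_nat n) ((F ^^ n) v)"
proof (induction n)
  case (Suc n)
  then show ?case using wt_F[of "\<mu> - 2 * of_nat n" "(F ^^ n) v"] by (simp add: algebra_simps)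
qed simp

lemma wt_T: assumes "wt \<mu> v" shows "wt \<mu> (T v)"
  using wt_F[OF wt_E[OF assms]] by simp

lemma wt_prod_T: assumes "wt \<mu> v" shows "wt \<mu> (prod_op T ms v)"
proof (induction ms)
  case (Cons m ms)
  show ?case unfolding prod_op_simps by (rule wt_lin(2)[OF wt_T[OF Cons] wt_scale[OF Cons]])
qed (use assms in simp)

lemma clin_T: "clin T"
  by (rule clin_comp[OF clin_op(1) clin_op(2)])

lemma comm: assumes "wt \<mu> v" shows "E (F v) = F (E v) + qnum r \<mu> *\<^sub>c v"
  using relations(8)[OF wt_in[OF assms]] assms
  by (simp add: weight_vec_def qnum_def qbr_def fun_eq_iff algebra_simps diff_divide_distrib)

text \<open>Moving \<open>E\<close> through n + 1 copies of \<open>F\<close> collects [\<mu>] +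
  [\<mu> - 2] + ... + [\<mu> - 2n], which telescopes to [n+1][\<mu> - n].\<close>

lemma E_Fn:
  assumes "wt \<mu> v"
  shows "E ((F ^^ Suc n) v) =
    (F ^^ Suc n) (E v) + (qnum r (of_nat n + 1) * qnum r (\<mu> - of_nat n)) *\<^sub>c (F ^^ n) v"
proof (induction n)
  case 0
  show "E ((F ^^ Suc 0) v) =
    (F ^^ Suc 0) (E v) + (qnum r (of_nat 0 + 1) * qnum r (\<mu> - of_nat 0)) *\<^sub>c (F ^^ 0) v"
    using r2 by (simp add: comm[OF assms])
next
  case (Suc n)
  have IH: "E ((F ^^ Suc n) v) =
    (F ^^ Suc n) (E v) + (qnum r (of_nat n + 1) * qnum r (\<mu> - of_nat n)) *\<^sub>c (F ^^ n) v"
    by (rule Suc.IH)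
  have id: "qnum r (of_nat n + 1) * qnum r (\<mu> - of_nat n) + qnum r 1 * qnum r (\<mu> - 2 * (of_nat n + 1))
      = qnum r (of_nat (Suc n) + 1) * qnum r (\<mu> - of_nat (Suc n))"
    by (rule qnum_mult_add) (auto simp: algebra_simps)
  have "E ((F ^^ Suc (Suc n)) v) = F (E ((F ^^ Suc n) v)) + qnum r (\<mu> - 2 * of_nat (Suc n)) *\<^sub>c (F ^^ Suc n) v"
    using comm[OF wt_Fn[OF assms, of "Suc n"]] by simp
  also have "\<dots> = (F ^^ Suc (Suc n)) (E v) +
     (qnum r (of_nat n + 1) * qnum r (\<mu> - of_nat n) + qnum r 1 * qnum r (\<mu> - 2 * (of_nat n + 1))) *\<^sub>c (F ^^ Suc n) v"
    unfolding IH using r2 by (simp add: op_simps fun_eq_iff algebra_simps)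
  finally show "E ((F ^^ Suc (Suc n)) v) = (F ^^ Suc (Suc n)) (E v)
     + (qnum r (of_nat (Suc n) + 1) * qnum r (\<mu> - of_nat (Suc n))) *\<^sub>c (F ^^ Suc n) v"
    unfolding id .
qed

text \<open>Rewriting \<open>F E\<close> as \<open>E F\<close> minus a quantum number moves one
  \<open>E\<close> to the left of \<open>T\<close>. The numbers [\<mu> + 2], ..., [\<mu> + 2n]
  collected on the way add up to \<open>kap r \<mu> n\<close>.\<close>

lemma T_En:
  assumes "wt \<mu> y"
  shows "T ((E ^^ n) y) = (E ^^ n) (T y - kap r \<mu> n *\<^sub>c y)"
proof (induction n)
  case 0
  show "T ((E ^^ 0) y) = (E ^^ 0) (T y - kap r \<mu> 0 *\<^sub>c y)" by (simp add: kap_def fun_eq_iff)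
next
  case (Suc n)
  have IH: "T ((E ^^ n) y) = (E ^^ n) (T y - kap r \<mu> n *\<^sub>c y)" by (rule Suc.IH)
  have "qnum r 1 * qnum r (\<mu> + 2 * (of_nat n + 1)) + qnum r (of_nat n) * qnum r (\<mu> + 1 + of_nat n)
      = qnum r (of_nat (Suc n)) * qnum r (\<mu> + 1 + of_nat (Suc n))"
    by (rule qnum_mult_add) (auto simp: algebra_simps)
  then have id: "kap r \<mu> n + qnum r 1 * qnum r (\<mu> + 2 * (of_nat n + 1)) = kap r \<mu> (Suc n)"
    by (simp only: kap_def add.commute)
  have *: "T ((E ^^ Suc n) y) = E (T ((E ^^ n) y)) - qnum r (\<mu> + 2 * of_nat (Suc n)) *\<^sub>c (E ^^ Suc n) y"
    using comm[OF wt_En[OF assms, of "Suc n"]] by (simp add: fun_eq_iff)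
  have "T ((E ^^ Suc n) y) = (E ^^ Suc n) (T y)
      - (kap r \<mu> n + qnum r 1 * qnum r (\<mu> + 2 * (of_nat n + 1))) *\<^sub>c (E ^^ Suc n) y"
    unfolding * IH using r2 by (simp add: op_simps funpow_op_simps fun_eq_iff algebra_simps)
  also have "\<dots> = (E ^^ Suc n) (T y - kap r \<mu> (Suc n) *\<^sub>c y)"
    unfolding id by (simp only: funpow_op_simps)
  finally show "T ((E ^^ Suc n) y) = (E ^^ Suc n) (T y - kap r \<mu> (Suc n) *\<^sub>c y)" .
qed

text \<open>For n + b = r the left side contains E^r and vanishes. The lemma then says that an
  explicit polynomial in \<open>T\<close>, followed by E^b, annihilates every vector of weight
  \<mu>; it is used with b = 0, b = 1 and b = r - i, the middle case with n + b = r - 1 - i.\<close>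

lemma Fn_En:
  assumes "wt \<mu> y"
  shows "(F ^^ n) ((E ^^ (n + b)) y) = (E ^^ b) (prod_op T (map (kap r \<mu>) [b..<n + b]) y)"
proof -
  \<comment> \<open>The vector is quantified because the induction hypothesis is applied to T y -
    \<kappa> y, which has the same weight.\<close>
  have "\<forall>y. wt \<mu> y \<longrightarrow>
    (F ^^ n) ((E ^^ (n + b)) y) = (E ^^ b) (prod_op T (map (kap r \<mu>) [b..<n + b]) y)"
  proof (induction n)
    case 0
    show ?case by simp
  next
    case (Suc n)
    show ?case
    proof (intro allI impI)
      fix y assume y: "wt \<mu> y"
      have "(F ^^ Suc n) ((E ^^ (Suc n + b)) y) = (F ^^ n) (T ((E ^^ (n + b)) y))"
        by (simp add: funpow_swap1)
      also have "\<dots> = (F ^^ n) ((E ^^ (n + b)) (T y - kap r \<mu> (n + b) *\<^sub>c y))"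
        unfolding T_En[OF y] ..
      also have "\<dots> = (E ^^ b) (prod_op T (map (kap r \<mu>) [b..<n + b]) (T y - kap r \<mu> (n + b) *\<^sub>c y))"
        by (rule Suc.IH[rule_format], rule wt_lin(2)[OF wt_T[OF y] wt_scale[OF y]])
      also have "\<dots> = (E ^^ b) (prod_op T (map (kap r \<mu>) [b..<Suc n + b]) y)" by simp
      finally show "(F ^^ Suc n) ((E ^^ (Suc n + b)) y)
        = (E ^^ b) (prod_op T (map (kap r \<mu>) [b..<Suc n + b]) y)" .
    qed
  qed
  with assms show ?thesis by blast
qed

end

text \<open>If the basis consists of weight vectors and \<open>E\<close>, \<open>F\<close> shift
  weights by 2 and -2, all relations involving \<open>K\<close> and \<open>H\<close> follow. What
  remains to be checked on basis vectors is the commutator of \<open>E\<close> and \<open>F\<close>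
  and the nilpotency of both.\<close>

lemma weight_moduleI:
  fixes M :: "'a qmod"
  assumes r: "2 \<le> r" and fin: "finite (basis M)"
    and wt: "\<And>b. b \<in> basis M \<Longrightarrow> weight_vec r M (\<mu> b) (bvec b)"
    and E: "\<And>b. b \<in> basis M \<Longrightarrow> weight_vec r M (\<mu> b + 2) (opE M (bvec b))"
    and F: "\<And>b. b \<in> basis M \<Longrightarrow> weight_vec r M (\<mu> b - 2) (opF M (bvec b))"
    and EF: "\<And>b. b \<in> basis M \<Longrightarrow>
      opE M (opF M (bvec b)) - opF M (opE M (bvec b)) = qnum r (\<mu> b) *\<^sub>c bvec b"
    and nil: "\<And>b. b \<in> basis M \<Longrightarrow> (opE M ^^ r) (bvec b) = 0"
      "\<And>b. b \<in> basis M \<Longrightarrow> (opF M ^^ r) (bvec b) = 0"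
  shows "uqH_module r M" "weight_module r M"
proof -
  note c = clin_comp[OF clin_op(4) clin_op(3)] clin_comp[OF clin_op(3) clin_op(4)]
    clin_comp[OF clin_op(1) clin_op(3)] clin_comp[OF clin_op(3) clin_op(1)]
    clin_comp[OF clin_op(2) clin_op(3)] clin_comp[OF clin_op(3) clin_op(2)]
    clin_comp[OF clin_op(3) clin_op(5)] clin_comp[OF clin_op(5) clin_op(3)]
    clin_comp[OF clin_op(1) clin_op(5)] clin_comp[OF clin_op(5) clin_op(1)]
    clin_comp[OF clin_op(2) clin_op(5)] clin_comp[OF clin_op(5) clin_op(2)]
    clin_comp[OF clin_op(2) clin_op(1)] clin_comp[OF clin_op(1) clin_op(2)]
  have ext: "f v = g v" if "v \<in> vspace M" "clin f" "clin g"
    "\<And>b. b \<in> basis M \<Longrightarrow> f (bvec b) = g (bvec b)" for f g :: "'a vec \<Rightarrow> 'a vec" and v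
    using clin_eqI[OF fin that(2,3), of v] that(1,4) by (simp add: vspace_def)
  have acts: "actE M b = opE M (bvec b)" "actF M b = opF M (bvec b)" "actK M b = opK M (bvec b)"
    "actKi M b = opKi M (bvec b)" "actH M b = opH M (bvec b)" if "b \<in> basis M" for b
    using that fin by (simp_all add: op_defs)
  have in1: "bvec b \<in> vspace M" if "b \<in> basis M" for b using that by (simp add: vspace_def)
  have K: "opK M (bvec b) = qpow r (\<mu> b) *\<^sub>c bvec b" "opKi M (bvec b) = qpow r (- \<mu> b) *\<^sub>c bvec b"
    "opH M (bvec b) = \<mu> b *\<^sub>c bvec b" if "b \<in> basis M" for b
    using wt[OF that] by (simp_all add: weight_vec_def)
  have KE: "opK M (opE M (bvec b)) = qpow r (\<mu> b + 2) *\<^sub>c opE M (bvec b)"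
    "opH M (opE M (bvec b)) = (\<mu> b + 2) *\<^sub>c opE M (bvec b)" "opE M (bvec b) \<in> vspace M" if "b \<in> basis M" for b
    using E[OF that] by (simp_all add: weight_vec_def)
  have KF: "opK M (opF M (bvec b)) = qpow r (\<mu> b - 2) *\<^sub>c opF M (bvec b)"
    "opH M (opF M (bvec b)) = (\<mu> b - 2) *\<^sub>c opF M (bvec b)" "opF M (bvec b) \<in> vspace M" if "b \<in> basis M" for b
    using F[OF that] by (simp_all add: weight_vec_def)
  have q2: "qpow r (x - 2) = qpow r (- 2) * qpow r x" for x
    using qpow_add[of r "-2" x] by simp
  have q1: "qpow r x * qpow r (- x) = 1" for x
    using qpow_add[of r x "- x"] by simp
  have b0: "opK M (opKi M (bvec b)) = (bvec b)" if "b \<in> basis M" for b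
    by (simp add: that K op_simps q1 mult.commute)
  have b1: "opKi M (opK M (bvec b)) = (bvec b)" if "b \<in> basis M" for b
    by (simp add: that K op_simps q1 mult.commute)
  have b2: "opK M (opE M (bvec b)) = qpow r 2 *\<^sub>c opE M (opK M (bvec b))" if "b \<in> basis M" for b
    by (simp add: that K KE op_simps qpow_add mult.commute)
  have b3: "opK M (opF M (bvec b)) = qpow r (-2) *\<^sub>c opF M (opK M (bvec b))" if "b \<in> basis M" for b
    by (simp add: that K KF op_simps q2)
  have b4: "opH M (opK M (bvec b)) = opK M (opH M (bvec b))" if "b \<in> basis M" for b
    by (simp add: that K op_simps mult.commute)
  have b5: "opH M (opE M (bvec b)) - opE M (opH M (bvec b)) = 2 *\<^sub>c opE M (bvec b)" if "b \<in> basis M" for b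
    by (simp add: that K KE op_simps fun_eq_iff algebra_simps)
  have b6: "opH M (opF M (bvec b)) - opF M (opH M (bvec b)) = (-2) *\<^sub>c opF M (bvec b)" if "b \<in> basis M" for b
    by (simp add: that K KF op_simps fun_eq_iff algebra_simps)
  have b7: "opE M (opF M (bvec b)) - opF M (opE M (bvec b)) = (1 / (qpow r 1 - qpow r (-1))) *\<^sub>c (opK M (bvec b) - opKi M (bvec b))" if "b \<in> basis M" for b
    by (simp add: that K EF qnum_def qbr_def fun_eq_iff algebra_simps diff_divide_distrib)
  show 1: "uqH_module r M"
    unfolding uqH_module_def
  proof (intro conjI ballI fin)
    fix b assume b: "b \<in> basis M"
    show "actE M b \<in> vspace M" "actF M b \<in> vspace M" using b KE KF acts by auto
    show "actK M b \<in> vspace M" "actKi M b \<in> vspace M" "actH M b \<in> vspace M"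
      using in1[OF b] by (simp_all add: acts K b vspace_def)
  next
    fix v assume v: "v \<in> vspace M"
    show "opK M (opKi M v) = v"
      by (rule ext[OF v]) ((intro c clin_diff clin_scale clin_op clin_id)+, rule b0)
    show "opKi M (opK M v) = v"
      by (rule ext[OF v]) ((intro c clin_diff clin_scale clin_op clin_id)+, rule b1)
    show "opK M (opE M v) = qpow r 2 *\<^sub>c opE M (opK M v)"
      by (rule ext[OF v]) ((intro c clin_diff clin_scale clin_op clin_id)+, rule b2)
    show "opK M (opF M v) = qpow r (-2) *\<^sub>c opF M (opK M v)"
      by (rule ext[OF v]) ((intro c clin_diff clin_scale clin_op clin_id)+, rule b3)
    show "opH M (opK M v) = opK M (opH M v)"
      by (rule ext[OF v]) ((intro c clin_diff clin_scale clin_op clin_id)+, rule b4)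
    show "opH M (opE M v) - opE M (opH M v) = 2 *\<^sub>c opE M v"
      by (rule ext[OF v]) ((intro c clin_diff clin_scale clin_op clin_id)+, rule b5)
    show "opH M (opF M v) - opF M (opH M v) = (-2) *\<^sub>c opF M v"
      by (rule ext[OF v]) ((intro c clin_diff clin_scale clin_op clin_id)+, rule b6)
    show "opE M (opF M v) - opF M (opE M v) = (1 / (qpow r 1 - qpow r (-1))) *\<^sub>c (opK M v - opKi M v)"
      by (rule ext[OF v]) ((intro c clin_diff clin_scale clin_op clin_id)+, rule b7)
    show "(opE M ^^ r) v = 0" by (rule ext[OF v]) (intro clin_funpow clin_zero clin_op nil)+
    show "(opF M ^^ r) v = 0" by (rule ext[OF v]) (intro clin_funpow clin_zero clin_op nil)+
  qed
  show "weight_module r M" unfolding weight_module_def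
  proof (intro conjI 1 ballI allI impI)
    let ?S = "{v \<in> vspace M. \<exists>\<mu>. opH M v = \<mu> *\<^sub>c v}"
    show "vspace M = cvec.span ?S"
    proof
      show "vspace M \<subseteq> cvec.span ?S"
      proof
        fix v assume "v \<in> vspace M"
        then have "v = (\<Sum>b\<in>basis M. v b *\<^sub>c bvec b)"
          using free_space_expand[OF fin] by (simp add: vspace_def)
        also have "\<dots> \<in> cvec.span ?S"
          by (intro cvec.span_sum cvec.span_scale cvec.span_base) (use K(3) in1 in auto)
        finally show "v \<in> cvec.span ?S" .
      qed
      show "cvec.span ?S \<subseteq> vspace M"
        by (rule cvec.span_minimal) (auto simp: vspace_def subspace_free_space)
    qed
  next
    fix v \<nu> assume v: "v \<in> vspace M" and H: "opH M v = \<nu> *\<^sub>c v"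
    have exp: "f v = (\<Sum>b\<in>basis M. v b *\<^sub>c f (bvec b))" if "clin f" for f :: "'a vec \<Rightarrow> 'a vec"
    proof -
      interpret f: module_hom scale scale f by fact
      show ?thesis
        by (subst free_space_expand[OF fin, of v]) (use v in \<open>simp_all add: vspace_def f.sum f.scale\<close>)
    qed
    have val: "(\<Sum>b\<in>basis M. v b *\<^sub>c (w b *\<^sub>c bvec b)) a = (if a \<in> basis M then v a * w a else 0)" for w a
    proof -
      have "(\<Sum>b\<in>basis M. v b *\<^sub>c (w b *\<^sub>c bvec b)) a = (\<Sum>b\<in>basis M. if a = b then v a * w a else 0)"
        unfolding sum_fun_apply by (rule sum.cong) (auto simp: bvec_def)
      then show ?thesis using fin by simp
    qed
    \<comment> \<open>Coordinates are compared: an \<open>H\<close>-eigenvector of eigenvalue \<nu>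
      is supported on basis vectors of weight \<nu>, and there \<open>K\<close> acts by
      q^\<nu>.\<close>
    have "opH M v = (\<Sum>b\<in>basis M. v b *\<^sub>c (\<mu> b *\<^sub>c bvec b))"
      using exp[OF clin_op(5)] by (simp add: K cong: sum.cong)
    then have "\<nu> * v a = v a * \<mu> a" if "a \<in> basis M" for a
      using that val[of \<mu> a] H by (metis scale_apply)
    then have *: "v a = 0 \<or> \<mu> a = \<nu>" if "a \<in> basis M" for a
      using that by (metis mult.commute mult_cancel_left)
    have "opK M v = (\<Sum>b\<in>basis M. v b *\<^sub>c (qpow r (\<mu> b) *\<^sub>c bvec b))"
      using exp[OF clin_op(3)] by (simp add: K cong: sum.cong)
    then show "opK M v = qpow r \<nu> *\<^sub>c v"
      using * v val[of "\<lambda>b. qpow r (\<mu> b)"] by (auto simp: fun_eq_iff vspace_def free_space_def)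
  qed
qed

section \<open>The module X\<close>

locale X_setup =
  fixes r i :: nat and l :: int and \<epsilon> :: complex
  assumes r2: "2 \<le> r" and ir: "i \<le> r - 2"
begin

abbreviation "X \<equiv> X_mod r i l \<epsilon>"
abbreviation "E \<equiv> opE X"
abbreviation "F \<equiv> opF X"

definition sg :: complex where "sg = (-1) powi l"
definition a :: complex where "a = qnum r (1 + of_nat i) * qnum r \<epsilon>"
text \<open>Up to \<open>sg\<close>, this is the factor by which \<open>E\<close> lowers the k-th
  power of \<open>F\<close> on the vector 2 a w^H + w^S of weight i + l r + \<epsilon>, for k at
  most i.\<close>

definition g :: "nat \<Rightarrow> complex" where
  "g k = qnum r (1 + of_nat i - of_nat k + \<epsilon>) * qnum r (of_nat k)"

abbreviation "L k \<equiv> bvec (wL k) :: x_label vec"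
abbreviation "Hv k \<equiv> bvec (wH k) :: x_label vec"
abbreviation "S k \<equiv> bvec (wS k) :: x_label vec"
abbreviation "R k \<equiv> bvec (wR k) :: x_label vec"

lemma sg_Suc: "(-1) powi (l + 1) = - sg"
  unfolding sg_def by (simp add: power_int_add)

lemma fin: "finite (basis X)"
  by (simp add: X_mod_def)

lemma basis_X [simp]:
  "wL k \<in> basis X \<longleftrightarrow> k \<le> r - 2 - i" "wH k \<in> basis X \<longleftrightarrow> k \<le> i"
  "wS k \<in> basis X \<longleftrightarrow> k \<le> i" "wR k \<in> basis X \<longleftrightarrow> k \<le> r - 2 - i"
  by (auto simp: X_mod_def)

lemma op_basis:
  assumes "x \<in> basis X"
  shows "E (bvec x) = x_E r i l \<epsilon> x" "F (bvec x) = x_F r i \<epsilon> x"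
  using assms fin by (simp_all add: op_defs) (simp_all add: X_mod_def)

lemma g_0 [simp]: "g 0 = 0"
  by (simp add: g_def)

text \<open>This value, together with g 0 = 0, makes the formulas for \<open>E F\<close> and
  \<open>F E\<close> on the H and S strings valid at both ends, where the vectors pass into the L
  and R strings.\<close>

lemma g_end: "g (Suc i) = a"
  by (simp add: g_def a_def mult.commute)

lemma g_diff: "g k - qnum r (1 + of_nat i - of_nat k) * qnum r (of_nat k - \<epsilon>) = a"
proof -
  have "qnum r (1 + of_nat i) * qnum r \<epsilon> + qnum r (1 + of_nat i - of_nat k) * qnum r (of_nat k - \<epsilon>)
    = qnum r (1 + of_nat i - of_nat k + \<epsilon>) * qnum r (of_nat k)"
    by (rule qnum_mult_add) (auto simp: algebra_simps)
  then show ?thesis by (simp add: g_def a_def algebra_simps)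
qed

text \<open>With these abbreviations \<open>E\<close> sends the pair (w^H, w^S) at position k to
  position k - 1 by \<open>sg\<close> times g k plus a fixed 2 by 2 matrix. That matrix kills 2 a
  w^H + w^S and multiplies a w^H + w^S by -a, which is where the two distinguished combinations come
  from.\<close>

lemma g_coeffs:
  "2 * qnum r (1 + of_nat i - of_nat k + \<epsilon>) * qnum r (of_nat k)
     - qnum r (1 + of_nat i - of_nat k) * qnum r (of_nat k - \<epsilon>) = g k + a" (is "2 * ?x * ?y - ?z * ?w = _")
  "2 * qnum r (1 + of_nat i - of_nat k) * qnum r (of_nat k - \<epsilon>)
     - qnum r (1 + of_nat i - of_nat k + \<epsilon>) * qnum r (of_nat k) = g k - 2 * a"
proof -
  have "?x * ?y - ?z * ?w = a" using g_diff[of k] by (simp only: g_def)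
  then show "2 * ?x * ?y - ?z * ?w = g k + a" "2 * ?z * ?w - ?x * ?y = g k - 2 * a"
    unfolding g_def by (simp_all only: mult.assoc) (simp_all add: diff_eq_eq)
qed

section \<open>The action of E and F on the four strings\<close>

lemma E_L_0: "E (L 0) = sg *\<^sub>c ((2 * a) *\<^sub>c Hv i + S i)"
  by (simp add: op_basis fun_eq_iff algebra_simps a_def sg_def)

lemma E_L_Suc:
  assumes "Suc k \<le> r - 2 - i"
  shows "E (L (Suc k)) = (- sg * (qnum r (2 + of_nat i + of_nat k) * qnum r (of_nat k + 1 - \<epsilon>))) *\<^sub>c L k"
proof -
  have "E (L (Suc k)) = ((-1) powi (l + 1) * qnum r (1 + of_nat i + of_nat (Suc k)) *
      qnum r (of_nat (Suc k) - \<epsilon>)) *\<^sub>c L k"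
    using assms by (simp add: op_basis del: of_nat_Suc)
  also have "(-1) powi (l + 1) * qnum r (1 + of_nat i + of_nat (Suc k)) * qnum r (of_nat (Suc k) - \<epsilon>)
      = - sg * (qnum r (2 + of_nat i + of_nat k) * qnum r (of_nat k + 1 - \<epsilon>))"
    unfolding sg_Suc by (simp add: algebra_simps)
  finally show ?thesis .
qed

lemma E_H_0: "E (Hv 0) = sg *\<^sub>c R 0"
  by (simp add: op_basis sg_def)

lemma E_H_Suc:
  assumes "Suc k \<le> i"
  shows "E (Hv (Suc k)) = sg *\<^sub>c ((g (Suc k) + a) *\<^sub>c Hv k + S k)"
proof -
  have "E (Hv (Suc k)) = ((g (Suc k) + a) * sg) *\<^sub>c Hv k + sg *\<^sub>c S k"
    using assms unfolding g_coeffs(1)[symmetric] by (simp add: op_basis sg_def del: of_nat_Suc)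
  then show ?thesis by (simp add: fun_eq_iff algebra_simps)
qed

lemma E_S_0: "E (S 0) = (- 2 * a * sg) *\<^sub>c R 0"
proof -
  have "E (S 0) = (2 * (-1) powi (l + 1) * qnum r (1 + of_nat i) * qnum r \<epsilon>) *\<^sub>c R 0"
    by (simp add: op_basis)
  then show ?thesis unfolding sg_Suc by (simp add: a_def algebra_simps)
qed

lemma E_S_Suc:
  assumes "Suc k \<le> i"
  shows "E (S (Suc k)) = sg *\<^sub>c ((g (Suc k) - 2 * a) *\<^sub>c S k - (2 * a * a) *\<^sub>c Hv k)"
proof -
  have "E (S (Suc k)) = ((g (Suc k) - 2 * a) * sg) *\<^sub>c S k
      + (2 * (- sg) * (qnum r (1 + of_nat i))\<^sup>2 * (qnum r \<epsilon>)\<^sup>2) *\<^sub>c Hv k"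
    using assms unfolding g_coeffs(2)[symmetric] by (simp add: op_basis sg_def sg_Suc[unfolded sg_def] del: of_nat_Suc)
  also have "2 * (- sg) * (qnum r (1 + of_nat i))\<^sup>2 * (qnum r \<epsilon>)\<^sup>2 = - (2 * sg * a * a)"
    by (simp add: a_def power2_eq_square)
  finally show ?thesis by (simp add: fun_eq_iff algebra_simps)
qed

lemmas E_L = E_L_0 E_L_Suc
lemmas E_H = E_H_0 E_H_Suc
lemmas E_S = E_S_0 E_S_Suc

lemma E_R: "E (R (r - 2 - i)) = 0" "k < r - 2 - i \<Longrightarrow> E (R k) = sg *\<^sub>c R (Suc k)"
  by (simp_all add: op_basis sg_def)

lemma F_L: "F (L (r - 2 - i)) = 0" "k < r - 2 - i \<Longrightarrow> F (L k) = L (Suc k)"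
  by (simp_all add: op_basis)

lemma F_H: "F (Hv i) = L 0" "k < i \<Longrightarrow> F (Hv k) = Hv (Suc k)"
  by (simp_all add: op_basis)

lemma F_S: "F (S i) = (- a) *\<^sub>c L 0" "k < i \<Longrightarrow> F (S k) = S (Suc k)"
  by (simp_all add: op_basis a_def)

lemma F_R_0: "F (R 0) = S 0 + a *\<^sub>c Hv 0"
  by (simp add: op_basis a_def)

lemma F_R_Suc:
  assumes "Suc k \<le> r - 2 - i"
  shows "F (R (Suc k)) = (- (qnum r (2 + of_nat i + of_nat k) * qnum r (of_nat k + 1 + \<epsilon>))) *\<^sub>c R k"
proof -
  have "F (R (Suc k)) = (- qnum r (1 + of_nat i + of_nat (Suc k)) * qnum r (of_nat (Suc k) + \<epsilon>)) *\<^sub>c R k"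
    using assms by (simp add: op_basis del: of_nat_Suc)
  also have "- qnum r (1 + of_nat i + of_nat (Suc k)) * qnum r (of_nat (Suc k) + \<epsilon>)
      = - (qnum r (2 + of_nat i + of_nat k) * qnum r (of_nat k + 1 + \<epsilon>))"
    by (simp add: algebra_simps)
  finally show ?thesis .
qed

lemmas F_R = F_R_0 F_R_Suc

text \<open>At the last position k = r - 2 - i of the L and R strings this gives 2 + i + k = r.
  Since [r] = 0, the general coefficient then reproduces the zero at the end of the string.\<close>

lemma top_eq: "of_nat i + of_nat (r - 2 - i) = (of_nat r - 2 :: complex)"
proof -
  have "r = i + (r - 2 - i) + 2" using r2 ir by simp
  then have "(of_nat r :: complex) = of_nat i + of_nat (r - 2 - i) + 2" by (metis of_nat_add of_nat_numeral)
  then show ?thesis by simp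
qed

section \<open>The composites E F and F E\<close>

lemma EF_L:
  assumes "k \<le> r - 2 - i"
  shows "E (F (L k)) = (- sg * (qnum r (2 + of_nat i + of_nat k) * qnum r (of_nat k + 1 - \<epsilon>))) *\<^sub>c L k"
proof (cases "k = r - 2 - i")
  case True
  then have "2 + of_nat i + of_nat k = (of_nat r :: complex)"
    using top_eq by (simp add: algebra_simps)
  moreover have "E (F (L k)) = 0" unfolding True F_L(1) by (simp add: op_simps)
  ultimately show ?thesis using r2 by (simp add: fun_eq_iff)
next
  case False
  then show ?thesis using assms by (simp add: F_L E_L)
qed

lemma FE_L:
  assumes "k \<le> r - 2 - i"
  shows "F (E (L k)) = (- sg * (qnum r (1 + of_nat i + of_nat k) * qnum r (of_nat k - \<epsilon>))) *\<^sub>c L k"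
proof (cases k)
  case 0
  have "F (E (L 0)) = (sg * a) *\<^sub>c L 0"
    by (simp add: E_L F_H F_S op_simps fun_eq_iff algebra_simps)
  then show ?thesis by (simp add: 0 qnum_minus a_def)
next
  case (Suc m)
  then show ?thesis using assms by (simp add: F_L E_L op_simps algebra_simps)
qed

lemma EF_R:
  assumes "k \<le> r - 2 - i"
  shows "E (F (R k)) = (- sg * (qnum r (1 + of_nat i + of_nat k) * qnum r (of_nat k + \<epsilon>))) *\<^sub>c R k"
proof (cases k)
  case 0
  have "E (F (R 0)) = (- sg * a) *\<^sub>c R 0"
    by (simp add: F_R E_H E_S op_simps fun_eq_iff algebra_simps)
  then show ?thesis by (simp add: 0 a_def)
next
  case (Suc m)
  then show ?thesis using assms by (simp add: F_R E_R op_simps algebra_simps)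
qed

lemma FE_R:
  assumes "k \<le> r - 2 - i"
  shows "F (E (R k)) = (- sg * (qnum r (2 + of_nat i + of_nat k) * qnum r (of_nat k + 1 + \<epsilon>))) *\<^sub>c R k"
proof (cases "k = r - 2 - i")
  case True
  then have "2 + of_nat i + of_nat k = (of_nat r :: complex)"
    using top_eq by (simp add: algebra_simps)
  moreover have "F (E (R k)) = 0" unfolding True E_R(1) by (simp add: op_simps)
  ultimately show ?thesis using r2 by (simp add: fun_eq_iff)
next
  case False
  then show ?thesis using assms by (simp add: F_R E_R op_simps)
qed

lemma EF_H:
  assumes "k \<le> i"
  shows "E (F (Hv k)) = sg *\<^sub>c ((g (Suc k) + a) *\<^sub>c Hv k + S k)"
proof (cases "k = i")
  case True
  then show ?thesis by (simp add: F_H E_L g_end)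
next
  case False
  then show ?thesis using assms by (simp add: F_H E_H)
qed

lemma FE_H:
  assumes "k \<le> i"
  shows "F (E (Hv k)) = sg *\<^sub>c ((g k + a) *\<^sub>c Hv k + S k)"
proof (cases k)
  case 0
  then show ?thesis by (simp add: F_R E_H op_simps add.commute)
next
  case (Suc m)
  then show ?thesis using assms by (simp add: F_S F_H E_H op_simps)
qed

lemma EF_S:
  assumes "k \<le> i"
  shows "E (F (S k)) = sg *\<^sub>c ((g (Suc k) - 2 * a) *\<^sub>c S k - (2 * a * a) *\<^sub>c Hv k)"
proof (cases "k = i")
  case True
  then show ?thesis by (simp add: F_S E_L g_end op_simps fun_eq_iff algebra_simps)
next
  case False
  then show ?thesis using assms by (simp add: F_S E_S)
qed

lemma FE_S:
  assumes "k \<le> i"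
  shows "F (E (S k)) = sg *\<^sub>c ((g k - 2 * a) *\<^sub>c S k - (2 * a * a) *\<^sub>c Hv k)"
proof (cases k)
  case 0
  then show ?thesis by (simp add: F_R E_S op_simps fun_eq_iff algebra_simps)
next
  case (Suc m)
  then show ?thesis using assms by (simp add: F_S F_H E_S op_simps)
qed

section \<open>Weights and the commutator relation\<close>

definition mu :: "x_label \<Rightarrow> complex" where
  "mu x = of_int (x_index i x) + of_int l * of_nat r + \<epsilon>"

text \<open>Both q^(l r) and q^(-l r) equal (-1)^l, so the same sign serves for \<open>K\<close> and
  its inverse.\<close>

lemma qpow_mu:
  "qpow r (mu x) = sg * qpow r (of_int (x_index i x) + \<epsilon>)"
  "qpow r (- mu x) = sg * qpow r (- (of_int (x_index i x) + \<epsilon>))"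
proof -
  have 1: "qpow r (of_int l * of_nat r) = sg" "qpow r (- (of_int l * of_nat r)) = sg"
    using qpow_int_mult_r[of r l] qpow_int_mult_r[of r "- l"] r2
    by (auto simp: sg_def power_int_minus power_int_minus_left)
  have "mu x = (of_int (x_index i x) + \<epsilon>) + of_int l * of_nat r"
    "- mu x = - (of_int (x_index i x) + \<epsilon>) + - (of_int l * of_nat r)" by (simp_all add: mu_def)
  then show "qpow r (mu x) = sg * qpow r (of_int (x_index i x) + \<epsilon>)"
    "qpow r (- mu x) = sg * qpow r (- (of_int (x_index i x) + \<epsilon>))"
    using 1 by (metis qpow_add mult.commute)+
qed

lemma qnum_mu: "qnum r (mu x) = sg * qnum r (of_int (x_index i x) + \<epsilon>)"
  by (simp add: qpow_mu qnum_def qbr_def algebra_simps diff_divide_distrib)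

lemma wt_basis:
  assumes "x \<in> basis X" shows "weight_vec r X (mu x) (bvec x)"
  using assms fin unfolding weight_vec_def qpow_mu
  by (auto simp: op_defs vspace_def) (simp_all add: X_mod_def mu_def sg_def)

lemma wt_index:
  assumes "x \<in> basis X" "of_int (x_index i x) + of_int l * of_nat r + \<epsilon> = \<mu>"
  shows "weight_vec r X \<mu> (c *\<^sub>c bvec x)"
  using wt_scale[OF wt_basis[OF assms(1)]] assms(2) by (simp add: mu_def)

lemma wt_E_basis:
  assumes "x \<in> basis X" shows "weight_vec r X (mu x + 2) (E (bvec x))"
  using assms unfolding op_basis(1)[OF assms]
  by (cases x) (auto simp: mu_def intro!: wt_lin(1) wt_index wt_0)

lemma wt_F_basis:
  assumes "x \<in> basis X" shows "weight_vec r X (mu x - 2) (F (bvec x))"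
proof -
  have *: "weight_vec r X \<mu> (bvec x)" if "x \<in> basis X"
    "of_int (x_index i x) + of_int l * of_nat r + \<epsilon> = \<mu>" for x \<mu>
    using wt_basis[OF that(1)] that(2) by (simp add: mu_def)
  show ?thesis
    using assms unfolding op_basis(2)[OF assms]
    by (cases x) (auto simp: mu_def intro!: wt_lin(1) wt_minus wt_index wt_0 *)
qed

text \<open>On the L and R strings the commutator is a difference of two products of quantum numbers
  at neighbouring positions. On the H and S strings \<open>E F\<close> and \<open>F E\<close> differ
  only in having g (k+1) in place of g k, so the non-diagonal parts cancel and the scalar g (k+1) -
  g k remains.\<close>

lemma EF_comm:
  assumes "x \<in> basis X"
  shows "E (F (bvec x)) - F (E (bvec x)) = qnum r (mu x) *\<^sub>c bvec x"
proof -
  have idL: "qnum r (- of_nat i - 2 - 2 * of_nat k + \<epsilon>) =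
    qnum r (1 + of_nat i + of_nat k) * qnum r (of_nat k - \<epsilon>)
    - qnum r (2 + of_nat i + of_nat k) * qnum r (of_nat k + 1 - \<epsilon>)" for k
  proof -
    have "qnum r (of_nat i + 2 + 2 * of_nat k - \<epsilon>) * qnum r 1
      + qnum r (1 + of_nat i + of_nat k) * qnum r (of_nat k - \<epsilon>)
      = qnum r (2 + of_nat i + of_nat k) * qnum r (of_nat k + 1 - \<epsilon>)"
      by (rule qnum_mult_add) (auto simp: algebra_simps)
    moreover have "qnum r (- of_nat i - 2 - 2 * of_nat k + \<epsilon>) = - qnum r (of_nat i + 2 + 2 * of_nat k - \<epsilon>)"
      unfolding qnum_minus[symmetric] by (simp add: algebra_simps)
    ultimately show ?thesis using r2 by (simp add: algebra_simps)
  qed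
  have idR: "qnum r (of_nat i + 2 + 2 * of_nat k + \<epsilon>) =
    qnum r (2 + of_nat i + of_nat k) * qnum r (of_nat k + 1 + \<epsilon>)
    - qnum r (1 + of_nat i + of_nat k) * qnum r (of_nat k + \<epsilon>)" for k
  proof -
    have "qnum r (of_nat i + 2 + 2 * of_nat k + \<epsilon>) * qnum r 1
      + qnum r (1 + of_nat i + of_nat k) * qnum r (of_nat k + \<epsilon>)
      = qnum r (2 + of_nat i + of_nat k) * qnum r (of_nat k + 1 + \<epsilon>)"
      by (rule qnum_mult_add) (auto simp: algebra_simps)
    then show ?thesis using r2 by (simp add: algebra_simps)
  qed
  have idg: "qnum r (of_nat i - 2 * of_nat k + \<epsilon>) = g (Suc k) - g k" for k
  proof -
    have "qnum r (1 + of_nat i - of_nat k + \<epsilon>) * qnum r (of_nat k) + qnum r 1 * qnum r (of_nat i - 2 * of_nat k + \<epsilon>)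
      = qnum r (1 + of_nat i - of_nat (Suc k) + \<epsilon>) * qnum r (of_nat (Suc k))"
      by (rule qnum_mult_add) (auto simp: algebra_simps)
    then show ?thesis using r2 by (simp add: g_def algebra_simps)
  qed
  show ?thesis
  proof (cases x)
    case (wL k)
    have "qnum r (mu x) = sg * qnum r (- of_nat i - 2 - 2 * of_nat k + \<epsilon>)" by (simp add: qnum_mu wL)
    then show ?thesis using assms unfolding idL wL
      by (simp add: EF_L FE_L) (simp add: fun_eq_iff algebra_simps)
  next
    case (wR k)
    have "qnum r (mu x) = sg * qnum r (of_nat i + 2 + 2 * of_nat k + \<epsilon>)" by (simp add: qnum_mu wR)
    then show ?thesis using assms unfolding idR wR
      by (simp add: EF_R FE_R) (simp add: fun_eq_iff algebra_simps)
  next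
    case (wH k)
    have "qnum r (mu x) = sg * qnum r (of_nat i - 2 * of_nat k + \<epsilon>)" by (simp add: qnum_mu wH)
    then show ?thesis using assms unfolding idg wH
      by (simp add: EF_H FE_H) (simp add: fun_eq_iff algebra_simps)
  next
    case (wS k)
    have "qnum r (mu x) = sg * qnum r (of_nat i - 2 * of_nat k + \<epsilon>)" by (simp add: qnum_mu wS)
    then show ?thesis using assms unfolding idg wS
      by (simp add: EF_S FE_S) (simp add: fun_eq_iff algebra_simps)
  qed
qed

section \<open>Nilpotency of E and F on X\<close>

definition kerE :: "nat \<Rightarrow> x_label vec set" where "kerE n = {v. (E ^^ n) v = 0}"
definition kerF :: "nat \<Rightarrow> x_label vec set" where "kerF n = {v. (F ^^ n) v = 0}"

lemma ker_lin:
  "v \<in> kerE n \<Longrightarrow> w \<in> kerE n \<Longrightarrow> v + w \<in> kerE n" "v \<in> kerE n \<Longrightarrow> c *\<^sub>c v \<in> kerE n" "v \<in> kerE n \<Longrightarrow> - v \<in> kerE n" "0 \<in> kerE n"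
  "v \<in> kerE n \<Longrightarrow> w \<in> kerE n \<Longrightarrow> v - w \<in> kerE n"
  "v \<in> kerF n \<Longrightarrow> w \<in> kerF n \<Longrightarrow> v + w \<in> kerF n" "v \<in> kerF n \<Longrightarrow> c *\<^sub>c v \<in> kerF n" "v \<in> kerF n \<Longrightarrow> - v \<in> kerF n" "0 \<in> kerF n"
  "v \<in> kerF n \<Longrightarrow> w \<in> kerF n \<Longrightarrow> v - w \<in> kerF n"
  by (simp_all add: kerE_def kerF_def funpow_op_simps)

lemma ker_Suc: "E v \<in> kerE n \<Longrightarrow> v \<in> kerE (Suc n)" "F v \<in> kerF n \<Longrightarrow> v \<in> kerF (Suc n)"
  by (simp_all add: kerE_def kerF_def funpow_swap1)

lemma ker_mono: "v \<in> kerE n \<Longrightarrow> n \<le> m \<Longrightarrow> v \<in> kerE m" "v \<in> kerF n \<Longrightarrow> n \<le> m \<Longrightarrow> v \<in> kerF m"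
proof -
  have "(E ^^ m) v = (E ^^ (m - n)) ((E ^^ n) v)" "(F ^^ m) v = (F ^^ (m - n)) ((F ^^ n) v)" if "n \<le> m"
    using that by (metis comp_apply funpow_add le_add_diff_inverse2)+
  then show "v \<in> kerE n \<Longrightarrow> n \<le> m \<Longrightarrow> v \<in> kerE m" "v \<in> kerF n \<Longrightarrow> n \<le> m \<Longrightarrow> v \<in> kerF m"
    by (simp_all add: kerE_def kerF_def funpow_op_simps)
qed

text \<open>The order of nilpotency is tracked along the strings, ending with R. For L the bound
  inherited from w^H and w^S at position i would be r + 1 already at k = 0; the sharper bound uses
  that \<open>E (L 0)\<close> is a multiple of 2 a w^H + w^S.\<close>

lemma nilpotent_E:
  assumes x: "x \<in> basis X" shows "(E ^^ r) (bvec x) = 0"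
proof -
  have R: "R k \<in> kerE (Suc n)" if "k + n = r - 2 - i" for k n
    using that
  proof (induction n arbitrary: k)
    case 0
    then have "E (R k) \<in> kerE 0" using E_R(1) by (simp add: kerE_def)
    then show ?case by (rule ker_Suc)
  next
    case (Suc n)
    then have "E (R k) \<in> kerE (Suc n)" using E_R(2)[of k] Suc.IH[of "Suc k"] by (simp add: ker_lin)
    then show ?case by (rule ker_Suc)
  qed
  have HS: "Hv k \<in> kerE (k + r - i) \<and> S k \<in> kerE (k + r - i)" if "k \<le> i" for k
    using that
  proof (induction k)
    case 0
    have "R 0 \<in> kerE (r - Suc i)" using R[of 0 "r - 2 - i"] r2 ir by (simp add: Suc_diff_Suc)
    then have "Hv 0 \<in> kerE (Suc (r - Suc i))" "S 0 \<in> kerE (Suc (r - Suc i))"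
      by (auto intro!: ker_Suc simp: E_H_0 E_S_0 ker_lin)
    moreover have "Suc (r - Suc i) = 0 + r - i" using r2 ir by simp
    ultimately show ?case by simp
  next
    case (Suc k)
    then have "Hv k \<in> kerE (k + r - i)" "S k \<in> kerE (k + r - i)" by auto
    then have "Hv (Suc k) \<in> kerE (Suc (k + r - i))" "S (Suc k) \<in> kerE (Suc (k + r - i))"
      using Suc.prems by (auto intro!: ker_Suc ker_lin simp: E_H_Suc E_S_Suc)
    moreover have "Suc (k + r - i) = Suc k + r - i" using r2 ir by simp
    ultimately show ?case by simp
  qed
  \<comment> \<open>\<open>E\<close> moves this combination along its own line and kills it at k =
    0, so it never enters the R string.\<close>
  have U: "(2 * a) *\<^sub>c Hv k + S k \<in> kerE (Suc k)" if "k \<le> i" for k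
    using that
  proof (induction k)
    case 0
    have "E ((2 * a) *\<^sub>c Hv 0 + S 0) \<in> kerE 0" by (simp add: kerE_def op_simps E_H_0 E_S_0 fun_eq_iff)
    then show ?case by (rule ker_Suc(1))
  next
    case (Suc k)
    have "E ((2 * a) *\<^sub>c Hv (Suc k) + S (Suc k)) = (sg * g (Suc k)) *\<^sub>c ((2 * a) *\<^sub>c Hv k + S k)"
      using Suc.prems by (simp add: op_simps E_H_Suc E_S_Suc fun_eq_iff algebra_simps)
    also have "\<dots> \<in> kerE (Suc k)" by (rule ker_lin(2), rule Suc.IH) (use Suc.prems in simp)
    finally show ?case by (rule ker_Suc(1))
  qed
  have L: "L k \<in> kerE (k + i + 2)" if "k \<le> r - 2 - i" for k
    using that
  proof (induction k)
    case 0
    have "E (L 0) \<in> kerE (Suc i)" unfolding E_L_0 by (rule ker_lin(2)[OF U]) simp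
    then show ?case using ker_Suc(1) by fastforce
  next
    case (Suc k)
    then have "E (L (Suc k)) \<in> kerE (k + i + 2)" by (simp add: E_L_Suc ker_lin)
    then show ?case using ker_Suc(1) by fastforce
  qed
  have "bvec x \<in> kerE r"
  proof (cases x)
    case (wL k) then show ?thesis using x r2 ir by (auto intro: ker_mono(1)[OF L])
  next
    case (wH k) then show ?thesis using x r2 ir by (auto intro: ker_mono(1)[OF HS[THEN conjunct1]])
  next
    case (wS k) then show ?thesis using x r2 ir by (auto intro: ker_mono(1)[OF HS[THEN conjunct2]])
  next
    case (wR k) then show ?thesis
      using x r2 ir by (auto intro!: ker_mono(1)[OF R[of k "r - 2 - i - k"]])
  qed
  then show ?thesis by (simp add: kerE_def)
qed

text \<open>The mirror image of the argument for \<open>E\<close>: now L is the final string, and R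
  is controlled because \<open>F (R 0)\<close> is the combination w^S + a w^H, which
  \<open>F\<close> kills at position i.\<close>

lemma nilpotent_F:
  assumes x: "x \<in> basis X" shows "(F ^^ r) (bvec x) = 0"
proof -
  have L: "L k \<in> kerF (Suc n)" if "k + n = r - 2 - i" for k n
    using that
  proof (induction n arbitrary: k)
    case 0
    then have "F (L k) \<in> kerF 0" using F_L(1) by (simp add: kerF_def)
    then show ?case by (rule ker_Suc)
  next
    case (Suc n)
    then have "F (L k) \<in> kerF (Suc n)" using F_L(2)[of k] Suc.IH[of "Suc k"] by simp
    then show ?case by (rule ker_Suc)
  qed
  \<comment> \<open>The third bound is the sharper one: the L components of F w^S and a F w^H at
    position i are -a and a, and cancel.\<close>
  have HS: "Hv k \<in> kerF (r - i + n) \<and> S k \<in> kerF (r - i + n)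
      \<and> S k + a *\<^sub>c Hv k \<in> kerF (Suc n)" if "k + n = i" for k n
    using that
  proof (induction n arbitrary: k)
    case 0
    then have k: "k = i" by simp
    have "L 0 \<in> kerF (r - Suc i)" using L[of 0 "r - 2 - i"] r2 ir by (simp add: Suc_diff_Suc)
    then have "Hv i \<in> kerF (Suc (r - Suc i))" "S i \<in> kerF (Suc (r - Suc i))"
      by (auto intro!: ker_Suc simp: F_H F_S ker_lin)
    moreover have "Suc (r - Suc i) = r - i + 0" using r2 ir by simp
    moreover have "F (S i + a *\<^sub>c Hv i) \<in> kerF 0" by (simp add: kerF_def op_simps F_H F_S fun_eq_iff)
    then have "S i + a *\<^sub>c Hv i \<in> kerF (Suc 0)" by (rule ker_Suc(2))
    ultimately have "Hv k \<in> kerF (r - i + 0) \<and> S k \<in> kerF (r - i + 0)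
      \<and> S k + a *\<^sub>c Hv k \<in> kerF (Suc 0)" by (simp add: k)
    then show ?case .
  next
    case (Suc n)
    then have IH: "Hv (Suc k) \<in> kerF (r - i + n)" "S (Suc k) \<in> kerF (r - i + n)"
      "S (Suc k) + a *\<^sub>c Hv (Suc k) \<in> kerF (Suc n)" using Suc.IH[of "Suc k"] Suc.prems by (simp_all only: add_Suc_right add_Suc)
    have "F (S k + a *\<^sub>c Hv k) = S (Suc k) + a *\<^sub>c Hv (Suc k)"
      using Suc.prems by (simp add: op_simps F_H F_S)
    also note IH(3)
    finally have "S k + a *\<^sub>c Hv k \<in> kerF (Suc (Suc n))" by (rule ker_Suc(2))
    moreover have "k < i" using Suc.prems by simp
    then have "Hv k \<in> kerF (Suc (r - i + n))" "S k \<in> kerF (Suc (r - i + n))"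
      using IH(1,2) by (auto intro!: ker_Suc simp: F_H F_S)
    ultimately have "Hv k \<in> kerF (r - i + Suc n) \<and> S k \<in> kerF (r - i + Suc n)
      \<and> S k + a *\<^sub>c Hv k \<in> kerF (Suc (Suc n))" by simp
    then show ?case .
  qed
  have R: "R k \<in> kerF (k + i + 2)" if "k \<le> r - 2 - i" for k
    using that
  proof (induction k)
    case 0
    have "F (R 0) \<in> kerF (Suc i)" unfolding F_R_0 using HS[of 0 i] by simp
    then show ?case using ker_Suc(2) by fastforce
  next
    case (Suc k)
    then have "F (R (Suc k)) \<in> kerF (k + i + 2)" by (simp add: F_R_Suc ker_lin)
    then show ?case using ker_Suc(2) by fastforce
  qed
  have "bvec x \<in> kerF r"
  proof (cases x)
    case (wL k) then show ?thesis
      using x r2 ir by (auto intro!: ker_mono(2)[OF L[of k "r - 2 - i - k"]])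
  next
    case (wH k) then show ?thesis
      using x r2 ir HS[of k "i - k"] by (auto intro: ker_mono(2)[of _ "r - i + (i - k)"])
  next
    case (wS k) then show ?thesis
      using x r2 ir HS[of k "i - k"] by (auto intro: ker_mono(2)[of _ "r - i + (i - k)"])
  next
    case (wR k) then show ?thesis using x r2 ir by (auto intro: ker_mono(2)[OF R])
  qed
  then show ?thesis by (simp add: kerF_def)
qed

lemma module_X: "uqH_module r X" "weight_module r X"
  using weight_moduleI[OF r2 fin wt_basis wt_E_basis wt_F_basis EF_comm nilpotent_E nilpotent_F]
  by blast+

end

section \<open>The generic case\<close>

lemma inl_inr_vec [simp]:
  "inl_vec 0 = 0" "inl_vec (c *\<^sub>c u) = c *\<^sub>c inl_vec u" "inl_vec (bvec m) = bvec (Inl m)"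
  "inr_vec 0 = 0" "inr_vec (c *\<^sub>c v) = c *\<^sub>c inr_vec v" "inr_vec (bvec n) = bvec (Inr n)"
  by (auto simp: inl_vec_def inr_vec_def bvec_def fun_eq_iff split: sum.splits)

text \<open>The inverse map undoes \<open>f\<close> only on \<open>vspace M\<close>; the closure
  hypothesis keeps the operators of \<open>M\<close> inside that set.\<close>

lemma mod_iso_sym:
  assumes "M \<cong>\<^sub>m N"
    and uq: "\<And>v. opE M v \<in> vspace M \<and> opF M v \<in> vspace M \<and> opK M v \<in> vspace M \<and> opKi M v \<in> vspace M \<and> opH M v \<in> vspace M"
  shows "N \<cong>\<^sub>m M"
proof -
  from assms obtain f where f: "mod_hom M N f" "bij_betw f (vspace M) (vspace N)"
    by (auto simp: mod_iso_def)
  define h where "h = inv_into (vspace M) f"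
  have h: "bij_betw h (vspace N) (vspace M)" unfolding h_def by (rule bij_betw_inv_into[OF f(2)])
  have hin: "h w \<in> vspace M" and fh: "f (h w) = w" if "w \<in> vspace N" for w
    using that h bij_betw_inv_into_right[OF f(2)] by (auto simp: h_def bij_betw_def)
  have hf: "h (f v) = v" if "v \<in> vspace M" for v
    unfolding h_def using bij_betw_inv_into_left[OF f(2) that] .
  have sub: "v + w \<in> vspace M" "c *\<^sub>c v \<in> vspace M" if "v \<in> vspace M" "w \<in> vspace M" for v w c
    using that by (auto simp: vspace_def)
  have key: "h (f v) = v \<Longrightarrow> f v = w \<Longrightarrow> h w = v" for v w by simp
  have "mod_hom N M h"
    unfolding mod_hom_def
  proof (intro conjI ballI allI)
    show "h w \<in> vspace M" if "w \<in> vspace N" for w by (rule hin[OF that])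
  next
    fix v w assume v: "v \<in> vspace N" and w: "w \<in> vspace N"
    show "h (v + w) = h v + h w"
      by (rule key[OF hf[OF sub(1)[OF hin[OF v] hin[OF w]]]])
        (use f(1) hin[OF v] hin[OF w] fh[OF v] fh[OF w] in \<open>simp only: mod_hom_def\<close>)
  next
    fix c v assume v: "v \<in> vspace N"
    show "h (c *\<^sub>c v) = c *\<^sub>c h v"
      by (rule key[OF hf[OF sub(2)[OF hin[OF v] hin[OF v]]]])
        (use f(1) hin[OF v] fh[OF v] in \<open>simp only: mod_hom_def\<close>)
  next
    fix v assume v: "v \<in> vspace N"
    note m = uq[of "h v"] and ff = f(1)[unfolded mod_hom_def] hin[OF v] fh[OF v]
    show "h (opE N v) = opE M (h v)"
      by (rule key[OF hf]) (use m ff in \<open>simp_all only:\<close>)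
    show "h (opF N v) = opF M (h v)"
      by (rule key[OF hf]) (use m ff in \<open>simp_all only:\<close>)
    show "h (opK N v) = opK M (h v)"
      by (rule key[OF hf]) (use m ff in \<open>simp_all only:\<close>)
    show "h (opKi N v) = opKi M (h v)"
      by (rule key[OF hf]) (use m ff in \<open>simp_all only:\<close>)
    show "h (opH N v) = opH M (h v)"
      by (rule key[OF hf]) (use m ff in \<open>simp_all only:\<close>)
  qed
  with h show ?thesis by (auto simp: mod_iso_def)
qed

context uqH
begin

text \<open>The powers of \<open>F\<close> on a highest weight vector satisfy the formulas that
  define V_\<alpha>. Since \<open>E x = 0\<close>, only the scalar term of \<open>E_Fn\<close>
  survives.\<close>

lemma highest_weight_action:
  assumes x: "wt (\<alpha> + of_nat r - 1) x" and Ex: "E x = 0"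
  shows "E ((F ^^ n) x) =
      (if n = 0 then 0 else (qnum r (of_nat n) * qnum r (of_nat n - \<alpha>)) *\<^sub>c (F ^^ (n - 1)) x)"
    and "F ((F ^^ n) x) = (if n = r - 1 then 0 else (F ^^ (n + 1)) x)"
    and "H ((F ^^ n) x) = (\<alpha> + of_nat r - 1 - 2 * of_nat n) *\<^sub>c (F ^^ n) x"
    and "K ((F ^^ n) x) = qpow r (\<alpha> + of_nat r - 1 - 2 * of_nat n) *\<^sub>c (F ^^ n) x"
    and "Ki ((F ^^ n) x) = qpow r (- (\<alpha> + of_nat r - 1 - 2 * of_nat n)) *\<^sub>c (F ^^ n) x"
proof -
  have "E ((F ^^ Suc n) x) = (qnum r (of_nat (Suc n)) * qnum r (of_nat (Suc n) - \<alpha>)) *\<^sub>c (F ^^ n) x" for n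
  proof -
    \<comment> \<open>The shift by r changes the sign of the quantum number, and this sign turns
      \<alpha> - 1 - n into n + 1 - \<alpha>, as in the definition of V_\<alpha>.\<close>
    have "qnum r (\<alpha> + of_nat r - 1 - of_nat n) = qnum r ((\<alpha> - 1 - of_nat n) + of_nat r)"
      by (simp add: algebra_simps)
    also have "\<dots> = - qnum r (\<alpha> - 1 - of_nat n)"
      by (rule qnum_add_r) (use r2 in simp)
    also have "\<dots> = qnum r (of_nat (Suc n) - \<alpha>)"
      unfolding qnum_minus[symmetric] by (simp add: algebra_simps)
    finally have *: "qnum r (\<alpha> + of_nat r - 1 - of_nat n) = qnum r (of_nat (Suc n) - \<alpha>)" .
    have "of_nat n + 1 = (of_nat (Suc n) :: complex)" by simp
    then show ?thesis
      unfolding E_Fn[OF x] Ex * by (simp add: funpow_op_simps del: funpow.simps of_nat_Suc)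
  qed
  from this[of "n - 1"] show "E ((F ^^ n) x) =
      (if n = 0 then 0 else (qnum r (of_nat n) * qnum r (of_nat n - \<alpha>)) *\<^sub>c (F ^^ (n - 1)) x)"
    using Ex by (cases n) (simp_all del: of_nat_Suc)
  have "(F ^^ r) x = 0" by (rule relations(10)[OF wt_in[OF x]])
  moreover have "F ((F ^^ n) x) = (F ^^ Suc n) x" by simp
  moreover have "Suc n = r" if "n = r - 1" using that r2 by simp
  ultimately show "F ((F ^^ n) x) = (if n = r - 1 then 0 else (F ^^ (n + 1)) x)"
    by (metis Suc_eq_plus1)
  note w = wt_Fn[OF x, of n, unfolded weight_vec_def]
  from w show "H ((F ^^ n) x) = (\<alpha> + of_nat r - 1 - 2 * of_nat n) *\<^sub>c (F ^^ n) x"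
    "K ((F ^^ n) x) = qpow r (\<alpha> + of_nat r - 1 - 2 * of_nat n) *\<^sub>c (F ^^ n) x"
    "Ki ((F ^^ n) x) = qpow r (- (\<alpha> + of_nat r - 1 - 2 * of_nat n)) *\<^sub>c (F ^^ n) x"
    by blast+
qed

lemma mod_hom_V_sum:
  assumes x: "wt (\<alpha> + of_nat r - 1) x" "E x = 0" and y: "wt (\<beta> + of_nat r - 1) y" "E y = 0"
  defines "B \<equiv> {..<r} <+> {..<r}" and "f \<equiv> case_sum (\<lambda>n. (F ^^ n) x) (\<lambda>n. (F ^^ n) y)"
  shows "mod_hom (V_mod r \<alpha> \<oplus>\<^sub>m V_mod r \<beta>) M (lin_ext B f)"
proof -
  define W where "W = V_mod r \<alpha> \<oplus>\<^sub>m V_mod r \<beta>"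
  have B: "B = basis W"
    by (simp add: W_def B_def direct_sum_def V_mod_def)
  have fB: "finite B" and in_B: "Inl n \<in> B \<longleftrightarrow> n < r" "Inr n \<in> B \<longleftrightarrow> n < r" for n
    by (auto simp: B_def)
  define gx where "gx n = (F ^^ n) x" for n
  define gy where "gy n = (F ^^ n) y" for n
  have f: "f (Inl n) = gx n" "f (Inr n) = gy n" for n by (simp_all add: f_def gx_def gy_def)
  note act = highest_weight_action[OF x, folded gx_def] highest_weight_action[OF y, folded gy_def]
  have g_in: "gx n \<in> vspace M" "gy n \<in> vspace M" for n
    using wt_in[OF x(1)] wt_in[OF y(1)] by (simp_all add: gx_def gy_def)
  note simps = f W_def direct_sum_def V_mod_def sum_act_def lin_ext_simps fB in_B act
  have main: "lin_ext B f (actE W b) = E (f b) \<and> lin_ext B f (actF W b) = F (f b) \<and>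
      lin_ext B f (actK W b) = K (f b) \<and> lin_ext B f (actKi W b) = Ki (f b) \<and>
      lin_ext B f (actH W b) = H (f b)" if "b \<in> B" for b
    using that by (cases b) (auto simp: simps)
  show ?thesis unfolding B W_def[symmetric]
  proof (rule mod_hom_lin_ext, unfold B[symmetric])
    show "f b \<in> vspace M" if "b \<in> B" for b using g_in by (cases b) (auto simp: f)
  qed (use main fB in blast)+
qed

end

section \<open>Splitting of X at nonzero parameter\<close>

context X_setup
begin

sublocale uqX: uqH r X
  by unfold_locales (rule r2, rule module_X(1))

context
  assumes a_nz: "a \<noteq> 0"
    and F_R_nz: "\<And>k. k < r - 2 - i \<Longrightarrow> qnum r (2 + of_nat i + of_nat k) * qnum r (of_nat k + 1 + \<epsilon>) \<noteq> 0"
begin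

text \<open>\<open>N\<close> is the last position of the L and R strings.\<close>

abbreviation "N \<equiv> r - Suc (Suc i)"
abbreviation "hwv \<equiv> (2 * a) *\<^sub>c Hv 0 + S 0"

lemma Fn_hwv: "n \<le> i \<Longrightarrow> (F ^^ n) hwv = (2 * a) *\<^sub>c Hv n + S n"
proof (induction n)
  case (Suc n)
  then have "n \<le> i" by simp
  from Suc.IH[OF this] have IH: "(F ^^ n) hwv = (2 * a) *\<^sub>c Hv n + S n" .
  have "(F ^^ Suc n) hwv = (2 * a) *\<^sub>c Hv (Suc n) + S (Suc n)"
    using Suc.prems by (simp only: funpow.simps comp_apply IH) (simp add: op_simps F_H F_S)
  then show ?case .
qed simp

text \<open>At the passage from position i into L, the coefficients 2a from w^H and -a from w^S
  combine to a, which is nonzero; so the chain of \<open>hwv\<close> continues through all of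
  L.\<close>

lemma Fn_hwv_L: "k \<le> N \<Longrightarrow> (F ^^ (Suc i + k)) hwv = a *\<^sub>c L k"
proof (induction k)
  case 0
  have "(F ^^ (Suc i + 0)) hwv = a *\<^sub>c L 0"
    unfolding add_0_right funpow.simps comp_apply Fn_hwv[OF order_refl]
    by (simp add: op_simps F_H F_S fun_eq_iff)
  then show ?case .
next
  case (Suc k)
  then have "k \<le> N" by simp
  from Suc.IH[OF this] have IH: "(F ^^ (Suc i + k)) hwv = a *\<^sub>c L k" .
  have "(F ^^ (Suc i + Suc k)) hwv = a *\<^sub>c L (Suc k)"
    using Suc.prems unfolding add_Suc_right[of "Suc i"] funpow.simps comp_apply IH
    by (simp add: op_simps F_L)
  then show ?case .
qed

text \<open>The product of the first n coefficients of \<open>F\<close> met when descending the R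
  string from its top vector.\<close>

definition top_coeff :: "nat \<Rightarrow> complex" where
  "top_coeff n = (\<Prod>k<n. - (qnum r (2 + of_nat i + of_nat (N - Suc k)) * qnum r (of_nat (N - Suc k) + 1 + \<epsilon>)))"

lemma top_coeff_nz: "n \<le> N \<Longrightarrow> top_coeff n \<noteq> 0"
proof -
  assume "n \<le> N"
  then have "qnum r (2 + of_nat i + of_nat (N - Suc k)) * qnum r (of_nat (N - Suc k) + 1 + \<epsilon>) \<noteq> 0"
    if "k < n" for k using that by (intro F_R_nz) simp
  then show ?thesis
    unfolding top_coeff_def prod_zero_iff[OF finite_lessThan] neg_equal_0_iff_equal by blast
qed

lemma Fn_top: "n \<le> N \<Longrightarrow> (F ^^ n) (R N) = top_coeff n *\<^sub>c R (N - n)"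
proof (induction n)
  case 0
  have "(F ^^ 0) (R N) = top_coeff 0 *\<^sub>c R (N - 0)" by (simp add: top_coeff_def fun_eq_iff)
  then show ?case .
next
  case (Suc n)
  then have n: "n \<le> N" "N - n = Suc (N - Suc n)" by simp_all
  from Suc.IH[OF n(1)] have IH: "(F ^^ n) (R N) = top_coeff n *\<^sub>c R (Suc (N - Suc n))"
    unfolding n(2) .
  have "F (R (Suc (N - Suc n))) = (- (qnum r (2 + of_nat i + of_nat (N - Suc n))
      * qnum r (of_nat (N - Suc n) + 1 + \<epsilon>))) *\<^sub>c R (N - Suc n)"
    by (rule F_R_Suc) (use Suc.prems in simp)
  then have "(F ^^ Suc n) (R N) = top_coeff (Suc n) *\<^sub>c R (N - Suc n)"
    unfolding funpow.simps comp_apply IH by (simp only: op_simps) (simp add: top_coeff_def)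
  then show ?case .
qed

lemma Fn_top_HS: "k \<le> i \<Longrightarrow> (F ^^ (Suc N + k)) (R N) = top_coeff N *\<^sub>c (S k + a *\<^sub>c Hv k)"
proof (induction k)
  case 0
  have "(F ^^ (Suc N + 0)) (R N) = top_coeff N *\<^sub>c (S 0 + a *\<^sub>c Hv 0)"
    unfolding add_0_right funpow.simps comp_apply Fn_top[OF order_refl]
    by (simp add: op_simps F_R_0)
  then show ?case .
next
  case (Suc k)
  then have "k \<le> i" by simp
  from Suc.IH[OF this] have IH: "(F ^^ (Suc N + k)) (R N) = top_coeff N *\<^sub>c (S k + a *\<^sub>c Hv k)" .
  have "(F ^^ (Suc N + Suc k)) (R N) = top_coeff N *\<^sub>c (S (Suc k) + a *\<^sub>c Hv (Suc k))"
    using Suc.prems unfolding add_Suc_right[of "Suc N"] funpow.simps comp_apply IH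
    by (simp add: op_simps F_H F_S)
  then show ?case .
qed

lemma wt_hwv: "weight_vec r X (of_nat i + of_int l * of_nat r + \<epsilon>) hwv" "E hwv = 0"
  by (auto intro!: wt_lin(1) wt_index wt_basis[of "wS 0", unfolded mu_def, simplified])
    (simp add: op_simps E_H_0 E_S_0 fun_eq_iff)

lemma wt_top: "weight_vec r X (2 * of_nat r - 2 - of_nat i + of_int l * of_nat r + \<epsilon>) (R N)" "E (R N) = 0"
proof -
  have "of_int (x_index i (wR N)) = (2 * of_nat r - 2 - of_nat i :: complex)"
  proof -
    have "(of_nat N :: complex) = of_nat r - 2 - of_nat i" using top_eq by (simp add: algebra_simps)
    then show ?thesis by simp
  qed
  then show "weight_vec r X (2 * of_nat r - 2 - of_nat i + of_int l * of_nat r + \<epsilon>) (R N)"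
    using wt_basis[of "wR N"] unfolding mu_def by (simp del: x_index.simps)
  show "E (R N) = 0" using E_R(1) by simp
qed

text \<open>With t = \<open>top_coeff N\<close>, the two chains meet each pair of H and S vectors in
  2 a w^H + w^S and t (w^S + a w^H). This is a linear system of determinant a t, and the middle two
  clauses are its solution.\<close>

fun inv_basis :: "x_label \<Rightarrow> (nat + nat) vec" where
  "inv_basis (wL k) = (1 / a) *\<^sub>c bvec (Inl (Suc i + k))"
| "inv_basis (wH k) = (1 / a) *\<^sub>c (bvec (Inl k) - (1 / top_coeff N) *\<^sub>c bvec (Inr (Suc N + k)))"
| "inv_basis (wS k) = (2 / top_coeff N) *\<^sub>c bvec (Inr (Suc N + k)) - bvec (Inl k)"
| "inv_basis (wR k) = (1 / top_coeff (N - k)) *\<^sub>c bvec (Inr (N - k))"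

lemma X_iso_V_sum:
  "X \<cong>\<^sub>m V_mod r (1 + of_nat i - of_nat r + of_int l * of_nat r + \<epsilon>) \<oplus>\<^sub>m
       V_mod r (- 1 - of_nat i + of_nat r + of_int l * of_nat r + \<epsilon>)"
proof -
  let ?\<alpha> = "1 + of_nat i - of_nat r + of_int l * of_nat r + \<epsilon>"
  let ?\<beta> = "- 1 - of_nat i + of_nat r + of_int l * of_nat r + \<epsilon>"
  define B where "B = {..<r} <+> {..<r}"
  define f where "f = case_sum (\<lambda>n. (F ^^ n) hwv) (\<lambda>n. (F ^^ n) (R N))"
  \<comment> \<open>The r powers of \<open>F\<close> on \<open>hwv\<close> give i + 1 vectors in the
    H and S strings and N + 1 in L; those on the top vector of R give N + 1 in R and i + 1 in the H
    and S strings.\<close>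
  have r: "Suc i + Suc N = r" using r2 ir by simp
  have fB: "finite B" and in_B: "Inl n \<in> B \<longleftrightarrow> n < r" "Inr n \<in> B \<longleftrightarrow> n < r" for n
    by (auto simp: B_def)
  have B: "B = basis (V_mod r ?\<alpha> \<oplus>\<^sub>m V_mod r ?\<beta>)"
    by (simp add: B_def direct_sum_def V_mod_def)
  have wt: "weight_vec r X (?\<alpha> + of_nat r - 1) hwv" "weight_vec r X (?\<beta> + of_nat r - 1) (R N)"
    using wt_hwv(1) wt_top(1) by (simp_all add: algebra_simps)
  have hom: "mod_hom (V_mod r ?\<alpha> \<oplus>\<^sub>m V_mod r ?\<beta>) X (lin_ext B f)"
    unfolding B_def f_def by (rule uqX.mod_hom_V_sum[OF wt(1) wt_hwv(2) wt(2) wt_top(2)])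
  note tN = top_coeff_nz[OF order_refl]
  have f_Inl: "f (Inl n) = (2 * a) *\<^sub>c Hv n + S n" if "n \<le> i" for n
    unfolding f_def sum.case by (rule Fn_hwv[OF that])
  have f_Inl_L: "f (Inl (Suc i + k)) = a *\<^sub>c L k" if "k \<le> N" for k
    unfolding f_def sum.case by (rule Fn_hwv_L[OF that])
  have f_Inr: "f (Inr n) = top_coeff n *\<^sub>c R (N - n)" if "n \<le> N" for n
    unfolding f_def sum.case by (rule Fn_top[OF that])
  have f_Inr_HS: "f (Inr (Suc N + k)) = top_coeff N *\<^sub>c (S k + a *\<^sub>c Hv k)" if "k \<le> i" for k
    unfolding f_def sum.case by (rule Fn_top_HS[OF that])
  have cases_B: "(\<exists>n\<le>i. b = Inl n) \<or> (\<exists>k\<le>N. b = Inl (Suc i + k)) \<or>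
      (\<exists>n\<le>N. b = Inr n) \<or> (\<exists>k\<le>i. b = Inr (Suc N + k))" if "b \<in> B" for b
  proof (cases b)
    case (Inl n)
    show ?thesis
    proof (cases "n \<le> i")
      case False
      then obtain k where k: "n = Suc i + k" by (metis not_less_eq_eq le_iff_add)
      moreover have "n < r" using that Inl in_B by simp
      ultimately have "k \<le> N" by linarith
      with Inl k show ?thesis by blast
    qed (use Inl in blast)
  next
    case (Inr n)
    show ?thesis
    proof (cases "n \<le> N")
      case False
      then obtain k where k: "n = Suc N + k" by (metis not_less_eq_eq le_iff_add)
      moreover have "n < r" using that Inr in_B by simp
      ultimately have "k \<le> i" using r by linarith
      with Inr k show ?thesis by blast
    qed (use Inr in blast)
  qed
  have lB: "lin_ext B f (bvec (Inl n)) = f (Inl n)" "lin_ext B f (bvec (Inr n)) = f (Inr n)" if "n < r" for n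
    using that fB in_B by simp_all
  have lX: "lin_ext (basis X) inv_basis (bvec x) = inv_basis x" if "x \<in> basis X" for x
    using that fin by simp
  have bij: "bij_betw (lin_ext B f) (free_space B) (free_space (basis X))"
  proof (rule bij_betw_lin_ext[where g = inv_basis, OF fB fin])
    show "f b \<in> free_space (basis X)" if "b \<in> B" for b
      using hom that fB unfolding mod_hom_def B[symmetric] vspace_def
      by (metis B bvec_in lin_ext_bvec)
    show "inv_basis x \<in> free_space B" if "x \<in> basis X" for x
      using that r by (cases x) (auto simp: in_B simp del: add_Suc add_Suc_right)
    show "lin_ext (basis X) inv_basis (f b) = bvec b" if "b \<in> B" for b
      using cases_B[OF that]
    proof (elim disjE exE conjE)
      fix n assume n: "n \<le> i" and b: "b = Inl n"
      have "lin_ext (basis X) inv_basis ((2 * a) *\<^sub>c Hv n + S n) = bvec (Inl n)"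
        using n a_nz by (simp add: lin_ext_simps lX) (simp add: fun_eq_iff field_simps)
      then show ?thesis unfolding b f_Inl[OF n] .
    next
      fix k assume k: "k \<le> N" and b: "b = Inl (Suc i + k)"
      have "lin_ext (basis X) inv_basis (a *\<^sub>c L k) = bvec (Inl (Suc i + k))"
        using k a_nz by (simp add: lin_ext_simps lX)
      then show ?thesis unfolding b f_Inl_L[OF k] .
    next
      fix n assume n: "n \<le> N" and b: "b = Inr n"
      have "lin_ext (basis X) inv_basis (top_coeff n *\<^sub>c R (N - n)) = bvec (Inr n)"
      proof -
        have "wR (N - n) \<in> basis X" "N - (N - n) = n" using n by simp_all
        then show ?thesis
          using top_coeff_nz[OF n] by (simp only: lin_ext_simps lX inv_basis.simps) simp
      qed
      then show ?thesis unfolding b f_Inr[OF n] .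
    next
      fix k assume k: "k \<le> i" and b: "b = Inr (Suc N + k)"
      have "lin_ext (basis X) inv_basis (top_coeff N *\<^sub>c (S k + a *\<^sub>c Hv k)) = bvec (Inr (Suc N + k))"
        using k a_nz tN by (simp add: lin_ext_simps lX del: add_Suc) (simp add: fun_eq_iff field_simps)
      then show ?thesis unfolding b f_Inr_HS[OF k] .
    qed
    show "lin_ext B f (inv_basis x) = bvec x" if x: "x \<in> basis X" for x
    proof (cases x)
      case (wL k)
      then have k: "k \<le> N" and kr: "Suc i + k < r" using x r by auto
      have "lin_ext B f (inv_basis (wL k)) = L k"
        using a_nz by (simp add: lin_ext_simps lB[OF kr] f_Inl_L[OF k] del: add_Suc)
      then show ?thesis unfolding wL .
    next
      case (wH k)
      then have k: "k \<le> i" and kr: "k < r" "Suc N + k < r" using x r by auto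
      have "lin_ext B f (inv_basis (wH k)) = Hv k"
        using a_nz tN
        by (simp add: lin_ext_simps lB(1)[OF kr(1)] lB(2)[OF kr(2)] f_Inl[OF k] f_Inr_HS[OF k] del: add_Suc)
          (simp add: fun_eq_iff field_simps)
      then show ?thesis unfolding wH .
    next
      case (wS k)
      then have k: "k \<le> i" and kr: "k < r" "Suc N + k < r" using x r by auto
      have "lin_ext B f (inv_basis (wS k)) = S k"
        using tN
        by (simp add: lin_ext_simps lB(1)[OF kr(1)] lB(2)[OF kr(2)] f_Inl[OF k] f_Inr_HS[OF k] del: add_Suc)
          (simp add: fun_eq_iff field_simps)
      then show ?thesis unfolding wS .
    next
      case (wR k)
      then have k: "N - k \<le> N" "N - (N - k) = k" and kr: "N - k < r" using x r by auto
      have "lin_ext B f (inv_basis (wR k)) = R k"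
        using top_coeff_nz[OF k(1)] by (simp only: inv_basis.simps lin_ext_simps lB(2)[OF kr] f_Inr[OF k(1)] k(2)) simp
      then show ?thesis unfolding wR .
    qed
  qed
  \<comment> \<open>The homomorphism was built out of the direct sum, where images of highest weight
    vectors determine everything; the isomorphism is now reversed.\<close>
  show ?thesis
  proof (rule mod_iso_sym)
    show "V_mod r ?\<alpha> \<oplus>\<^sub>m V_mod r ?\<beta> \<cong>\<^sub>m X"
      using hom bij unfolding mod_iso_def vspace_def B[symmetric] by blast
    have "actE (V_mod r ?\<alpha> \<oplus>\<^sub>m V_mod r ?\<beta>) b \<in> free_space B \<and>
        actF (V_mod r ?\<alpha> \<oplus>\<^sub>m V_mod r ?\<beta>) b \<in> free_space B \<and>
        actK (V_mod r ?\<alpha> \<oplus>\<^sub>m V_mod r ?\<beta>) b \<in> free_space B \<and>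
        actKi (V_mod r ?\<alpha> \<oplus>\<^sub>m V_mod r ?\<beta>) b \<in> free_space B \<and>
        actH (V_mod r ?\<alpha> \<oplus>\<^sub>m V_mod r ?\<beta>) b \<in> free_space B" if "b \<in> B" for b
      using that by (cases b) (auto simp: direct_sum_def V_mod_def sum_act_def in_B)
    then show "opE (V_mod r ?\<alpha> \<oplus>\<^sub>m V_mod r ?\<beta>) v \<in> vspace (V_mod r ?\<alpha> \<oplus>\<^sub>m V_mod r ?\<beta>) \<and>
        opF (V_mod r ?\<alpha> \<oplus>\<^sub>m V_mod r ?\<beta>) v \<in> vspace (V_mod r ?\<alpha> \<oplus>\<^sub>m V_mod r ?\<beta>) \<and>
        opK (V_mod r ?\<alpha> \<oplus>\<^sub>m V_mod r ?\<beta>) v \<in> vspace (V_mod r ?\<alpha> \<oplus>\<^sub>m V_mod r ?\<beta>) \<and>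
        opKi (V_mod r ?\<alpha> \<oplus>\<^sub>m V_mod r ?\<beta>) v \<in> vspace (V_mod r ?\<alpha> \<oplus>\<^sub>m V_mod r ?\<beta>) \<and>
        opH (V_mod r ?\<alpha> \<oplus>\<^sub>m V_mod r ?\<beta>) v \<in> vspace (V_mod r ?\<alpha> \<oplus>\<^sub>m V_mod r ?\<beta>)" for v
      unfolding op_defs vspace_def B[symmetric] by (intro conjI lin_ext_in) blast+
  qed
qed

end

end

section \<open>Maps out of X at parameter zero\<close>

lemma qnum_nat_nonzero:
  assumes "2 \<le> r" "0 < n" "n < 2 * r" "n \<noteq> r"
  shows "qnum r (of_nat n) \<noteq> 0"
proof (cases "n < r")
  case True
  then show ?thesis using qnum_int_nonzero[of r "int n"] assms by simp
next
  case False
  then have "of_nat n = (of_nat (n - r) + of_nat r :: complex)" by (simp flip: of_nat_add)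
  then have "qnum r (of_nat n) = - qnum r (of_nat (n - r))"
    using qnum_add_r[of r "of_nat (n - r)"] assms by simp
  then show ?thesis using qnum_int_nonzero[of r "int (n - r)"] assms False by simp
qed

text \<open>In [n][i + 1 + n] both arguments lie strictly between 0 and 2r. In that range only r
  gives zero, and i + 1 + n = r is the excluded value of n.\<close>

lemma kap_nonzero:
  assumes "2 \<le> r" "0 < n" "n < r" "i < r" "n \<noteq> r - 1 - i"
  shows "kap r (of_nat i) n \<noteq> 0"
proof -
  have "of_nat i + 1 + of_nat n = (of_nat (i + 1 + n) :: complex)" by simp
  moreover have "qnum r (of_nat (i + 1 + n)) \<noteq> 0"
    by (rule qnum_nat_nonzero) (use assms in auto)
  moreover have "qnum r (of_nat n) \<noteq> 0"
    by (rule qnum_nat_nonzero) (use assms in auto)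
  ultimately show ?thesis unfolding kap_def by (simp only: mult_eq_0_iff) simp
qed

lemma kap_zero:
  assumes "2 \<le> r" "i \<le> r - 2"
  shows "kap r (of_nat i) 0 = 0" "kap r (of_nat i) (r - 1 - i) = 0"
proof -
  have "of_nat i + 1 + of_nat (r - 1 - i) = (of_nat (i + 1 + (r - 1 - i)) :: complex)"
    by (simp del: of_nat_diff)
  also have "i + 1 + (r - 1 - i) = r" using assms by simp
  finally show "kap r (of_nat i) (r - 1 - i) = 0" using assms by (simp only: kap_def) simp
qed (simp add: kap_def)

context uqH
begin

text \<open>At l = 0 and \<epsilon> = 0 every basis vector of \<open>X\<close> is a word in
  \<open>E\<close> and \<open>F\<close> applied to \<open>wH 0\<close>, so these images are forced
  once \<open>wH 0\<close> is sent to y.\<close>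

fun X_map :: "nat \<Rightarrow> 'a vec \<Rightarrow> x_label \<Rightarrow> 'a vec" where
  "X_map i y (wL k) = (F ^^ (Suc i + k)) y"
| "X_map i y (wH k) = (F ^^ k) y"
| "X_map i y (wS k) = (F ^^ k) (F (E y))"
| "X_map i y (wR k) = (E ^^ Suc k) y"

text \<open>The three vanishing hypotheses say that y obeys the relations of \<open>wH 0\<close>
  where strings stop: \<open>E\<close> kills \<open>wS 0\<close>, \<open>E\<close> kills the top of
  R, and \<open>F\<close> kills \<open>wS i\<close>. The end of L is covered by F^r = 0, and the
  remaining coefficients follow from the commutation formulas.\<close>

lemma mod_hom_X_map:
  assumes i: "i \<le> r - 2" and y: "wt (of_nat i) y" and EFE: "E (F (E y)) = 0"
    and Ey: "(E ^^ (r - i)) y = 0" and Fs: "(F ^^ Suc i) (F (E y)) = 0"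
  shows "mod_hom (X_mod r i 0 0) M (lin_ext (basis (X_mod r i 0 0)) (X_map i y))"
proof -
  interpret x: X_setup r i 0 0 by unfold_locales (use r2 i in auto)
  let ?X = "X_mod r i 0 0" and ?f = "X_map i y"
  have a0: "x.a = 0" and sg1: "x.sg = 1" by (simp_all add: x.a_def x.sg_def)
  have g: "x.g (Suc k) = qnum r (of_nat k + 1) * qnum r (of_nat i - of_nat k)" for k
    by (simp add: x.g_def algebra_simps)
  have s: "wt (of_nat i) (F (E y))" by (rule wt_T[OF y])
  have f: "lin_ext (basis ?X) ?f (bvec b) = ?f b" if "b \<in> basis ?X" for b
    using that x.fin by simp
  have wtf: "wt (of_int (x_index i b)) (?f b)" for b
  proof (cases b)
    case (wL k)
    have "(of_nat i - 2 * of_nat (Suc i + k) :: complex) = of_int (x_index i b)" by (simp add: wL)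
    then show ?thesis using wt_Fn[OF y, of "Suc i + k"] by (simp only: wL X_map.simps)
  next
    case (wH k)
    have "(of_nat i - 2 * of_nat k :: complex) = of_int (x_index i b)" by (simp add: wH)
    then show ?thesis using wt_Fn[OF y, of k] by (simp only: wH X_map.simps)
  next
    case (wS k)
    have "(of_nat i - 2 * of_nat k :: complex) = of_int (x_index i b)" by (simp add: wS)
    then show ?thesis using wt_Fn[OF s, of k] by (simp only: wS X_map.simps)
  next
    case (wR k)
    have "(of_nat i + 2 * of_nat (Suc k) :: complex) = of_int (x_index i b)" by (simp add: wR)
    then show ?thesis using wt_En[OF y, of "Suc k"] by (simp only: wR X_map.simps)
  qed
  have acts: "actE ?X b = opE ?X (bvec b)" "actF ?X b = opF ?X (bvec b)" if "b \<in> basis ?X" for b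
    using that x.fin by (simp_all add: op_defs)
  note ff = f[OF x.basis_X(1)[THEN iffD2]] f[OF x.basis_X(2)[THEN iffD2]]
    f[OF x.basis_X(3)[THEN iffD2]] f[OF x.basis_X(4)[THEN iffD2]]
  have E_FSuc: "E ((F ^^ Suc k) y) = (F ^^ k) (F (E y)) + (qnum r (of_nat k + 1) * qnum r (of_nat i - of_nat k)) *\<^sub>c (F ^^ k) y" for k
    using E_Fn[OF y, of k] by (simp only: funpow_Suc_right comp_apply)
  have E_FSuc_s: "E ((F ^^ Suc k) (F (E y))) = (qnum r (of_nat k + 1) * qnum r (of_nat i - of_nat k)) *\<^sub>c (F ^^ k) (F (E y))" for k
    using E_Fn[OF s, of k] EFE by (simp add: funpow_op_simps op_simps del: funpow.simps)
  have main_E: "lin_ext (basis ?X) ?f (actE ?X b) = E (?f b)" if b: "b \<in> basis ?X" for b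
    unfolding acts[OF b]
  proof (cases b)
    case (wL k)
    show "lin_ext (basis ?X) ?f (opE ?X (bvec b)) = E (?f b)"
    proof (cases k)
      case 0
      have "E ((F ^^ Suc i) y) = (F ^^ i) (F (E y))" unfolding E_FSuc by simp
      then show ?thesis unfolding wL 0 x.E_L_0 a0 sg1
        by (simp add: lin_ext_simps ff del: funpow.simps)
    next
      case (Suc m)
      then have m: "Suc m \<le> r - 2 - i" "m \<le> r - 2 - i" using b wL by auto
      \<comment> \<open>Moving \<open>E\<close> to the right in E F^(i+2+m) y leaves this extra
        term, which vanishes because F^(i+1) already kills \<open>F (E y)\<close>.\<close>
      have "(F ^^ (Suc i + m)) (F (E y)) = (F ^^ m) ((F ^^ Suc i) (F (E y)))"
        by (simp only: funpow_add comp_apply add.commute[of "Suc i"])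
      then have "(F ^^ (Suc i + m)) (F (E y)) = 0" by (simp only: Fs funpow_op_simps)
      then have e: "E ((F ^^ (Suc i + Suc m)) y) =
        (qnum r (of_nat (Suc i + m) + 1) * qnum r (of_nat i - of_nat (Suc i + m))) *\<^sub>c (F ^^ (Suc i + m)) y"
        using E_FSuc[of "Suc i + m"] by (simp only: add_Suc_right add_0_left)
      have q: "qnum r (of_nat (Suc i + m) + 1) * qnum r (of_nat i - of_nat (Suc i + m))
        = - x.sg * (qnum r (2 + of_nat i + of_nat m) * qnum r (of_nat m + 1 - 0))"
      proof -
        have "qnum r (of_nat i - of_nat (Suc i + m)) = - qnum r (of_nat m + 1)"
          unfolding qnum_minus[symmetric] by (simp add: algebra_simps)
        moreover have "of_nat (Suc i + m) + 1 = (2 + of_nat i + of_nat m :: complex)" by simp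
        ultimately show ?thesis by (simp only: sg1) simp
      qed
      show ?thesis unfolding wL Suc x.E_L_Suc[OF m(1)] lin_ext_simps ff(1)[OF m(2)] X_map.simps e q ..
    qed
  next
    case (wH k)
    show "lin_ext (basis ?X) ?f (opE ?X (bvec b)) = E (?f b)"
    proof (cases k)
      case 0
      show ?thesis unfolding wH 0 x.E_H_0 sg1 by (simp add: lin_ext_simps ff)
    next
      case (Suc m)
      then have m: "Suc m \<le> i" "m \<le> i" using b wH by auto
      show ?thesis unfolding wH Suc x.E_H_Suc[OF m(1)] X_map.simps E_FSuc a0 sg1 g
        by (simp add: lin_ext_simps ff m(2) add.commute)
    qed
  next
    case (wS k)
    show "lin_ext (basis ?X) ?f (opE ?X (bvec b)) = E (?f b)"
    proof (cases k)
      case 0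
      show ?thesis unfolding wS 0 x.E_S_0 a0 by (simp add: lin_ext_simps EFE)
    next
      case (Suc m)
      then have m: "Suc m \<le> i" "m \<le> i" using b wS by auto
      show ?thesis unfolding wS Suc x.E_S_Suc[OF m(1)] X_map.simps E_FSuc_s a0 sg1 g
        by (simp add: lin_ext_simps ff m(2))
    qed
  next
    case (wR k)
    show "lin_ext (basis ?X) ?f (opE ?X (bvec b)) = E (?f b)"
    proof (cases "k = r - 2 - i")
      case True
      then have "Suc (Suc k) = r - i" using r2 i by simp
      then have "E (?f b) = 0" using Ey unfolding wR X_map.simps by (metis comp_apply funpow.simps(2))
      then show ?thesis unfolding wR True x.E_R(1) lin_ext_simps by simp
    next
      case False
      then have k: "k < r - 2 - i" "Suc k \<le> r - 2 - i" using b wR by auto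
      show ?thesis unfolding wR x.E_R(2)[OF k(1)] sg1 lin_ext_simps ff(4)[OF k(2)] X_map.simps by simp
    qed
  qed
  have main_F: "lin_ext (basis ?X) ?f (actF ?X b) = F (?f b)" if b: "b \<in> basis ?X" for b
    unfolding acts[OF b]
  proof (cases b)
    case (wL k)
    show "lin_ext (basis ?X) ?f (opF ?X (bvec b)) = F (?f b)"
    proof (cases "k = r - 2 - i")
      case True
      then have "Suc (Suc i + k) = r" using r2 i by simp
      then have "F (?f b) = 0" using relations(10)[OF wt_in[OF y]] unfolding wL X_map.simps
        by (metis comp_apply funpow.simps(2))
      then show ?thesis unfolding wL True x.F_L(1) lin_ext_simps by simp
    next
      case False
      then have k: "k < r - 2 - i" "Suc k \<le> r - 2 - i" using b wL by auto
      show ?thesis unfolding wL x.F_L(2)[OF k(1)] ff(1)[OF k(2)] X_map.simps by simp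
    qed
  next
    case (wH k)
    show "lin_ext (basis ?X) ?f (opF ?X (bvec b)) = F (?f b)"
    proof (cases "k = i")
      case True
      show ?thesis unfolding wH True x.F_H(1) ff(1)[OF le0] X_map.simps by simp
    next
      case False
      then have k: "k < i" "Suc k \<le> i" using b wH by auto
      show ?thesis unfolding wH x.F_H(2)[OF k(1)] ff(2)[OF k(2)] X_map.simps by simp
    qed
  next
    case (wS k)
    show "lin_ext (basis ?X) ?f (opF ?X (bvec b)) = F (?f b)"
    proof (cases "k = i")
      case True
      have "F ((F ^^ i) (F (E y))) = 0" using Fs by simp
      then show ?thesis unfolding wS True x.F_S(1) a0 X_map.simps by (simp add: lin_ext_simps)
    next
      case False
      then have k: "k < i" "Suc k \<le> i" using b wS by auto
      show ?thesis unfolding wS x.F_S(2)[OF k(1)] ff(3)[OF k(2)] X_map.simps by simp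
    qed
  next
    case (wR k)
    show "lin_ext (basis ?X) ?f (opF ?X (bvec b)) = F (?f b)"
    proof (cases k)
      case 0
      show ?thesis unfolding wR 0 x.F_R_0 a0 by (simp add: lin_ext_simps ff)
    next
      case (Suc m)
      then have m: "Suc m \<le> r - 2 - i" "m \<le> r - 2 - i" using b wR by auto
      \<comment> \<open>Since E F E y = 0, the vector E^(m+1) y is an eigenvector of
        \<open>T\<close>, with eigenvalue given by \<open>kap\<close>.\<close>
      have "(E ^^ Suc m) (F (E y)) = (E ^^ m) (E (F (E y)))" by (simp only: funpow_Suc_right comp_apply)
      then have z: "(E ^^ Suc m) (F (E y)) = 0" by (simp only: EFE funpow_op_simps)
      have "F ((E ^^ Suc (Suc m)) y) = T ((E ^^ Suc m) y)" by simp
      also have "\<dots> = (- kap r (of_nat i) (Suc m)) *\<^sub>c (E ^^ Suc m) y"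
        unfolding T_En[OF y] funpow_op_simps z by (simp add: fun_eq_iff)
      also have "- kap r (of_nat i) (Suc m) = - (qnum r (2 + of_nat i + of_nat m) * qnum r (of_nat m + 1 + 0))"
        by (simp add: kap_def algebra_simps)
      finally show ?thesis unfolding wR Suc x.F_R_Suc[OF m(1)] lin_ext_simps ff(4)[OF m(2)] X_map.simps
        by (rule sym)
    qed
  qed
  have KX: "actK ?X b = qpow r (of_int (x_index i b)) *\<^sub>c bvec b"
    "actKi ?X b = qpow r (- of_int (x_index i b)) *\<^sub>c bvec b"
    "actH ?X b = of_int (x_index i b) *\<^sub>c bvec b" if "b \<in> basis ?X" for b
    by (simp_all add: X_mod_def)
  have KM: "K (?f b) = qpow r (of_int (x_index i b)) *\<^sub>c ?f b"
    "Ki (?f b) = qpow r (- of_int (x_index i b)) *\<^sub>c ?f b"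
    "H (?f b) = of_int (x_index i b) *\<^sub>c ?f b" "?f b \<in> vspace M" for b
    using wtf[of b] by (simp_all only: weight_vec_def)
  show ?thesis
  proof (rule mod_hom_lin_ext[OF x.fin KM(4) main_E main_F])
    fix b assume b: "b \<in> basis ?X"
    show "lin_ext (basis ?X) ?f (actK ?X b) = K (?f b)"
      unfolding KX[OF b] KM lin_ext_simps f[OF b] ..
    show "lin_ext (basis ?X) ?f (actKi ?X b) = Ki (?f b)"
      unfolding KX[OF b] KM lin_ext_simps f[OF b] ..
    show "lin_ext (basis ?X) ?f (actH ?X b) = H (?f b)"
      unfolding KX[OF b] KM lin_ext_simps f[OF b] ..
  qed
qed

section \<open>Consequences of T^2 y = 0\<close>

text \<open>From F^i E^r y = 0 one gets E^(r-i) p(T) y = 0, where p has the roots \<kappa>_j for j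
  from r - i to r - 1. None of them is zero, so p(T) y = c y + d T y with c nonzero.\<close>

lemma E_power_zero:
  assumes i: "i \<le> r - 2" and y: "wt (of_nat i) y" and T2: "T (T y) = 0"
  shows "(E ^^ (r - i)) y = 0"
proof -
  have z: "0 \<notin> set (map (kap r (of_nat i)) [r - i..<i + (r - i)])"
    using kap_nonzero[OF r2] r2 i by fastforce
  have key: "(E ^^ (r - i)) (prod_op T (map (kap r (of_nat i)) [r - i..<i + (r - i)]) w) = 0"
    if w: "wt (of_nat i) w" for w
  proof -
    have "i + (r - i) = r" using i by simp
    then show ?thesis
      using Fn_En[OF w, of i "r - i"] relations(9)[OF wt_in[OF w]] by (simp add: funpow_op_simps)
  qed
  \<comment> \<open>The argument is run first on T y, where T^2 y = 0 removes the second term; this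
    then removes the term d T y for y itself.\<close>
  have s: "(E ^^ (r - i)) (T y) = 0"
  proof -
    have "T (T (T y)) = 0" by (simp add: T2 op_simps)
    from prod_op_kernel2[OF clin_T this z] obtain c d where c: "c \<noteq> 0"
      "prod_op T (map (kap r (of_nat i)) [r - i..<i + (r - i)]) (T y) = c *\<^sub>c T y + d *\<^sub>c T (T y)" by blast
    then have "c *\<^sub>c (E ^^ (r - i)) (T y) = 0"
      using key[OF wt_T[OF y]] unfolding c(2) T2 by (simp add: funpow_op_simps)
    then show ?thesis using c(1) by simp
  qed
  from prod_op_kernel2[OF clin_T T2 z] obtain c d where c: "c \<noteq> 0"
    "prod_op T (map (kap r (of_nat i)) [r - i..<i + (r - i)]) y = c *\<^sub>c y + d *\<^sub>c T y" by blast
  then have "c *\<^sub>c (E ^^ (r - i)) y = 0"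
    using key[OF y] unfolding c(2) by (simp add: funpow_op_simps s)
  then show ?thesis using c(1) by simp
qed

text \<open>Let s = T y. As \<kappa> vanishes at r - 1 - i, \<open>T\<close> commutes with that
  power of \<open>E\<close> on y, so E^(r-1-i) s = F E^(r-i) y = 0. Applying F^(r-2-i) turns this
  into E p(T) s = 0 with nonzero roots, and T s = 0 reduces p(T) s to a nonzero multiple of
  s.\<close>

lemma EFE_zero:
  assumes i: "i \<le> r - 2" and y: "wt (of_nat i) y" and T2: "T (T y) = 0"
  shows "E (F (E y)) = 0"
proof -
  have s: "wt (of_nat i) (F (E y))" by (rule wt_T[OF y])
  have m: "r - i = Suc (r - 1 - i)" "r - 1 - i = r - 2 - i + 1" using r2 i by auto
  have "(E ^^ (r - 1 - i)) (T y) = T ((E ^^ (r - 1 - i)) y)"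
    unfolding T_En[OF y] kap_zero(2)[OF r2 i] by (simp add: funpow_op_simps)
  also have "\<dots> = F ((E ^^ (r - i)) y)" unfolding m(1) by simp
  also have "\<dots> = 0" unfolding E_power_zero[OF assms] by (simp add: op_simps)
  finally have Es: "(E ^^ (r - 2 - i + 1)) (F (E y)) = 0" unfolding m(2) .
  have z: "0 \<notin> set (map (kap r (of_nat i)) [1..<r - 2 - i + 1])"
    using kap_nonzero[OF r2] r2 i by fastforce
  have "T (T (F (E y))) = 0" by (simp add: T2 op_simps)
  from prod_op_kernel2[OF clin_T this z] obtain c d where c: "c \<noteq> 0"
    "prod_op T (map (kap r (of_nat i)) [1..<r - 2 - i + 1]) (F (E y)) = c *\<^sub>c F (E y) + d *\<^sub>c T (F (E y))"
    by blast
  have "0 = (E ^^ 1) (prod_op T (map (kap r (of_nat i)) [1..<r - 2 - i + 1]) (F (E y)))"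
    unfolding Fn_En[OF s, symmetric] Es by (simp add: funpow_op_simps)
  also have "\<dots> = c *\<^sub>c E (F (E y))" unfolding c(2) T2 by (simp add: op_simps)
  finally show ?thesis using c(1) by (metis cvec.scale_eq_0_iff)
qed

text \<open>Let s = F E y, which \<open>E\<close> kills. Descending induction starts from F^(r-1) s
  = F^r E y = 0, and E F^(n+1) s = [n+1][i-n] F^n s with a nonzero coefficient for i < n < r -
  1.\<close>

lemma F_power_zero:
  assumes i: "i \<le> r - 2" and y: "wt (of_nat i) y" and T2: "T (T y) = 0"
  shows "(F ^^ Suc i) (F (E y)) = 0"
proof -
  have s: "wt (of_nat i) (F (E y))" by (rule wt_T[OF y])
  have "Suc i \<le> r - 1" using r2 i by simp
  then show ?thesis
  proof (induction rule: inc_induct)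
    case base
    have "(F ^^ (r - 1)) (F (E y)) = (F ^^ Suc (r - 1)) (E y)" by (simp only: funpow_Suc_right comp_apply)
    then show ?case using relations(10)[of "E y"] r2 by simp
  next
    case (step n)
    have IH: "(F ^^ Suc n) (F (E y)) = 0" by (rule step.IH)
    have "of_nat n + 1 = (of_nat (Suc n) :: complex)" "of_nat i - of_nat n = - (of_nat (n - i) :: complex)"
      using step.hyps by (simp_all add: of_nat_diff)
    then have nz: "qnum r (of_nat n + 1) * qnum r (of_nat i - of_nat n) \<noteq> 0"
      using qnum_nat_nonzero[OF r2, of "Suc n"] qnum_nat_nonzero[OF r2, of "n - i"] step.hyps
      by (simp only: qnum_minus mult_eq_0_iff neg_equal_0_iff_equal) auto
    have "0 = (qnum r (of_nat n + 1) * qnum r (of_nat i - of_nat n)) *\<^sub>c (F ^^ n) (F (E y))"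
      using E_Fn[OF s, of n] EFE_zero[OF assms] by (simp only: IH op_simps funpow_op_simps add_0_left)
    then show "(F ^^ n) (F (E y)) = 0" using nz by (metis cvec.scale_eq_0_iff)
  qed
qed

end

section \<open>Lifting weight vectors\<close>

lemma mod_homD:
  assumes "mod_hom M N f" "v \<in> vspace M"
  shows "f v \<in> vspace N" "w \<in> vspace M \<Longrightarrow> f (v + w) = f v + f w" "f (c *\<^sub>c v) = c *\<^sub>c f v"
    "f (opE M v) = opE N (f v)" "f (opF M v) = opF N (f v)" "f (opK M v) = opK N (f v)"
    "f (opKi M v) = opKi N (f v)" "f (opH M v) = opH N (f v)"
  using assms by (auto simp: mod_hom_def)

lemma vspace_closed [simp]:
  "0 \<in> vspace M" "v \<in> vspace M \<Longrightarrow> w \<in> vspace M \<Longrightarrow> v + w \<in> vspace M"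
  "v \<in> vspace M \<Longrightarrow> w \<in> vspace M \<Longrightarrow> v - w \<in> vspace M" "v \<in> vspace M \<Longrightarrow> c *\<^sub>c v \<in> vspace M"
  "v \<in> vspace M \<Longrightarrow> - v \<in> vspace M"
  by (simp_all add: vspace_def)

lemma mod_hom_zero: assumes "mod_hom M N f" shows "f 0 = 0"
  using mod_homD(3)[OF assms, of 0 0] by simp

lemma mod_hom_diff:
  assumes "mod_hom M N f" "v \<in> vspace M" "w \<in> vspace M"
  shows "f (v - w) = f v - f w"
proof -
  have "v - w = v + (-1) *\<^sub>c w" "f v - f w = f v + (-1) *\<^sub>c f w" by (simp_all add: fun_eq_iff)
  then show ?thesis
    using mod_homD(2)[OF assms(1,2), of "(-1) *\<^sub>c w"] mod_homD(3)[OF assms(1,3), of "-1"] assms(3) by simp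
qed

lemma mod_hom_comp:
  assumes f: "mod_hom M N f" and g: "mod_hom N P g"
  shows "mod_hom M P (\<lambda>v. g (f v))"
  unfolding mod_hom_def
  by (intro conjI ballI allI)
    (simp_all add: mod_homD[OF f] mod_homD[OF g])

text \<open>A \<open>mod_hom\<close> is linear only on \<open>vspace M\<close>. Replacing it by a
  linear extension makes comparison on basis vectors available.\<close>

lemma mod_hom_eq_on:
  assumes "mod_hom M N f" "finite (basis M)" "v \<in> vspace M"
  shows "f v = lin_ext (basis M) (\<lambda>b. f (bvec b)) v"
proof -
  have "f (\<Sum>b\<in>A. v b *\<^sub>c bvec b) = (\<Sum>b\<in>A. v b *\<^sub>c f (bvec b)) \<and> (\<Sum>b\<in>A. v b *\<^sub>c bvec b) \<in> vspace M"
    if "A \<subseteq> basis M" for A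
    using finite_subset[OF that assms(2)] that
  proof (induction rule: finite_induct)
    case empty
    show ?case unfolding sum.empty by (rule conjI[OF mod_hom_zero[OF assms(1)] vspace_closed(1)])
  next
    case (insert x A)
    from insert.prems have x: "bvec x \<in> vspace M" and "A \<subseteq> basis M" by (simp_all add: vspace_def)
    from insert.IH[OF this(2)]
    have A: "f (\<Sum>b\<in>A. v b *\<^sub>c bvec b) = (\<Sum>b\<in>A. v b *\<^sub>c f (bvec b))" "(\<Sum>b\<in>A. v b *\<^sub>c bvec b) \<in> vspace M"
      by blast+
    have "f (v x *\<^sub>c bvec x + (\<Sum>b\<in>A. v b *\<^sub>c bvec b)) = v x *\<^sub>c f (bvec x) + (\<Sum>b\<in>A. v b *\<^sub>c f (bvec b))"
      unfolding mod_homD(2)[OF assms(1) vspace_closed(4)[OF x] A(2)] mod_homD(3)[OF assms(1) x] A(1) ..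
    moreover have "v x *\<^sub>c bvec x + (\<Sum>b\<in>A. v b *\<^sub>c bvec b) \<in> vspace M"
      by (intro vspace_closed x A)
    ultimately show ?case unfolding sum.insert[OF insert.hyps] by (rule conjI)
  qed
  from this[OF order_refl] show ?thesis
    using free_space_expand[OF assms(2), of v] assms(3) by (simp only: lin_ext_def vspace_def)
qed

lemma submod_image:
  assumes r: "2 \<le> r" and M: "uqH_module r M" and f: "mod_hom M N f"
  shows "submod N (f ` vspace M)"
proof -
  interpret uqH r M by unfold_locales (rule r, rule M)
  have "cvec.subspace (f ` vspace M)"
    unfolding cvec.subspace_def
  proof (intro conjI ballI allI)
    show "0 \<in> f ` vspace M" using mod_hom_zero[OF f] by (metis image_eqI vspace_closed(1))
    show "x + y \<in> f ` vspace M" if xy: "x \<in> f ` vspace M" "y \<in> f ` vspace M" for x y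
    proof -
      obtain v w where "x = f v" "y = f w" "v \<in> vspace M" "w \<in> vspace M" using xy by blast
      then show ?thesis using mod_homD(2)[OF f] by (metis image_eqI vspace_closed(2))
    qed
    show "c *\<^sub>c x \<in> f ` vspace M" if x: "x \<in> f ` vspace M" for c x
    proof -
      obtain v where "x = f v" "v \<in> vspace M" using x by blast
      then show ?thesis using mod_homD(3)[OF f] by (metis image_eqI vspace_closed(4))
    qed
  qed
  moreover have "opE N v \<in> f ` vspace M \<and> opF N v \<in> f ` vspace M \<and> opK N v \<in> f ` vspace M
     \<and> opKi N v \<in> f ` vspace M \<and> opH N v \<in> f ` vspace M" if v: "v \<in> f ` vspace M" for v
  proof -
    obtain w where w: "v = f w" "w \<in> vspace M" using v by blast
    show ?thesis unfolding w(1) mod_homD(4-)[OF f w(2), symmetric] by (intro conjI imageI closed)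
  qed
  moreover have "f ` vspace M \<subseteq> vspace N" using mod_homD(1)[OF f] by blast
  ultimately show ?thesis unfolding submod_def by blast
qed

lemma simple_mod_surj:
  assumes "2 \<le> r" "uqH_module r M" "mod_hom M S f" "simple_mod S" "v \<in> vspace M" "f v \<noteq> 0"
  shows "f ` vspace M = vspace S"
  using submod_image[OF assms(1-3)] assms(4-6) unfolding simple_mod_def by blast

section \<open>Transport of structure and the lifting property\<close>

text \<open>Every vector of \<open>N\<close> has the form f v, so each relation in \<open>N\<close>
  is the image under f of the same relation in \<open>M\<close>.\<close>

lemma transport_module:
  assumes r: "2 \<le> r" and M: "uqH_module r M" and f: "mod_hom M N f" and bij: "bij_betw f (vspace M) (vspace N)"
    and finN: "finite (basis N)"
    and acts: "\<And>b. b \<in> basis N \<Longrightarrow> actE N b \<in> vspace N \<and> actF N b \<in> vspace N \<and> actK N b \<in> vspace N \<and>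
        actKi N b \<in> vspace N \<and> actH N b \<in> vspace N"
  shows "uqH_module r N"
proof -
  interpret uqH r M by unfold_locales (rule r, rule M)
  note h = mod_homD(4-)[OF f, symmetric]
  have d: "f v - f w = f (v - w)" if "v \<in> vspace M" "w \<in> vspace M" for v w
    using mod_hom_diff[OF f that] by simp
  have s: "c *\<^sub>c f v = f (c *\<^sub>c v)" if "v \<in> vspace M" for c v
    using mod_homD(3)[OF f that] by simp
  have pw: "(opE N ^^ n) (f v) = f ((E ^^ n) v)" "(opF N ^^ n) (f v) = f ((F ^^ n) v)" if "v \<in> vspace M" for n v
  proof -
    show "(opE N ^^ n) (f v) = f ((E ^^ n) v)"
    proof (induction n)
      case (Suc n)
      have "(opE N ^^ n) (f v) = f ((E ^^ n) v)" by (rule Suc.IH)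
      then have "(opE N ^^ Suc n) (f v) = f ((E ^^ Suc n) v)" using that by (simp add: h)
      then show ?case .
    qed simp
    show "(opF N ^^ n) (f v) = f ((F ^^ n) v)"
    proof (induction n)
      case (Suc n)
      have "(opF N ^^ n) (f v) = f ((F ^^ n) v)" by (rule Suc.IH)
      then have "(opF N ^^ Suc n) (f v) = f ((F ^^ Suc n) v)" using that by (simp add: h)
      then show ?case .
    qed simp
  qed
  show ?thesis unfolding uqH_module_def
  proof (intro conjI ballI finN)
    fix w assume "w \<in> vspace N"
    then obtain v where w: "w = f v" and v: "v \<in> vspace M" using bij by (auto simp: bij_betw_def)
    show "opK N (opKi N w) = w" "opKi N (opK N w) = w"
      unfolding w by (simp_all only: h v closed relations[OF v])
    show "opK N (opE N w) = qpow r 2 *\<^sub>c opE N (opK N w)"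
      unfolding w by (simp_all only: h s v closed relations[OF v])
    show "opK N (opF N w) = qpow r (-2) *\<^sub>c opF N (opK N w)"
      unfolding w by (simp_all only: h s v closed relations[OF v])
    show "opH N (opK N w) = opK N (opH N w)"
      unfolding w by (simp_all only: h v closed relations[OF v])
    show "opH N (opE N w) - opE N (opH N w) = 2 *\<^sub>c opE N w"
      unfolding w by (simp_all only: h d s v closed relations[OF v])
    show "opH N (opF N w) - opF N (opH N w) = (-2) *\<^sub>c opF N w"
      unfolding w by (simp_all only: h d s v closed relations[OF v])
    show "opE N (opF N w) - opF N (opE N w) = (1 / (qpow r 1 - qpow r (-1))) *\<^sub>c (opK N w - opKi N w)"
      unfolding w by (simp_all only: h d s v closed vspace_closed relations[OF v])
    show "(opE N ^^ r) w = 0" "(opF N ^^ r) w = 0"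
      unfolding w by (simp_all only: pw v relations[OF v] mod_hom_zero[OF f])
  qed (use finN acts in auto)
qed

lemma transport_weight_module:
  assumes r: "2 \<le> r" and M: "weight_module r M" and f: "mod_hom M N f" and bij: "bij_betw f (vspace M) (vspace N)"
    and finN: "finite (basis N)"
    and acts: "\<And>b. b \<in> basis N \<Longrightarrow> actE N b \<in> vspace N \<and> actF N b \<in> vspace N \<and> actK N b \<in> vspace N \<and>
        actKi N b \<in> vspace N \<and> actH N b \<in> vspace N"
  shows "weight_module r N"
proof -
  have M': "uqH_module r M" "vspace M = cvec.span {v \<in> vspace M. \<exists>\<mu>. opH M v = \<mu> *\<^sub>c v}"
    "\<And>v \<mu>. v \<in> vspace M \<Longrightarrow> opH M v = \<mu> *\<^sub>c v \<Longrightarrow> opK M v = qpow r \<mu> *\<^sub>c v"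
    using M unfolding weight_module_def by blast+
  interpret uqH r M by unfold_locales (rule r, rule M')
  let ?S = "{v \<in> vspace M. \<exists>\<mu>. opH M v = \<mu> *\<^sub>c v}" and ?T = "{v \<in> vspace N. \<exists>\<mu>. opH N v = \<mu> *\<^sub>c v}"
  have span: "v \<in> vspace M \<and> f v \<in> cvec.span ?T" if "v \<in> cvec.span ?S" for v
    using that
  proof (induction rule: cvec.span_induct_alt)
    case base
    have "0 \<in> vspace M \<and> f 0 \<in> cvec.span ?T" unfolding mod_hom_zero[OF f] by (simp add: cvec.span_zero)
    then show ?case .
  next
    case (step c x y)
    then obtain \<mu> where x: "x \<in> vspace M" "opH M x = \<mu> *\<^sub>c x" by blast
    have "opH N (f x) = \<mu> *\<^sub>c f x" using mod_homD(8,3)[OF f x(1)] x(2) by metis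
    then have "f x \<in> ?T" using mod_homD(1)[OF f x(1)] by blast
    from step(2) have y: "y \<in> vspace M" "f y \<in> cvec.span ?T" by blast+
    have "c *\<^sub>c f x + f y \<in> cvec.span ?T"
      by (rule cvec.span_add[OF cvec.span_scale[OF cvec.span_base[OF \<open>f x \<in> ?T\<close>]] y(2)])
    moreover have "f (c *\<^sub>c x + y) = c *\<^sub>c f x + f y"
      unfolding mod_homD(2)[OF f vspace_closed(4)[OF x(1)] y(1)] mod_homD(3)[OF f x(1)] ..
    moreover have "c *\<^sub>c x + y \<in> vspace M" by (intro vspace_closed x y)
    ultimately have "c *\<^sub>c x + y \<in> vspace M \<and> f (c *\<^sub>c x + y) \<in> cvec.span ?T" by (simp only: simp_thms)
    then show ?case .
  qed
  show ?thesis unfolding weight_module_def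
  proof (intro conjI ballI allI impI)
    show "uqH_module r N" by (rule transport_module[OF r M'(1) f bij finN acts])
    show "vspace N = cvec.span ?T"
    proof
      show "vspace N \<subseteq> cvec.span ?T"
      proof
        fix w assume "w \<in> vspace N"
        then obtain v where w: "w = f v" and v: "v \<in> vspace M" using bij by (auto simp: bij_betw_def)
        have "v \<in> cvec.span ?S" using v M'(2) by (rule subst[rotated])
        then show "w \<in> cvec.span ?T" unfolding w using span by blast
      qed
      show "cvec.span ?T \<subseteq> vspace N"
        by (rule cvec.span_minimal) (auto simp: vspace_def subspace_free_space)
    qed
  next
    fix w \<mu> assume "w \<in> vspace N" and H: "opH N w = \<mu> *\<^sub>c w"
    then obtain v where w: "w = f v" and v: "v \<in> vspace M" using bij by (auto simp: bij_betw_def)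
    have "f (opH M v) = f (\<mu> *\<^sub>c v)" using H mod_homD(8,3)[OF f v] unfolding w by metis
    then have "opH M v = \<mu> *\<^sub>c v"
      using bij v by (meson bij_betw_def inj_onD closed(5) vspace_closed(4))
    from M'(3)[OF v this] show "opK N w = qpow r \<mu> *\<^sub>c w"
      unfolding w using mod_homD(6,3)[OF f v] by metis
  qed
qed

text \<open>The same module with its basis relabelled along an injection into the natural numbers.
  Projectivity is tested on modules of that type, whereas \<open>X\<close> is labelled by
  \<open>x_label\<close>.\<close>

definition nat_copy :: "('a \<Rightarrow> nat) \<Rightarrow> 'a qmod \<Rightarrow> nat qmod" where
  "nat_copy e M = (let act = \<lambda>A n. lin_ext (basis M) (\<lambda>b. bvec (e b)) (A (inv_into (basis M) e n)) in
     \<lparr> basis = e ` basis M, actE = act (actE M), actF = act (actF M), actK = act (actK M),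
       actKi = act (actKi M), actH = act (actH M) \<rparr>)"

lemma nat_copy_iso:
  assumes r: "2 \<le> r" and M: "weight_module r M"
  shows "\<exists>M' :: nat qmod. weight_module r M' \<and> M \<cong>\<^sub>m M'"
proof -
  have M': "uqH_module r M" using M by (simp add: weight_module_def)
  interpret uqH r M by unfold_locales (rule r, rule M')
  obtain e :: "'a \<Rightarrow> nat" where e: "inj_on e (basis M)"
    using finite_imp_inj_to_nat_seg[OF fin] by blast
  let ?N = "nat_copy e M" and ?f = "\<lambda>b. bvec (e b)" and ?g = "\<lambda>n. bvec (inv_into (basis M) e n)"
  have B: "basis ?N = e ` basis M" by (simp add: nat_copy_def Let_def)
  have fN: "finite (basis ?N)" unfolding B using fin by simp
  have acts: "actE ?N (e b) = lin_ext (basis M) ?f (actE M b)" "actF ?N (e b) = lin_ext (basis M) ?f (actF M b)"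
    "actK ?N (e b) = lin_ext (basis M) ?f (actK M b)" "actKi ?N (e b) = lin_ext (basis M) ?f (actKi M b)"
    "actH ?N (e b) = lin_ext (basis M) ?f (actH M b)" if "b \<in> basis M" for b
    using inv_into_f_f[OF e that] by (simp_all add: nat_copy_def Let_def)
  have in_N: "lin_ext (basis M) ?f v \<in> vspace ?N" for v
    unfolding vspace_def by (rule lin_ext_in) (auto simp: B)
  have hom: "mod_hom M ?N (lin_ext (basis M) ?f)"
  proof (rule mod_hom_lin_ext[OF fin])
    fix b assume b: "b \<in> basis M"
    then have "e b \<in> basis ?N" by (simp add: B)
    then show "?f b \<in> vspace ?N" "lin_ext (basis M) ?f (actE M b) = opE ?N (?f b)"
      "lin_ext (basis M) ?f (actF M b) = opF ?N (?f b)" "lin_ext (basis M) ?f (actK M b) = opK ?N (?f b)"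
      "lin_ext (basis M) ?f (actKi M b) = opKi ?N (?f b)" "lin_ext (basis M) ?f (actH M b) = opH ?N (?f b)"
      unfolding op_defs lin_ext_bvec[OF fN \<open>e b \<in> basis ?N\<close>] acts[OF b] by (simp_all add: vspace_def)
  qed
  have bij: "bij_betw (lin_ext (basis M) ?f) (vspace M) (vspace ?N)"
    unfolding vspace_def
    by (rule bij_betw_lin_ext[where g = ?g])
      (use e in \<open>auto simp: B fin inv_into_f_f inv_into_into\<close>)
  have "weight_module r ?N"
  proof (rule transport_weight_module[OF r M hom bij fN])
    fix n assume "n \<in> basis ?N"
    then obtain b where "n = e b" "b \<in> basis M" unfolding B by blast
    then show "actE ?N n \<in> vspace ?N \<and> actF ?N n \<in> vspace ?N \<and> actK ?N n \<in> vspace ?N \<and>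
        actKi ?N n \<in> vspace ?N \<and> actH ?N n \<in> vspace ?N"
      using in_N by (simp add: acts)
  qed
  with hom bij show ?thesis unfolding mod_iso_def by blast
qed

text \<open>The surjection is conjugated to one between copies labelled by natural numbers, where
  projectivity applies. The lift is carried back, and injectivity of \<open>N\<close> into its copy
  restores the equation.\<close>

lemma projective_lift:
  assumes r: "2 \<le> r" and P: "projective_in_C r P" and M: "weight_module r M" and N: "weight_module r N"
    and g: "mod_hom M N g" "g ` vspace M = vspace N" and f: "mod_hom P N f"
  shows "\<exists>h. mod_hom P M h \<and> (\<forall>v\<in>vspace P. g (h v) = f v)"
proof -
  have uq: "uqH_module r M" "uqH_module r N" using M N by (simp_all add: weight_module_def)
  interpret m: uqH r M by unfold_locales (rule r, rule uq)
  obtain M' :: "nat qmod" where M': "weight_module r M'" "M \<cong>\<^sub>m M'" using nat_copy_iso[OF r M] by blast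
  obtain N' :: "nat qmod" where N': "weight_module r N'" "N \<cong>\<^sub>m N'" using nat_copy_iso[OF r N] by blast
  have "M' \<cong>\<^sub>m M" by (rule mod_iso_sym[OF M'(2)]) simp
  then obtain m where m: "mod_hom M' M m" "bij_betw m (vspace M') (vspace M)" by (auto simp: mod_iso_def)
  obtain n where n: "mod_hom N N' n" "bij_betw n (vspace N) (vspace N')" using N'(2) by (auto simp: mod_iso_def)
  have hom: "mod_hom M' N' (\<lambda>v. n (g (m v)))" "mod_hom P N' (\<lambda>v. n (f v))"
    by (intro mod_hom_comp[OF mod_hom_comp[OF m(1) g(1)] n(1)] mod_hom_comp[OF f n(1)])+
  have "(\<lambda>v. n (g (m v))) ` vspace M' = n ` (g ` (m ` vspace M'))" by (simp add: image_image)
  also have "\<dots> = vspace N'" using m(2) n(2) g(2) by (simp add: bij_betw_def)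
  finally have surj: "(\<lambda>v. n (g (m v))) ` vspace M' = vspace N'" .
  have lift: "\<exists>h. mod_hom P A h \<and> (\<forall>v\<in>vspace P. a (h v) = b v)"
    if "weight_module r A" "weight_module r B" "mod_hom A B a" "a ` vspace A = vspace B" "mod_hom P B b"
    for A B :: "nat qmod" and a b
    using P that unfolding projective_in_C_def by blast
  from lift[OF M'(1) N'(1) hom(1) surj hom(2)]
  obtain h where h: "mod_hom P M' h" "\<And>v. v \<in> vspace P \<Longrightarrow> n (g (m (h v))) = n (f v)" by blast
  have "g (m (h v)) = f v" if v: "v \<in> vspace P" for v
    using h(2)[OF v] n(2) mod_homD(1)[OF f v] mod_homD(1)[OF g(1) mod_homD(1)[OF m(1) mod_homD(1)[OF h(1) v]]]
    by (meson bij_betw_def inj_onD)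
  then show ?thesis using mod_hom_comp[OF h(1) m(1)] by blast
qed

text \<open>A polynomial in \<open>A\<close> with roots \<open>ms\<close> multiplies the image w by
  the product of the numbers \<nu> - m, which is nonzero. A lift of w can thus be corrected by such
  a polynomial without losing its image.\<close>

lemma prod_op_lift:
  assumes f: "mod_hom M N f"
    and A: "\<And>v. v \<in> vspace M \<Longrightarrow> A v \<in> vspace M \<and> f (A v) = B (f v)"
    and B: "\<And>c. B (c *\<^sub>c w) = (c * \<nu>) *\<^sub>c w" and ms: "\<nu> \<notin> set ms"
    and x: "x \<in> vspace M" "f x = w"
  shows "prod_op A ms x \<in> vspace M \<and> (\<exists>c. c \<noteq> 0 \<and> f (prod_op A ms x) = c *\<^sub>c w)"
  using ms
proof (induction ms)
  case Nil
  have "f (prod_op A [] x) = 1 *\<^sub>c w" using x by simp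
  then show ?case using x(1) by (metis prod_op_simps(1) zero_neq_one)
next
  case (Cons m ms)
  then have "\<nu> \<notin> set ms" "\<nu> - m \<noteq> 0" by auto
  from Cons.IH[OF this(1)] obtain c where IH: "prod_op A ms x \<in> vspace M" "c \<noteq> 0" "f (prod_op A ms x) = c *\<^sub>c w"
    by blast
  have "f (prod_op A (m # ms) x) = B (c *\<^sub>c w) - m *\<^sub>c (c *\<^sub>c w)"
    using mod_hom_diff[OF f, of "A (prod_op A ms x)" "m *\<^sub>c prod_op A ms x"] A[OF IH(1)] IH(1)
      mod_homD(3)[OF f IH(1), of m] by (simp only: prod_op_simps IH(3) vspace_closed)
  also have "\<dots> = (c * (\<nu> - m)) *\<^sub>c w" unfolding B by (simp add: fun_eq_iff algebra_simps)
  finally have "f (prod_op A (m # ms) x) = (c * (\<nu> - m)) *\<^sub>c w" .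
  moreover have "prod_op A (m # ms) x \<in> vspace M"
    unfolding prod_op_simps using A[OF IH(1)] IH(1) by (intro vspace_closed) auto
  moreover have "c * (\<nu> - m) \<noteq> 0" using IH(2) \<open>\<nu> - m \<noteq> 0\<close> by simp
  ultimately show ?case by blast
qed

text \<open>Any lift is a sum of \<open>H\<close>-eigenvectors. A polynomial in \<open>H\<close>
  having all their eigenvalues except \<nu> as roots projects the lift to weight \<nu>, and its
  image is only rescaled.\<close>

lemma weight_lift:
  assumes r: "2 \<le> r" and M: "weight_module r M" and f: "mod_hom M N f"
    and w: "opH N w = \<nu> *\<^sub>c w" and x: "x \<in> vspace M" "f x = w"
  shows "\<exists>y. weight_vec r M \<nu> y \<and> f y = w"
proof -
  have M': "uqH_module r M" "vspace M = cvec.span {v \<in> vspace M. \<exists>\<mu>. opH M v = \<mu> *\<^sub>c v}"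
    "\<And>v \<mu>. v \<in> vspace M \<Longrightarrow> opH M v = \<mu> *\<^sub>c v \<Longrightarrow> opK M v = qpow r \<mu> *\<^sub>c v"
    using M unfolding weight_module_def by blast+
  interpret uqH r M by unfold_locales (rule r, rule M')
  \<comment> \<open>\<open>Q z\<close>: some polynomial in \<open>H\<close> without the root \<nu>
    carries z into the \<nu>-eigenspace. Adding an eigenvector of another eigenvalue to z costs one
    more root.\<close>
  define Q where "Q z \<longleftrightarrow> (\<exists>ms. \<nu> \<notin> set ms \<and> H (prod_op H ms z) = \<nu> *\<^sub>c prod_op H ms z)" for z
  note cH = clin_op(5)[of M] and cP = clin_prod_op[OF clin_op(5)[of M]]
  have eig: "H (prod_op H ms z) = \<nu> *\<^sub>c prod_op H ms z" if "H z = \<nu> *\<^sub>c z" for ms z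
    using prod_op_commute[OF cH, of ms z] module_hom.scale[OF cP, of ms \<nu> z] that by (simp only:)
  have "x \<in> cvec.span {v \<in> vspace M. \<exists>\<mu>. H v = \<mu> *\<^sub>c v}" using x(1) M'(2) by blast
  then have "Q x"
  proof (induction rule: cvec.span_induct_alt)
    case base
    have "H (prod_op H [] 0) = \<nu> *\<^sub>c prod_op H [] 0" by (simp add: op_simps)
    moreover have "\<nu> \<notin> set []" by simp
    ultimately show ?case unfolding Q_def by blast
  next
    case (step c z z')
    then obtain \<mu> where z: "H z = \<mu> *\<^sub>c z" by blast
    from step obtain ms where ms: "\<nu> \<notin> set ms" "H (prod_op H ms z') = \<nu> *\<^sub>c prod_op H ms z'"
      unfolding Q_def by blast
    show ?case
    proof (cases "\<mu> = \<nu>")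
      case True
      have "H (prod_op H ms (c *\<^sub>c z + z')) = \<nu> *\<^sub>c prod_op H ms (c *\<^sub>c z + z')"
        using eig[OF z[unfolded True], of ms] ms(2)
        by (simp only: module_hom.add[OF cP] module_hom.scale[OF cP] op_simps)
          (simp add: fun_eq_iff algebra_simps)
      then show ?thesis using ms(1) unfolding Q_def by blast
    next
      case False
      have "prod_op H (ms @ [\<mu>]) z = prod_op H ms (H z - \<mu> *\<^sub>c z)" by simp
      also have "H z - \<mu> *\<^sub>c z = 0" unfolding z by simp
      finally have 0: "prod_op H (ms @ [\<mu>]) z = 0" by (simp only: module_hom.zero[OF cP])
      have 1: "prod_op H (ms @ [\<mu>]) z' = prod_op H [\<mu>] (prod_op H ms z')"
        unfolding prod_op_simps(3) by (rule prod_op_swap[OF cH])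
      have "H (prod_op H (ms @ [\<mu>]) (c *\<^sub>c z + z')) = \<nu> *\<^sub>c prod_op H (ms @ [\<mu>]) (c *\<^sub>c z + z')"
        unfolding module_hom.add[OF cP] module_hom.scale[OF cP] 0 1
        using eig[OF ms(2), of "[\<mu>]"] by (simp only: cvec.scale_zero_right add_0_left)
      moreover have "\<nu> \<notin> set (ms @ [\<mu>])" using ms(1) False by simp
      ultimately show ?thesis unfolding Q_def by blast
    qed
  qed
  then obtain ms where ms: "\<nu> \<notin> set ms" "H (prod_op H ms x) = \<nu> *\<^sub>c prod_op H ms x"
    unfolding Q_def by blast
  have "H v \<in> vspace M \<and> f (H v) = opH N (f v)" if "v \<in> vspace M" for v
    using mod_homD(8)[OF f that] by simp
  moreover have "opH N (c *\<^sub>c w) = (c * \<nu>) *\<^sub>c w" for c using w by (simp add: op_simps)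
  ultimately obtain c where c: "prod_op H ms x \<in> vspace M" "c \<noteq> 0" "f (prod_op H ms x) = c *\<^sub>c w"
    using prod_op_lift[OF f _ _ ms(1) x, of H "opH N"] by blast
  have "wt \<nu> (prod_op H ms x)" by (rule wtI[OF c(1) ms(2) M'(3)[OF c(1) ms(2)]])
  then have "wt \<nu> ((1 / c) *\<^sub>c prod_op H ms x)" by (rule wt_scale)
  moreover have "f ((1 / c) *\<^sub>c prod_op H ms x) = w"
    using mod_homD(3)[OF f c(1), of "1 / c"] c(2,3) by simp
  ultimately show ?thesis by blast
qed

text \<open>Of the factors T - \<kappa>_j of F^r E^r exactly two are \<open>T\<close> itself.
  Applying the others to y gives a vector killed by T^2. Since \<open>E\<close> kills w, the image
  is multiplied by the value of that polynomial at 0, which is nonzero.\<close>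

lemma T_nilpotent_lift:
  assumes r: "2 \<le> r" and i: "i \<le> r - 2" and M: "uqH_module r M" and f: "mod_hom M N f"
    and w: "opE N w = 0" and y: "weight_vec r M (of_nat i) y" "f y = w"
  shows "\<exists>y'. weight_vec r M (of_nat i) y' \<and> f y' = w \<and> opF M (opE M (opF M (opE M y'))) = 0"
proof -
  interpret uqH r M by unfold_locales (rule r, rule M)
  let ?m = "r - 1 - i" and ?k = "kap r (of_nat i)"
  define ms where "ms = map ?k [1..<?m] @ map ?k [Suc ?m..<r]"
  \<comment> \<open>The range of indices is cut at the two zeros of \<kappa>, namely 0 and r - 1 -
    i; \<open>ms\<close> collects the other values.\<close>
  have upt: "[0..<r] = 0 # [1..<?m] @ ?m # [Suc ?m..<r]"
  proof -
    have "[0..<r] = [0..<?m] @ [?m..<r]" using upt_add_eq_append[of 0 ?m "r - ?m"] by simp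
    then show ?thesis using r i by (simp add: upt_conv_Cons)
  qed
  have "0 = (F ^^ r) ((E ^^ (r + 0)) y)" using relations(9)[OF wt_in[OF y(1)]] by (simp add: funpow_op_simps)
  also have "\<dots> = prod_op T (map ?k [0..<r]) y" unfolding Fn_En[OF y(1)] by simp
  also have "\<dots> = T (prod_op T (map ?k [1..<?m]) (T (prod_op T (map ?k [Suc ?m..<r]) y)))"
  proof -
    have z: "v - 0 *\<^sub>c u = v" for u v :: "'a vec" by (simp add: fun_eq_iff)
    show ?thesis unfolding upt by (simp only: list.map map_append prod_op_simps kap_zero[OF r i] z)
  qed
  also have "\<dots> = T (T (prod_op T ms y))"
    unfolding ms_def prod_op_simps(3) prod_op_commute[OF clin_T] ..
  finally have T2: "T (T (prod_op T ms y)) = 0" by (rule sym)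
  have ms0: "0 \<notin> set ms" using kap_nonzero[OF r] r i by (fastforce simp: ms_def)
  have "T v \<in> vspace M \<and> f (T v) = opF N (opE N (f v))" if "v \<in> vspace M" for v
    using mod_homD(5)[OF f, of "E v"] mod_homD(4)[OF f that] by simp
  moreover have "opF N (opE N (c *\<^sub>c w)) = (c * 0) *\<^sub>c w" for c using w by (simp add: op_simps)
  ultimately obtain c where c: "prod_op T ms y \<in> vspace M" "c \<noteq> 0" "f (prod_op T ms y) = c *\<^sub>c w"
    using prod_op_lift[OF f _ _ ms0 wt_in[OF y(1)] y(2), of T "\<lambda>v. opF N (opE N v)"] by blast
  have "wt (of_nat i) ((1 / c) *\<^sub>c prod_op T ms y)" by (intro wt_scale wt_prod_T y)
  moreover have "f ((1 / c) *\<^sub>c prod_op T ms y) = w"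
    using mod_homD(3)[OF f c(1), of "1 / c"] c(2,3) by simp
  moreover have "T (T ((1 / c) *\<^sub>c prod_op T ms y)) = 0" unfolding op_simps T2 by simp
  ultimately show ?thesis by blast
qed

section \<open>Endomorphisms of X at parameter zero\<close>

context X_setup
begin

lemma Fn_H: "k \<le> i \<Longrightarrow> (F ^^ k) (Hv 0) = Hv k"
proof (induction k)
  case (Suc k)
  then have k: "k \<le> i" "k < i" by auto
  have "(F ^^ k) (Hv 0) = Hv k" by (rule Suc.IH[OF k(1)])
  then have "(F ^^ Suc k) (Hv 0) = Hv (Suc k)" by (simp add: F_H(2)[OF k(2)])
  then show ?case .
qed simp

lemma Fn_S: "k \<le> i \<Longrightarrow> (F ^^ k) (S 0) = S k"
proof (induction k)
  case (Suc k)
  then have k: "k \<le> i" "k < i" by auto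
  have "(F ^^ k) (S 0) = S k" by (rule Suc.IH[OF k(1)])
  then have "(F ^^ Suc k) (S 0) = S (Suc k)" by (simp add: F_S(2)[OF k(2)])
  then show ?case .
qed simp

lemma Fn_L: "k \<le> r - 2 - i \<Longrightarrow> (F ^^ (Suc i + k)) (Hv 0) = L k"
proof (induction k)
  case 0
  have "(F ^^ i) (Hv 0) = Hv i" by (rule Fn_H) simp
  then have "(F ^^ (Suc i + 0)) (Hv 0) = L 0" by (simp add: F_H(1))
  then show ?case .
next
  case (Suc k)
  then have k: "k \<le> r - 2 - i" "k < r - 2 - i" by auto
  have "(F ^^ (Suc i + k)) (Hv 0) = L k" by (rule Suc.IH[OF k(1)])
  then have "(F ^^ (Suc i + Suc k)) (Hv 0) = L (Suc k)" by (simp add: F_L(2)[OF k(2)])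
  then show ?case .
qed

end

text \<open>Here \<open>j = 1 + d n\<close>, where \<open>n\<close> sends \<open>w\<^sup>H\<close> to \<open>w\<^sup>S\<close> and kills the other strings, so that \<open>n\<^sup>2 = 0\<close>.\<close>

lemma X0_endo_injective:
  fixes r i :: nat
  defines "X \<equiv> X_mod r i 0 0"
  assumes r: "2 \<le> r" and i: "i \<le> r - 2" and j: "mod_hom X X j"
    and jH: "j (bvec (wH 0)) = bvec (wH 0) + d *\<^sub>c bvec (wS 0)"
    and v: "v \<in> vspace X" and jv: "j v = 0"
  shows "v = 0"
proof -
  interpret x: X_setup r i 0 0 by unfold_locales (use r i in auto)
  have a0: "x.a = 0" and sg1: "x.sg = 1" by (simp_all add: x.a_def x.sg_def)
  note X = X_def[symmetric]
  have H0: "bvec (wH 0) \<in> vspace X" by (simp add: X_def vspace_def)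
  have pw: "j ((opF X ^^ n) w) = (opF X ^^ n) (j w) \<and> (opF X ^^ n) w \<in> vspace X"
    "j ((opE X ^^ n) w) = (opE X ^^ n) (j w) \<and> (opE X ^^ n) w \<in> vspace X" if w: "w \<in> vspace X" for n w
  proof -
    show "j ((opF X ^^ n) w) = (opF X ^^ n) (j w) \<and> (opF X ^^ n) w \<in> vspace X"
    proof (induction n)
      case (Suc n)
      then have IH: "j ((opF X ^^ n) w) = (opF X ^^ n) (j w)" "(opF X ^^ n) w \<in> vspace X" by blast+
      have "j ((opF X ^^ Suc n) w) = (opF X ^^ Suc n) (j w) \<and> (opF X ^^ Suc n) w \<in> vspace X"
        using mod_homD(5)[OF j IH(2)] x.uqX.closed(2) by (simp add: IH(1) X)
      then show ?case .
    qed (use w in simp)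
    show "j ((opE X ^^ n) w) = (opE X ^^ n) (j w) \<and> (opE X ^^ n) w \<in> vspace X"
    proof (induction n)
      case (Suc n)
      then have IH: "j ((opE X ^^ n) w) = (opE X ^^ n) (j w)" "(opE X ^^ n) w \<in> vspace X" by blast+
      have "j ((opE X ^^ Suc n) w) = (opE X ^^ Suc n) (j w) \<and> (opE X ^^ Suc n) w \<in> vspace X"
        using mod_homD(4)[OF j IH(2)] x.uqX.closed(1) by (simp add: IH(1) X)
      then show ?case .
    qed (use w in simp)
  qed
  define n where "n b = (case b of wH k \<Rightarrow> bvec (wS k) | _ \<Rightarrow> 0)" for b :: x_label
  have EH: "opE X (bvec (wH 0)) = bvec (wR 0)" unfolding X_def x.E_H_0 sg1 by simp
  have ES: "opE X (bvec (wS 0)) = 0" unfolding X_def x.E_S_0 a0 by simp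
  have FR: "opF X (bvec (wR 0)) = bvec (wS 0)" unfolding X_def x.F_R_0 a0 by simp
  have R0: "bvec (wR 0) \<in> vspace X" and S0: "bvec (wS 0) \<in> vspace X" by (simp_all add: X_def vspace_def)
  \<comment> \<open>\<open>E\<close> kills \<open>wS 0\<close> at \<epsilon> = 0, so the d-term
    disappears and \<open>wR 0\<close> is fixed. Then \<open>wS 0\<close>, being F of
    \<open>wR 0\<close>, is fixed as well.\<close>
  have jR: "j (bvec (wR 0)) = bvec (wR 0)"
    using mod_homD(4)[OF j H0] unfolding EH jH op_simps ES by simp
  have jS: "j (bvec (wS 0)) = bvec (wS 0)"
    using mod_homD(5)[OF j R0] unfolding FR jR .
  have FiS: "(opF X ^^ i) (bvec (wS 0)) = bvec (wS i)" unfolding X_def by (rule x.Fn_S) simp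
  have FSi: "opF X (bvec (wS i)) = 0" unfolding X_def x.F_S(1) a0 by simp
  have jb: "j (bvec b) = bvec b + d *\<^sub>c n b" if b: "b \<in> basis X" for b
  proof (cases b)
    case (wL k)
    then have k: "k \<le> r - 2 - i" using b unfolding X_def by simp
    have e: "(opF X ^^ (Suc i + k)) (bvec (wH 0)) = bvec (wL k)" unfolding X_def by (rule x.Fn_L[OF k])
    \<comment> \<open>The S string ends after i steps of \<open>F\<close>, so the d-term does not
      reach the L string.\<close>
    have "(opF X ^^ (k + Suc i)) (bvec (wS 0)) = (opF X ^^ k) (opF X ((opF X ^^ i) (bvec (wS 0))))"
      by (simp only: funpow_add funpow.simps comp_apply)
    then have "(opF X ^^ (Suc i + k)) (bvec (wS 0)) = 0"
      by (simp only: FiS FSi funpow_op_simps add.commute)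
    then have "j (bvec (wL k)) = bvec (wL k)"
      using pw(1)[OF H0, of "Suc i + k"] unfolding e jH funpow_op_simps by simp
    then show ?thesis unfolding wL n_def by simp
  next
    case (wH k)
    then have k: "k \<le> i" using b unfolding X_def by simp
    have e: "(opF X ^^ k) (bvec (wH 0)) = bvec (wH k)" "(opF X ^^ k) (bvec (wS 0)) = bvec (wS k)"
      unfolding X_def by (rule x.Fn_H[OF k], rule x.Fn_S[OF k])
    have "j (bvec (wH k)) = bvec (wH k) + d *\<^sub>c bvec (wS k)"
      using pw(1)[OF H0, of k] unfolding e jH funpow_op_simps by simp
    then show ?thesis unfolding wH n_def by simp
  next
    case (wS k)
    then have k: "k \<le> i" using b unfolding X_def by simp
    have e: "(opF X ^^ k) (bvec (wS 0)) = bvec (wS k)" unfolding X_def by (rule x.Fn_S[OF k])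
    have "j (bvec (wS k)) = bvec (wS k)"
      using pw(1)[OF S0, of k] unfolding jS e by simp
    then show ?thesis unfolding wS n_def by simp
  next
    case (wR k)
    then have k: "k \<le> r - 2 - i" using b unfolding X_def by simp
    have e: "(opE X ^^ k) (bvec (wR 0)) = bvec (wR k)" using k
    proof (induction k)
      case (Suc k)
      then have k: "k \<le> r - 2 - i" "k < r - 2 - i" by auto
      have "(opE X ^^ k) (bvec (wR 0)) = bvec (wR k)" by (rule Suc.IH[OF k(1)])
      then have "(opE X ^^ Suc k) (bvec (wR 0)) = bvec (wR (Suc k))"
        using x.E_R(2)[OF k(2)] unfolding X sg1 by simp
      then show ?case .
    qed simp
    have "j (bvec (wR k)) = bvec (wR k)"
      using pw(2)[OF R0, of k] unfolding jR e by simp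
    then show ?thesis unfolding wR n_def by simp
  qed
  have fX: "finite (basis X)" unfolding X_def by (rule x.fin)
  let ?N = "lin_ext (basis X) n"
  have jN: "j w = w + d *\<^sub>c ?N w" if w: "w \<in> vspace X" for w
  proof -
    have "j w = lin_ext (basis X) (\<lambda>b. j (bvec b)) w" by (rule mod_hom_eq_on[OF j fX w])
    also have "\<dots> = w + d *\<^sub>c ?N w"
    proof (rule clin_eqI[OF fX clin_lin_ext _ w[unfolded vspace_def]])
      show "clin (\<lambda>w. w + d *\<^sub>c ?N w)"
        by (rule clinI) (simp_all add: lin_ext_simps fun_eq_iff algebra_simps)
      fix b assume b: "b \<in> basis X"
      show "lin_ext (basis X) (\<lambda>b. j (bvec b)) (bvec b) = bvec b + d *\<^sub>c ?N (bvec b)"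
        unfolding lin_ext_bvec[OF fX b] by (rule jb[OF b])
    qed
    finally show ?thesis .
  qed
  have NN: "?N (?N v) = 0"
  proof (rule clin_eqI[OF fX clin_comp[OF clin_lin_ext clin_lin_ext] clin_zero v[unfolded vspace_def]])
    fix b assume b: "b \<in> basis X"
    have "?N (n b) = 0"
    proof (cases b)
      case (wH k)
      then have "wS k \<in> basis X" using b unfolding X_def by simp
      then have "?N (bvec (wS k)) = n (wS k)" by (rule lin_ext_bvec[OF fX])
      moreover have "n b = bvec (wS k)" "n (wS k) = 0" by (simp_all add: n_def wH)
      ultimately show ?thesis by (simp only:)
    qed (simp_all add: n_def lin_ext_simps)
    then show "?N (?N (bvec b)) = 0" unfolding lin_ext_bvec[OF fX b] .
  qed
  \<comment> \<open>Applying the square-zero map to this equation removes its second term, leaving n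
    v = 0 and hence v = 0.\<close>
  have "v + d *\<^sub>c ?N v = 0" using jN[OF v] jv by simp
  then have "?N (v + d *\<^sub>c ?N v) = 0" by (simp only: lin_ext_simps)
  then have "?N v = 0" unfolding lin_ext_simps NN by simp
  with \<open>v + d *\<^sub>c ?N v = 0\<close> show ?thesis by simp
qed

section \<open>Identification with the projective cover\<close>

lemma projective_cover_iso:
  fixes r i :: nat and Q :: "'p qmod" and S :: "'s qmod"
  defines "X \<equiv> X_mod r i 0 0"
  assumes r: "2 \<le> r" and i: "i \<le> r - 2" and S: "is_S r i S" and Q: "projective_cover r Q S"
  shows "X \<cong>\<^sub>m Q"
proof -
  interpret x: X_setup r i 0 0 by unfold_locales (use r i in auto)
  have S': "weight_module r S" "uqH_module r S" "simple_mod S"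
    using S by (simp_all add: is_S_def weight_module_def)
  obtain v where v: "v \<in> vspace S" "v \<noteq> 0" "opE S v = 0" "opH S v = of_nat i *\<^sub>c v"
    using S unfolding is_S_def by blast
  have Q': "projective_in_C r Q" "weight_module r Q" "uqH_module r Q"
  proof -
    show 1: "projective_in_C r Q" using Q unfolding projective_cover_def by (rule conjunct1)
    then show 2: "weight_module r Q" unfolding projective_in_C_def by (rule conjunct1)
    then show "uqH_module r Q" unfolding weight_module_def by (rule conjunct1)
  qed
  have "\<exists>p. mod_hom Q S p \<and> p ` vspace Q = vspace S \<and>
      (\<forall>U. submod Q U \<and> vspace Q = {u + k | u k. u \<in> U \<and> k \<in> vspace Q \<and> p k = 0} \<longrightarrow> U = vspace Q)"
    using Q unfolding projective_cover_def by (elim conjE)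
  then obtain p where pc: "mod_hom Q S p \<and> p ` vspace Q = vspace S \<and>
      (\<forall>U. submod Q U \<and> vspace Q = {u + k | u k. u \<in> U \<and> k \<in> vspace Q \<and> p k = 0} \<longrightarrow> U = vspace Q)"
    by (rule exE)
  note p = pc[THEN conjunct1] pc[THEN conjunct2, THEN conjunct1]
  note cover = pc[THEN conjunct2, THEN conjunct2, rule_format, OF conjI]
  interpret q: uqH r Q by unfold_locales (rule r, rule Q')
  interpret s: uqH r S by unfold_locales (rule r, rule S')
  have X': "uqH_module r X" "weight_module r X" unfolding X_def by (rule x.module_X)+
  have wH0: "wH 0 \<in> basis X" and H0: "bvec (wH 0) \<in> vspace X" by (simp_all add: X_def vspace_def)
  have fX: "finite (basis X)" unfolding X_def by (rule x.fin)

  have "v \<in> p ` vspace Q" unfolding p(2) by (rule v(1))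
  then obtain z where z: "z \<in> vspace Q" "p z = v" by (elim imageE) simp
  obtain y0 where y0: "weight_vec r Q (of_nat i) y0" "p y0 = v"
    using weight_lift[OF r Q'(2) p(1) v(4) z] by blast
  obtain y where y: "weight_vec r Q (of_nat i) y" "p y = v" "opF Q (opE Q (opF Q (opE Q y))) = 0"
    using T_nilpotent_lift[OF r i Q'(3) p(1) v(3) y0] by blast
  define k where "k = lin_ext (basis X) (q.X_map i y)"
  have k: "mod_hom X Q k"
    unfolding k_def X_def
    by (rule q.mod_hom_X_map[OF i y(1) q.EFE_zero[OF i y(1,3)] q.E_power_zero[OF i y(1,3)] q.F_power_zero[OF i y(1,3)]])
  have kH: "k (bvec (wH 0)) = y" unfolding k_def by (simp add: fX wH0)
  have pk: "(\<lambda>w. p (k w)) ` vspace X = vspace S"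
    by (rule simple_mod_surj[OF r X'(1) mod_hom_comp[OF k p(1)] S'(3) H0]) (simp add: kH y(2) v(2))
  \<comment> \<open>The composite of k with p already maps onto S, so the image of k together with
    the kernel of p fills Q; the cover being essential, the image is all of Q.\<close>
  have k_surj: "k ` vspace X = vspace Q"
  proof (rule cover)
    show sub: "submod Q (k ` vspace X)" by (rule submod_image[OF r X'(1) k])
    show "vspace Q = {u + w | u w. u \<in> k ` vspace X \<and> w \<in> vspace Q \<and> p w = 0}"
    proof (intro equalityI subsetI)
      fix u assume u: "u \<in> vspace Q"
      then have "p u \<in> vspace S" by (rule mod_homD(1)[OF p(1)])
      then have "p u \<in> (\<lambda>w. p (k w)) ` vspace X" by (simp only: pk)
      then obtain w where w: "w \<in> vspace X" "p u = p (k w)" by (elim imageE)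
      have kw: "k w \<in> vspace Q" by (rule mod_homD(1)[OF k w(1)])
      have "p (u - k w) = 0" unfolding mod_hom_diff[OF p(1) u kw] w(2) by simp
      moreover have "u - k w \<in> vspace Q" by (rule vspace_closed(3)[OF u kw])
      moreover have "u = k w + (u - k w)" by simp
      ultimately show "u \<in> {u + w | u w. u \<in> k ` vspace X \<and> w \<in> vspace Q \<and> p w = 0}" using w(1) by blast
    next
      fix u assume "u \<in> {u + w | u w. u \<in> k ` vspace X \<and> w \<in> vspace Q \<and> p w = 0}"
      then show "u \<in> vspace Q" using mod_homD(1)[OF k] vspace_closed(2) by blast
    qed
  qed

  \<comment> \<open>A second map, g from X onto S with \<open>wH 0\<close> sent to v, is built in
    order to lift p through it.\<close>
  have wv: "weight_vec r S (of_nat i) v"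
    using s.wtI[OF v(1,4)] S'(1) v(1,4) unfolding weight_module_def by blast
  define g where "g = lin_ext (basis X) (s.X_map i v)"
  have "(opE S ^^ (r - i)) v = (opE S ^^ (r - Suc i)) (opE S v)"
  proof -
    have "r - i = Suc (r - Suc i)" using r i by simp
    then show ?thesis by (simp only: funpow_Suc_right comp_apply)
  qed
  then have Ev: "(opE S ^^ (r - i)) v = 0" unfolding v(3) funpow_op_simps .
  have g: "mod_hom X S g"
    unfolding g_def X_def
    by (rule s.mod_hom_X_map[OF i wv _ Ev]) (simp_all only: v(3) op_simps funpow_op_simps)
  have gH: "g (bvec (wH 0)) = v" unfolding g_def by (simp add: fX wH0)
  have gS: "g (bvec (wS 0)) = 0"
  proof -
    have "g (bvec (wS 0)) = s.X_map i v (wS 0)"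
      unfolding g_def by (rule lin_ext_bvec[OF fX]) (simp add: X_def)
    then show ?thesis unfolding s.X_map.simps v(3) op_simps funpow_op_simps .
  qed
  have g_surj: "g ` vspace X = vspace S"
    by (rule simple_mod_surj[OF r X'(1) g S'(3) H0]) (simp add: gH v(2))
  obtain h where h: "mod_hom Q X h" "\<And>w. w \<in> vspace Q \<Longrightarrow> g (h w) = p w"
    using projective_lift[OF r Q'(1) X'(2) S'(1) g g_surj p(1)] by blast

  define z0 where "z0 = h y"
  have yQ: "y \<in> vspace Q" using y(1) by (simp add: weight_vec_def)
  have z0: "z0 \<in> vspace X" "opH X z0 = of_nat i *\<^sub>c z0"
    using mod_homD(1,8,3)[OF h(1) yQ] y(1) unfolding z0_def weight_vec_def by metis+
  \<comment> \<open>The weight i occurs in X at \<open>wH 0\<close> and \<open>wS 0\<close> only: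
    indices in L are below -i, those in R above i, and H and S take the value i only at position
    0.\<close>
  have supp: "z0 b = 0" if b: "b \<noteq> wH 0" "b \<noteq> wS 0" for b
  proof (cases "b \<in> basis X")
    case False
    then show ?thesis using z0(1) by (simp add: vspace_def free_space_def)
  next
    case True
    have "opH X z0 b = (\<Sum>b'\<in>basis X. z0 b' * (of_int (x_index i b') * bvec b' b))"
      unfolding opH_def lin_ext_def sum_fun_apply scale_apply by (simp add: X_def X_mod_def)
    also have "\<dots> = (\<Sum>b'\<in>basis X. if b' = b then z0 b * of_int (x_index i b) else 0)"
      by (rule sum.cong) (auto simp: bvec_def)
    also have "\<dots> = z0 b * of_int (x_index i b)" using fX True by simp
    finally have "z0 b * (of_int (x_index i b) - of_nat i) = 0" unfolding z0(2) by (auto simp: algebra_simps)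
    moreover have "x_index i b \<noteq> int i" using b by (cases b) auto
    then have "of_int (x_index i b) - of_nat i \<noteq> (0 :: complex)"
      by (metis of_int_eq_iff of_int_of_nat_eq right_minus_eq)
    ultimately show ?thesis by simp
  qed
  define d where "d = z0 (wS 0)"
  have z0_eq: "z0 = z0 (wH 0) *\<^sub>c bvec (wH 0) + d *\<^sub>c bvec (wS 0)"
    using supp by (auto simp: fun_eq_iff bvec_def d_def)
  have S0: "bvec (wS 0) \<in> vspace X" by (simp add: X_def vspace_def)
  have "v = g z0" using h(2)[OF yQ] unfolding z0_def y(2) by (rule sym)
  also have "\<dots> = g (z0 (wH 0) *\<^sub>c bvec (wH 0) + d *\<^sub>c bvec (wS 0))" using z0_eq by (rule arg_cong)
  \<comment> \<open>As g kills \<open>wS 0\<close>, comparing g (h y) = p y = v forces the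
    coefficient of \<open>wH 0\<close> to be 1.\<close>
  also have "\<dots> = z0 (wH 0) *\<^sub>c v"
    unfolding mod_homD(2)[OF g vspace_closed(4)[OF H0] vspace_closed(4)[OF S0]]
      mod_homD(3)[OF g H0] mod_homD(3)[OF g S0] gH gS by simp
  finally have "(z0 (wH 0) - 1) *\<^sub>c v = 0" by (simp add: fun_eq_iff algebra_simps)
  then have "z0 (wH 0) = 1" using v(2) by (metis cvec.scale_eq_0_iff right_minus_eq)
  then have hkH: "h (k (bvec (wH 0))) = bvec (wH 0) + d *\<^sub>c bvec (wS 0)"
    using z0_eq unfolding kH z0_def by simp
  have "inj_on k (vspace X)"
  proof (rule inj_onI)
    fix u w assume u: "u \<in> vspace X" and w: "w \<in> vspace X" and "k u = k w"
    then have "k (u - w) = 0" using mod_hom_diff[OF k u w] by simp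
    then have "h (k (u - w)) = 0" using mod_hom_zero[OF h(1)] by simp
    then have "u - w = 0"
      using X0_endo_injective[OF r i, of "\<lambda>w. h (k w)" d "u - w"] mod_hom_comp[OF k h(1)] hkH
        vspace_closed(3)[OF u w] unfolding X_def by blast
    then show "u = w" by simp
  qed
  with k_surj k show ?thesis unfolding mod_iso_def bij_betw_def by (intro exI[of _ k] conjI)
qed

section \<open>Twisting by a one-dimensional module\<close>

text \<open>Passing from l = 0 to general l has the same effect on both sides: \<open>E\<close>,
  \<open>K\<close> and the inverse of \<open>K\<close> are multiplied by (-1)^l, \<open>F\<close> is
  unchanged, and l r is added to \<open>H\<close>.\<close>

lemma X_iso_tensor:
  fixes r i :: nat and l :: int and Q :: "'p qmod"
  assumes r: "2 \<le> r" and i: "i \<le> r - 2" and Q: "finite (basis Q)" and iso: "X_mod r i 0 0 \<cong>\<^sub>m Q"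
  shows "X_mod r i l 0 \<cong>\<^sub>m Q \<otimes>\<^sub>m CH_mod r l"
proof -
  let ?X = "X_mod r i l 0" and ?Y = "X_mod r i 0 0" and ?C = "Q \<otimes>\<^sub>m CH_mod r l"
  obtain k where k: "mod_hom ?Y Q k" "bij_betw k (vspace ?Y) (vspace Q)"
    using iso by (auto simp: mod_iso_def)
  define \<sigma> :: complex where "\<sigma> = (-1) powi l"
  have q: "qpow r (of_int l * of_nat r) = \<sigma>" "qpow r (- (of_int l * of_nat r)) = \<sigma>"
    using qpow_int_mult_r[of r l] qpow_int_mult_r[of r "- l"] r
    by (auto simp: \<sigma>_def power_int_minus power_int_minus_left)
  have B: "basis ?X = basis ?Y" "vspace ?X = vspace ?Y" by (simp_all add: X_mod_def vspace_def)
  have xE: "x_E r i l 0 b = \<sigma> *\<^sub>c x_E r i 0 0 b" for b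
    by (cases b) (auto simp: \<sigma>_def power_int_add fun_eq_iff algebra_simps)
  have opX: "opE ?X v = \<sigma> *\<^sub>c opE ?Y v" "opF ?X v = opF ?Y v" "opK ?X v = \<sigma> *\<^sub>c opK ?Y v"
    "opKi ?X v = \<sigma> *\<^sub>c opKi ?Y v" "opH ?X v = opH ?Y v + (of_int l * of_nat r) *\<^sub>c v"
    if v: "v \<in> vspace ?Y" for v
  proof -
    have sc: "lin_ext A (\<lambda>b. c *\<^sub>c f b) v = c *\<^sub>c lin_ext A f v" for A c and f :: "x_label \<Rightarrow> x_label vec"
      by (simp add: lin_ext_def fun_eq_iff sum_distrib_left algebra_simps)
    have ad: "lin_ext A (\<lambda>b. f b + g b) v = lin_ext A f v + lin_ext A g v" for A and f g :: "x_label \<Rightarrow> x_label vec"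
      by (simp add: lin_ext_def fun_eq_iff sum.distrib algebra_simps)
    have "actE ?X = (\<lambda>b. \<sigma> *\<^sub>c actE ?Y b)" by (rule ext) (simp add: X_mod_def xE)
    then show "opE ?X v = \<sigma> *\<^sub>c opE ?Y v" unfolding opE_def B by (simp only: sc)
    show "opF ?X v = opF ?Y v" unfolding opF_def B by (simp add: X_mod_def)
    have "actK ?X = (\<lambda>b. \<sigma> *\<^sub>c actK ?Y b)" "actKi ?X = (\<lambda>b. \<sigma> *\<^sub>c actKi ?Y b)"
      by (simp_all add: X_mod_def \<sigma>_def)
    then show "opK ?X v = \<sigma> *\<^sub>c opK ?Y v" "opKi ?X v = \<sigma> *\<^sub>c opKi ?Y v"
      unfolding opK_def opKi_def B by (simp_all only: sc)
    have "actH ?X = (\<lambda>b. actH ?Y b + (of_int l * of_nat r) *\<^sub>c bvec b)"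
      by (simp add: X_mod_def fun_eq_iff algebra_simps)
    moreover have "lin_ext (basis ?Y) bvec v = v"
      using free_space_expand[OF _ v[unfolded vspace_def]] by (simp add: lin_ext_def X_mod_def)
    ultimately show "opH ?X v = opH ?Y v + (of_int l * of_nat r) *\<^sub>c v"
      unfolding opH_def B by (simp only: sc ad)
  qed
  \<comment> \<open>The second factor has a one-point basis, so the tensor product is identified
    with the first factor.\<close>
  define t :: "'p vec \<Rightarrow> ('p \<times> unit) vec" where "t u = (\<lambda>(b, _). u b)" for u
  have tlin: "t (u + w) = t u + t w" "t (c *\<^sub>c u) = c *\<^sub>c t u" for u w c
    by (auto simp: t_def fun_eq_iff)
  have tv: "t u \<in> vspace ?C \<longleftrightarrow> u \<in> vspace Q" for u
    by (auto simp: t_def vspace_def free_space_def tensor_mod_def CH_mod_def)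
  have opC: "opE ?C (t u) = \<sigma> *\<^sub>c t (opE Q u)" "opF ?C (t u) = t (opF Q u)" "opK ?C (t u) = \<sigma> *\<^sub>c t (opK Q u)"
    "opKi ?C (t u) = \<sigma> *\<^sub>c t (opKi Q u)" "opH ?C (t u) = t (opH Q u) + (of_int l * of_nat r) *\<^sub>c t u"
    if u: "u \<in> vspace Q" for u
  proof -
    have BC: "basis ?C = basis Q \<times> UNIV" by (simp add: tensor_mod_def CH_mod_def)
    have sumU: "(\<Sum>x\<in>basis Q \<times> (UNIV :: unit set). G x) = (\<Sum>b\<in>basis Q. G (b, ()))" for G :: "'p \<times> unit \<Rightarrow> complex"
      by (rule sum.reindex_bij_witness[of _ "\<lambda>b. (b, ())" fst]) auto
    have ext: "lin_ext (basis ?C) act (t u) = c *\<^sub>c t (lin_ext (basis Q) A u)"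
      if "\<And>b. act (b, ()) = c *\<^sub>c t (A b)" for act c A
      by (simp add: lin_ext_def BC sumU fun_eq_iff that)
        (simp add: t_def sum_distrib_left mult.left_commute)
    have ext1: "lin_ext (basis ?C) act (t u) = t (lin_ext (basis Q) A u)"
      if "\<And>b. act (b, ()) = t (A b)" for act A
      using ext[of act 1 A] that by (simp add: fun_eq_iff)
    note ten = tensor_mod_def CH_mod_def tensor_vec_def t_def bvec_def q
    show "opE ?C (t u) = \<sigma> *\<^sub>c t (opE Q u)"
      unfolding opE_def by (rule ext) (auto simp: ten fun_eq_iff)
    show "opF ?C (t u) = t (opF Q u)"
      unfolding opF_def by (rule ext1) (auto simp: ten fun_eq_iff)
    show "opK ?C (t u) = \<sigma> *\<^sub>c t (opK Q u)"
      unfolding opK_def by (rule ext) (auto simp: ten fun_eq_iff)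
    show "opKi ?C (t u) = \<sigma> *\<^sub>c t (opKi Q u)"
      unfolding opKi_def by (rule ext) (auto simp: ten fun_eq_iff)
    have "opH ?C (t u) = t (lin_ext (basis Q) (\<lambda>b. actH Q b + (of_int l * of_nat r) *\<^sub>c bvec b) u)"
      unfolding opH_def by (rule ext1) (auto simp: ten fun_eq_iff)
    also have "lin_ext (basis Q) (\<lambda>b. actH Q b + (of_int l * of_nat r) *\<^sub>c bvec b) u
        = opH Q u + (of_int l * of_nat r) *\<^sub>c lin_ext (basis Q) bvec u"
      by (simp add: opH_def lin_ext_def fun_eq_iff sum.distrib sum_distrib_left algebra_simps)
    also have "lin_ext (basis Q) bvec u = u"
      using free_space_expand[OF Q u[unfolded vspace_def]] by (simp add: lin_ext_def)
    finally show "opH ?C (t u) = t (opH Q u) + (of_int l * of_nat r) *\<^sub>c t u" unfolding tlin .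
  qed
  have "mod_hom ?X ?C (\<lambda>v. t (k v))"
    unfolding mod_hom_def B
  proof (intro conjI ballI allI)
    fix v assume v: "v \<in> vspace ?Y"
    note kv = mod_homD[OF k(1) v] and Q' = mod_homD(1)[OF k(1) v]
    have cl: "opE ?Y v \<in> vspace ?Y" "opF ?Y v \<in> vspace ?Y" "opK ?Y v \<in> vspace ?Y"
      "opKi ?Y v \<in> vspace ?Y" "opH ?Y v \<in> vspace ?Y"
    proof -
      interpret x: X_setup r i 0 0 by unfold_locales (use r i in auto)
      show "opE ?Y v \<in> vspace ?Y" "opF ?Y v \<in> vspace ?Y" "opK ?Y v \<in> vspace ?Y"
        "opKi ?Y v \<in> vspace ?Y" "opH ?Y v \<in> vspace ?Y" by simp_all
    qed
    show "t (k v) \<in> vspace ?C" unfolding tv by (rule kv(1))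
    show "t (k (c *\<^sub>c v)) = c *\<^sub>c t (k v)" for c unfolding kv(3) tlin ..
    show "t (k (v + w)) = t (k v) + t (k w)" if "w \<in> vspace ?Y" for w unfolding kv(2)[OF that] tlin ..
    show "t (k (opE ?X v)) = opE ?C (t (k v))"
      unfolding opX[OF v] opC[OF Q'] mod_homD(3)[OF k(1) cl(1)] kv(4) tlin ..
    show "t (k (opF ?X v)) = opF ?C (t (k v))"
      unfolding opX[OF v] opC[OF Q'] kv(5) ..
    show "t (k (opK ?X v)) = opK ?C (t (k v))"
      unfolding opX[OF v] opC[OF Q'] mod_homD(3)[OF k(1) cl(3)] kv(6) tlin ..
    show "t (k (opKi ?X v)) = opKi ?C (t (k v))"
      unfolding opX[OF v] opC[OF Q'] mod_homD(3)[OF k(1) cl(4)] kv(7) tlin ..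
    show "t (k (opH ?X v)) = opH ?C (t (k v))"
      unfolding opX[OF v] opC[OF Q'] mod_homD(2)[OF k(1) cl(5) vspace_closed(4)[OF v]] kv(8) kv(3) tlin ..
  qed
  moreover have "bij_betw t (vspace Q) (vspace ?C)"
  proof (rule bij_betw_byWitness[where f' = "\<lambda>w b. w (b, ())"])
    show "t ` vspace Q \<subseteq> vspace ?C" using tv by blast
    show "(\<lambda>w b. w (b, ())) ` vspace ?C \<subseteq> vspace Q"
      by (auto simp: vspace_def free_space_def tensor_mod_def CH_mod_def)
  qed (auto simp: t_def)
  then have "bij_betw (\<lambda>v. t (k v)) (vspace ?X) (vspace ?C)"
    using bij_betw_trans[OF k(2)] unfolding B comp_def by blast
  ultimately show ?thesis unfolding mod_iso_def by blast
qed

section \<open>The module structure and the two cases of the parameter\<close>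

theorem theorem4:
  fixes r i :: nat and l :: int and \<epsilon> :: real
  assumes r: "r \<ge> 2" and i: "i \<le> r - 2" and \<epsilon>: "-1/2 < \<epsilon>" "\<epsilon> < 1/2"
  shows "uqH_module r (X_mod r i l (of_real \<epsilon>))
     \<and> (\<epsilon> \<noteq> 0 \<longrightarrow>
          X_mod r i l (of_real \<epsilon>) \<cong>\<^sub>m
            V_mod r (1 + of_nat i - of_nat r + of_int l * of_nat r + of_real \<epsilon>) \<oplus>\<^sub>m
            V_mod r (- 1 - of_nat i + of_nat r + of_int l * of_nat r + of_real \<epsilon>))
     \<and> (\<epsilon> = 0 \<longrightarrow>
          (\<forall>(S\<^sub>i :: 's qmod) (P\<^sub>i :: 'p qmod). is_S r i S\<^sub>i \<and> projective_cover r P\<^sub>i S\<^sub>i \<longrightarrow>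
             X_mod r i l (of_real \<epsilon>) \<cong>\<^sub>m P\<^sub>i \<otimes>\<^sub>m CH_mod r l))"
proof (intro conjI impI allI)
  interpret X_setup r i l "of_real \<epsilon>" by unfold_locales (use r i in auto)
  show "uqH_module r X" by (rule module_X(1))
  assume nz: "\<epsilon> \<noteq> 0"
  have "qnum r (of_real \<epsilon>) \<noteq> 0"
    by (rule qnum_nonzero) (use r nz \<epsilon> in auto)
  moreover have "qnum r (of_nat (1 + i)) \<noteq> 0"
    by (rule qnum_nat_nonzero) (use r i in auto)
  ultimately have "a \<noteq> 0" unfolding a_def by simp
  \<comment> \<open>For k < r - 2 - i the number 2 + i + k lies strictly between 0 and r, and so
    does k + 1 + \<epsilon> because \<epsilon> is less than 1/2 in absolute value.\<close>
  moreover have "qnum r (2 + of_nat i + of_nat k) * qnum r (of_nat k + 1 + of_real \<epsilon>) \<noteq> 0" if "k < r - 2 - i" for k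
  proof -
    have "qnum r (of_nat (2 + i + k)) \<noteq> 0"
      by (rule qnum_nat_nonzero) (use r that in auto)
    moreover have "qnum r (of_real (real k + 1 + \<epsilon>)) \<noteq> 0"
      by (rule qnum_nonzero) (use r \<epsilon> that in auto)
    ultimately show ?thesis by (simp add: add.assoc)
  qed
  ultimately show "X \<cong>\<^sub>m V_mod r (1 + of_nat i - of_nat r + of_int l * of_nat r + of_real \<epsilon>) \<oplus>\<^sub>m
            V_mod r (- 1 - of_nat i + of_nat r + of_int l * of_nat r + of_real \<epsilon>)"
    by (rule X_iso_V_sum)
next
  fix S\<^sub>i :: "'s qmod" and P\<^sub>i :: "'p qmod"
  assume "\<epsilon> = 0" and SP: "is_S r i S\<^sub>i \<and> projective_cover r P\<^sub>i S\<^sub>i"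
  have "finite (basis P\<^sub>i)"
    using SP by (simp add: projective_cover_def projective_in_C_def weight_module_def uqH_module_def)
  then have "X_mod r i l 0 \<cong>\<^sub>m P\<^sub>i \<otimes>\<^sub>m CH_mod r l"
    using X_iso_tensor[OF r i] projective_cover_iso[OF r i] SP by blast
  then show "X_mod r i l (of_real \<epsilon>) \<cong>\<^sub>m P\<^sub>i \<otimes>\<^sub>m CH_mod r l"
    using \<open>\<epsilon> = 0\<close> by simp
qed

end
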